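(* Let $(M,\mathcal F)$ be a compact minimal lamination by hyperbolic surfaces that has a (non-zero) holonomy-invariant measure. Then the right action of the affine group $B$ on its laminated unit tangent bundle $\hat M$ is minimal, i.e. every $B$-orbit is dense in $\hat M$.
   Context: A compact lamination by hyperbolic surfaces $(M,\mathcal F)$ is a compact metrizable space $M$ with a family $\{(U_\alpha,\varphi_\alpha)\}$ such that $\{U_\alpha\}$ is an open covering of $M$; $\varphi_\alpha:U_\alpha\to D_\alpha\times T_\alpha$ is a homeomorphism, with $D_\alpha$ a bounded open disk in the Poincaré upper half plane $\mathbb H$ and $T_\alpha$ a topological space; and for $(y,t)\in\varphi_\beta(U_\alpha\cap U_\beta)$, $\varphi_\alpha\circ\varphi_\beta^{-1}(y,t)=(g_{\alpha\beta}(t)y,h_{\alpha\beta}(t))$ with $g_{\alpha\beta}(t)\in PSL(2,\mathbb R)$. (Then $h_{\alpha\beta}$ is a homeomorphism between open subsets of $T_\beta$ and $T_\alpha$, and $g_{\alpha\beta}$ is continuous in $t$.) The plaques $\varphi_\alpha^{-1}(D_\alpha\times\{t\})$ glue together to form maximal connected hyperbolic surfaces called leaves; $\mathcal F$ is the partition of $M$ into leaves. The lamination is minimal if all leaves are dense in $M$. A transversal is a set $\varphi_\alpha^{-1}(\{y\}\times T_\alpha)$. A holonomy-invariant measure is a family of Radon measures on all transversals (not all zero) which are invariant under the maps $h_{\alpha\beta}$ restricted to their domains and ranges. The laminated unit tangent bundle is $\hat M=\bigcup_{x\in M}T^1_x\mathcal F$, where $T^1_x\mathcal F$ is the set of unit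 vectors at $x$ tangent to the leaf through $x$. It is topologized by the charts $\psi_\alpha$, with values in $T^1D_\alpha\times T_\alpha$, given by the leafwise differentials of $\varphi_\alpha$. Identify $T^1\mathbb H$ with $PSL(2,\mathbb R)$ as usual ($g\leftrightarrow g_*w_0$, $w_0$ the upward unit vector at $i$). Then the transition maps are $(g,t)\mapsto(g_{\alpha\beta}(t)g,h_{\alpha\beta}(t))$, so right multiplication in the charts defines a continuous right action of $PSL(2,\mathbb R)$ on $\hat M$, whose orbits are the unit tangent bundles $T^1L$ of the leaves $L$. The affine group is the subgroup $B=\left\{\begin{pmatrix}a&b\\0&a^{-1}\end{pmatrix}: a>0,\ b\in\mathbb R\right\}$ of $PSL(2,\mathbb R)$, acting on $\hat M$ by restriction. *)

theory Defs
  imports "HOL-Analysis.Analysis"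
begin

definition psl2_rel :: "real^2^2 \<Rightarrow> real^2^2 \<Rightarrow> bool" where
  "psl2_rel A B \<longleftrightarrow> det A = 1 \<and> det B = 1 \<and> (B = A \<or> B = - A)"

lemma det_uminus_2: "det (- A) = det (A :: real^2^2)"
  by (simp add: det_2)

lemma matrix_mul_uminus_left: "(- A) ** B = - (A ** B)" for A B :: "real^2^2"
  by (simp add: matrix_matrix_mult_def vec_eq_iff sum_negf)

lemma matrix_mul_uminus_right: "A ** (- B) = - (A ** B)" for A B :: "real^2^2"
  by (simp add: matrix_matrix_mult_def vec_eq_iff sum_negf)

quotient_type psl2 = "real^2^2" / partial: psl2_rel
proof (rule part_equivpI)
  show "\<exists>A. psl2_rel A A"
    by (rule exI[of _ "mat 1"]) (simp add: psl2_rel_def)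
  show "symp psl2_rel" "transp psl2_rel"
    by (auto simp: psl2_rel_def intro!: sympI transpI)
qed

instantiation psl2 :: monoid_mult
begin

lift_definition one_psl2 :: psl2 is "mat 1"
  by (simp add: psl2_rel_def)

lift_definition times_psl2 :: "psl2 \<Rightarrow> psl2 \<Rightarrow> psl2" is "(**)"
  by (auto simp: psl2_rel_def det_mul det_uminus_2 matrix_mul_uminus_left matrix_mul_uminus_right)

instance
  by standard
    (transfer; simp add: psl2_rel_def det_mul matrix_mul_assoc matrix_mul_lid matrix_mul_rid)+

end

definition affine_group :: "psl2 set" where
  "affine_group =
     {abs_psl2 (vector [vector [a, b], vector [0, inverse a]]) | a b. a > 0}"

definition upper_half_plane :: "complex set" where
  "upper_half_plane = {z. Im z > 0}"

definition hyp_dist :: "complex \<Rightarrow> complex \<Rightarrow> real" where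
  "hyp_dist z w = arcosh (1 + (norm (z - w))\<^sup>2 / (2 * Im z * Im w))"

definition hyp_disk :: "complex \<Rightarrow> real \<Rightarrow> complex set" where
  "hyp_disk c r = {z \<in> upper_half_plane. hyp_dist c z < r}"

lift_definition moebius :: "psl2 \<Rightarrow> complex \<Rightarrow> complex" is
  "\<lambda>A z. (of_real (A$1$1) * z + of_real (A$1$2)) / (of_real (A$2$1) * z + of_real (A$2$2))"
proof -
  fix A B :: "real^2^2"
  assume "psl2_rel A B"
  then consider "B = A" | "B = - A" by (auto simp: psl2_rel_def)
  then show "(\<lambda>z. (of_real (A$1$1) * z + of_real (A$1$2)) / (of_real (A$2$1) * z + of_real (A$2$2)))
    = (\<lambda>z::complex. (of_real (B$1$1) * z + of_real (B$1$2)) / (of_real (B$2$1) * z + of_real (B$2$2)))"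
  proof cases
    case 2
    have "(- p * z + - q) / (- r * z + - s) = (p * z + q) / (r * z + s)" for p q r s z :: complex
      by (metis minus_add_distrib minus_divide_divide mult_minus_left)
    with 2 show ?thesis by simp
  qed simp
qed

text \<open>A tangent vector is a pair of a base point and a vector in \<open>\<complex>\<close>; the hyperbolic metric
  is $|dz| / \mathrm{Im}\,z$.\<close>

definition unit_tangent :: "complex set \<Rightarrow> (complex \<times> complex) set" where
  "unit_tangent D = {(z, v). z \<in> D \<inter> upper_half_plane \<and> norm v / Im z = 1}"

definition push :: "psl2 \<Rightarrow> complex \<times> complex \<Rightarrow> complex \<times> complex" where
  "push g = (\<lambda>(z, v). (moebius g z, deriv (moebius g) z * v))"

definition base_vector :: "complex \<times> complex" where
  "base_vector = (\<i>, \<i>)"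

text \<open>Right multiplication on $PSL(2,\mathbb{R})$, carried over to the unit tangent bundle of the
  upper half plane by the bijection \<open>g \<mapsto> push g base_vector\<close>.\<close>

definition right_translate :: "complex \<times> complex \<Rightarrow> psl2 \<Rightarrow> complex \<times> complex" where
  "right_translate u b = push ((THE g. push g base_vector = u) * b) base_vector"

record ('m, 'i, 't) lamination =
  ambient :: "'m topology"
  chart_dom :: "'i \<Rightarrow> 'm set"
  chart :: "'i \<Rightarrow> 'm \<Rightarrow> complex \<times> 't"
  disk :: "'i \<Rightarrow> complex set"
  trans_space :: "'i \<Rightarrow> 't topology"
  cocycle :: "'i \<Rightarrow> 'i \<Rightarrow> 't \<Rightarrow> psl2"
  holonomy :: "'i \<Rightarrow> 'i \<Rightarrow> 't \<Rightarrow> 't"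

definition chart_inv :: "('m, 'i, 't) lamination \<Rightarrow> 'i \<Rightarrow> complex \<times> 't \<Rightarrow> 'm" where
  "chart_inv L \<alpha> = inv_into (chart_dom L \<alpha>) (chart L \<alpha>)"

text \<open>The charts are indexed by the whole type \<open>'i\<close>. A transition from chart \<open>\<beta>\<close> to chart \<open>\<alpha>\<close>
  determines \<open>cocycle L \<alpha> \<beta> t\<close> and \<open>holonomy L \<alpha> \<beta> t\<close> for all \<open>t\<close> in
  \<open>holonomy_dom L \<alpha> \<beta>\<close> below; their values elsewhere are irrelevant.\<close>

definition compact_hyperbolic_lamination :: "('m, 'i, 't) lamination \<Rightarrow> bool" where
  "compact_hyperbolic_lamination L \<longleftrightarrow>
     compact_space (ambient L) \<and> metrizable_space (ambient L) \<and>
     (\<forall>\<alpha>. openin (ambient L) (chart_dom L \<alpha>)) \<and>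
     (\<Union>\<alpha>. chart_dom L \<alpha>) = topspace (ambient L) \<and>
     (\<forall>\<alpha>. \<exists>c\<in>upper_half_plane. \<exists>r>0. disk L \<alpha> = hyp_disk c r) \<and>
     (\<forall>\<alpha>. homeomorphic_map (subtopology (ambient L) (chart_dom L \<alpha>))
        (prod_topology (top_of_set (disk L \<alpha>)) (trans_space L \<alpha>)) (chart L \<alpha>)) \<and>
     (\<forall>\<alpha> \<beta> y t. (y, t) \<in> chart L \<beta> ` (chart_dom L \<alpha> \<inter> chart_dom L \<beta>) \<longrightarrow>
        chart L \<alpha> (chart_inv L \<beta> (y, t)) =
          (moebius (cocycle L \<alpha> \<beta> t) y, holonomy L \<alpha> \<beta> t))"

definition plaque :: "('m, 'i, 't) lamination \<Rightarrow> 'i \<Rightarrow> 't \<Rightarrow> 'm set" where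
  "plaque L \<alpha> t = {x \<in> chart_dom L \<alpha>. snd (chart L \<alpha> x) = t}"

text \<open>The leaf through \<open>x\<close> consists of the points joined to \<open>x\<close> by a finite chain of
  plaques, consecutive ones intersecting.\<close>

definition leaf :: "('m, 'i, 't) lamination \<Rightarrow> 'm \<Rightarrow> 'm set" where
  "leaf L x = (\<Union>\<alpha> t. plaque L \<alpha> t \<times> plaque L \<alpha> t)\<^sup>* `` {x}"

definition minimal_lamination :: "('m, 'i, 't) lamination \<Rightarrow> bool" where
  "minimal_lamination L \<longleftrightarrow>
     (\<forall>x\<in>topspace (ambient L). ambient L closure_of leaf L x = topspace (ambient L))"

definition radon_measure_on :: "'a topology \<Rightarrow> 'a measure \<Rightarrow> bool" where
  "radon_measure_on X N \<longleftrightarrow>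
     space N = topspace X \<and> sets N = sigma_sets (topspace X) {S. openin X S} \<and>
     (\<forall>x\<in>topspace X. \<exists>S. openin X S \<and> x \<in> S \<and> emeasure N S < \<infinity>) \<and>
     (\<forall>E\<in>sets N. emeasure N E = (SUP K\<in>{K \<in> sets N. compactin X K \<and> K \<subseteq> E}. emeasure N K))"

definition transversal :: "('m, 'i, 't) lamination \<Rightarrow> 'i \<Rightarrow> complex \<Rightarrow> 'm set" where
  "transversal L \<alpha> y = {x \<in> chart_dom L \<alpha>. fst (chart L \<alpha> x) = y}"

definition holonomy_dom :: "('m, 'i, 't) lamination \<Rightarrow> 'i \<Rightarrow> 'i \<Rightarrow> 't set" where
  "holonomy_dom L \<alpha> \<beta> = snd ` chart L \<beta> ` (chart_dom L \<alpha> \<inter> chart_dom L \<beta>)"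

text \<open>The map \<open>holonomy L \<alpha> \<beta>\<close>, read as a map from a transversal of the chart \<open>\<beta>\<close> to the
  transversal of the chart \<open>\<alpha>\<close> over \<open>y\<close>.\<close>

definition holonomy_map :: "('m, 'i, 't) lamination \<Rightarrow> 'i \<Rightarrow> complex \<Rightarrow> 'i \<Rightarrow> 'm \<Rightarrow> 'm" where
  "holonomy_map L \<alpha> y \<beta> x = chart_inv L \<alpha> (y, holonomy L \<alpha> \<beta> (snd (chart L \<beta> x)))"

definition holonomy_invariant_measure ::
    "('m, 'i, 't) lamination \<Rightarrow> ('m set \<Rightarrow> 'm measure) \<Rightarrow> bool" where
  "holonomy_invariant_measure L \<nu> \<longleftrightarrow>
     (\<forall>\<alpha>. \<forall>y\<in>disk L \<alpha>. radon_measure_on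
        (subtopology (ambient L) (transversal L \<alpha> y)) (\<nu> (transversal L \<alpha> y))) \<and>
     (\<forall>\<alpha> \<beta>. \<forall>y\<in>disk L \<alpha>. \<forall>y'\<in>disk L \<beta>. \<forall>E\<in>sets (\<nu> (transversal L \<beta> y')).
        (\<forall>x\<in>E. snd (chart L \<beta> x) \<in> holonomy_dom L \<alpha> \<beta>) \<longrightarrow>
        emeasure (\<nu> (transversal L \<alpha> y)) (holonomy_map L \<alpha> y \<beta> ` E) =
          emeasure (\<nu> (transversal L \<beta> y')) E) \<and>
     (\<exists>\<alpha>. \<exists>y\<in>disk L \<alpha>. emeasure (\<nu> (transversal L \<alpha> y)) (transversal L \<alpha> y) \<noteq> 0)"

text \<open>A unit vector tangent to the leaf through \<open>x\<close> is an equivalence class of triples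
  \<open>(\<alpha>, x, u)\<close>, where \<open>u\<close> expresses the vector in the chart \<open>\<alpha>\<close> around \<open>x\<close>; triples are
  identified by the leafwise differentials of the transition maps.\<close>

type_synonym ('m, 'i) tangent_rep = "'i \<times> 'm \<times> complex \<times> complex"

definition tangent_reps :: "('m, 'i, 't) lamination \<Rightarrow> ('m, 'i) tangent_rep set" where
  "tangent_reps L =
     {(\<alpha>, x, u). x \<in> chart_dom L \<alpha> \<and> u \<in> unit_tangent (disk L \<alpha>) \<and> fst u = fst (chart L \<alpha> x)}"

definition tangent_rel ::
    "('m, 'i, 't) lamination \<Rightarrow> (('m, 'i) tangent_rep \<times> ('m, 'i) tangent_rep) set" where
  "tangent_rel L =
     {((\<beta>, x, w), (\<alpha>, x', u)). (\<beta>, x, w) \<in> tangent_reps L \<and> (\<alpha>, x', u) \<in> tangent_reps L \<and>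
        x' = x \<and> u = push (cocycle L \<alpha> \<beta> (snd (chart L \<beta> x))) w}"

definition unit_bundle :: "('m, 'i, 't) lamination \<Rightarrow> ('m, 'i) tangent_rep set set" where
  "unit_bundle L = tangent_reps L // tangent_rel L"

text \<open>The inverse $\psi_\alpha^{-1}$ of the bundle chart over \<open>chart_dom L \<alpha>\<close>, defined on
  \<open>unit_tangent (disk L \<alpha>) \<times> topspace (trans_space L \<alpha>)\<close>.\<close>

definition bundle_chart_inv ::
    "('m, 'i, 't) lamination \<Rightarrow> 'i \<Rightarrow> (complex \<times> complex) \<times> 't \<Rightarrow> ('m, 'i) tangent_rep set" where
  "bundle_chart_inv L \<alpha> =
     (\<lambda>(u, t). tangent_rel L `` {(\<alpha>, chart_inv L \<alpha> (fst u, t), u)})"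

definition bundle_chart_space ::
    "('m, 'i, 't) lamination \<Rightarrow> 'i \<Rightarrow> ((complex \<times> complex) \<times> 't) topology" where
  "bundle_chart_space L \<alpha> =
     prod_topology (top_of_set (unit_tangent (disk L \<alpha>))) (trans_space L \<alpha>)"

definition bundle_topology :: "('m, 'i, 't) lamination \<Rightarrow> ('m, 'i) tangent_rep set topology" where
  "bundle_topology L = topology (\<lambda>V. V \<subseteq> unit_bundle L \<and>
     (\<forall>\<alpha>. openin (bundle_chart_space L \<alpha>)
        {p \<in> topspace (bundle_chart_space L \<alpha>). bundle_chart_inv L \<alpha> p \<in> V}))"

lemma openin_bundle_topology:
  "openin (bundle_topology L) V \<longleftrightarrow> V \<subseteq> unit_bundle L \<and>
     (\<forall>\<alpha>. openin (bundle_chart_space L \<alpha>)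
        {p \<in> topspace (bundle_chart_space L \<alpha>). bundle_chart_inv L \<alpha> p \<in> V})"
proof -
  let ?P = "\<lambda>\<alpha> V. {p \<in> topspace (bundle_chart_space L \<alpha>). bundle_chart_inv L \<alpha> p \<in> V}"
  have "?P \<alpha> (S \<inter> S') = ?P \<alpha> S \<inter> ?P \<alpha> S'" for \<alpha> S S' by auto
  moreover have "?P \<alpha> (\<Union>K) = (\<Union>S\<in>K. ?P \<alpha> S)" for \<alpha> K by auto
  ultimately have "istopology (\<lambda>V. V \<subseteq> unit_bundle L \<and>
      (\<forall>\<alpha>. openin (bundle_chart_space L \<alpha>) (?P \<alpha> V)))"
    unfolding istopology_def by (auto simp del: Union_iff)
  then show ?thesis
    by (simp add: bundle_topology_def)
qed

text \<open>\<open>right_mult L v b w\<close> is the graph $w = v \cdot b$ of the right action. Multiplying on the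
  right inside a chart is possible only as long as the base point stays in the disk of the
  chart, so a general translate is reached by finitely many such multiplications.\<close>

inductive right_mult ::
    "('m, 'i, 't) lamination \<Rightarrow> ('m, 'i) tangent_rep set \<Rightarrow> psl2 \<Rightarrow> ('m, 'i) tangent_rep set \<Rightarrow> bool"
  for L v where
  unit: "v \<in> unit_bundle L \<Longrightarrow> right_mult L v 1 v"
| step: "right_mult L v b (bundle_chart_inv L \<alpha> (u, t)) \<Longrightarrow>
    u \<in> unit_tangent (disk L \<alpha>) \<Longrightarrow> t \<in> topspace (trans_space L \<alpha>) \<Longrightarrow>
    right_translate u c \<in> unit_tangent (disk L \<alpha>) \<Longrightarrow>
    right_mult L v (b * c) (bundle_chart_inv L \<alpha> (right_translate u c, t))"

definition right_action ::
    "('m, 'i, 't) lamination \<Rightarrow> ('m, 'i) tangent_rep set \<Rightarrow> psl2 \<Rightarrow> ('m, 'i) tangent_rep set" where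
  "right_action L v b = (THE w. right_mult L v b w)"

end

theory Submission
  imports Defs
begin

text \<open>Write \<open>B\<close> for the affine group and let \<open>C\<close> be the closure of a \<open>B\<close>-orbit. Inside the unit tangent
bundle of one leaf, the \<open>B\<close>-orbits are the sets of vectors pointing to a common point at infinity,
so \<open>C\<close> is described there by a closed set of boundary points. Two sets of points of the lamination
measure its size: the points with some unit vector in \<open>C\<close> and the points with all unit vectors in
\<open>C\<close>. Both are closed (\<open>closed_meeting\<close>, \<open>closed_containing\<close>), and both are unions of leaves, because
\<open>B\<close> moves a vector at one point of a plaque to a vector at any other (\<open>plaque_affine\<close>). By
minimality each is empty or everything. The first is everything, and the theorem says that the
second one is, so the whole proof consists in excluding that it is empty.

Suppose that no point has all its unit vectors in \<open>C\<close>. For \<open>k > 0\<close> let \<open>S k\<close> be the set of vectors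
that reach \<open>C\<close> by a rotation whose half angle has tangent at most \<open>k\<close>. Moving towards a boundary
point spreads the remaining boundary points apart as seen from the moving point: the geodesic flow
of time \<open>s\<close> maps \<open>S k\<close> onto \<open>S (exp s * k)\<close> (\<open>rotated_flow\<close>). The holonomy-invariant measure and
Haar measure on the leaves together give a finite measure on the bundle that the geodesic flow
preserves. Hence all \<open>S k\<close> have the same measure, and their differences are null
(\<open>null_between\<close>). By Fubini there is a plaque on which almost no vector lies in such a difference.
But every vector outside \<open>C\<close> lies in a difference of two of these sets, unless the only boundary
point of \<open>C\<close> is the one directly behind it, and on each plaque the vectors to which this applies
contain a nonempty open set (\<open>fat_slice\<close>). This contradiction proves the theorem (\<open>full_fibre_exists\<close>).

Three things have to be built for this argument. The right action is given only by steps inside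
charts; that the steps fit together to an action of the whole group rests on the simple
connectivity of the hyperbolic plane (\<open>local_action_extension\<close>) and on the fact that two charts
which agree at one point of a plaque agree wherever their disks overlap
(\<open>overlap_propagates\<close>). The bundle charts are open embeddings because the derivative of a Moebius
transformation is a function of three of its values (\<open>push_three_points\<close>). Haar measure is
represented by Lebesgue measure on real matrices with determinant between 1 and 2: left
multiplication by determinant one acts on the two columns separately, and the geodesic flow
rescales them by reciprocal factors.\<close>

section \<open>Moebius transformations and unit tangent vectors\<close>

definition mk :: "real \<Rightarrow> real \<Rightarrow> real \<Rightarrow> real \<Rightarrow> psl2" where
  "mk a b c d = abs_psl2 (vector [vector [a, b], vector [c, d]])"

lemma psl2_rel_vector:
  "psl2_rel (vector [vector [a, b], vector [c, d]]) (vector [vector [a, b], vector [c, d]]) \<longleftrightarrow>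
     a * d - b * c = 1"
  by (simp add: psl2_rel_def det_2)

lemma mk_mult:
  assumes "a * d - b * c = 1" "a' * d' - b' * c' = 1"
  shows "mk a b c d * mk a' b' c' d' =
    mk (a * a' + b * c') (a * b' + b * d') (c * a' + d * c') (c * b' + d * d')"
  unfolding mk_def using assms
  by (subst times_psl2.abs_eq)
     (auto simp: psl2_rel_vector eq_onp_def intro!: arg_cong[of _ _ abs_psl2]
       simp: vec_eq_iff forall_2 matrix_matrix_mult_def sum_2)

lemma mk_one: "mk 1 0 0 1 = 1"
  unfolding mk_def one_psl2_def
  by (rule arg_cong[of _ _ abs_psl2]) (simp add: vec_eq_iff forall_2 mat_def)

lemma mk_uminus:
  assumes "a * d - b * c = 1"
  shows "mk (- a) (- b) (- c) (- d) = mk a b c d"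
proof -
  have "psl2_rel (vector [vector [- a, - b], vector [- c, - d]]) (vector [vector [a, b], vector [c, d]])"
    using assms by (simp add: psl2_rel_def det_2 vec_eq_iff forall_2)
  then show ?thesis
    unfolding mk_def by (rule Quotient3_rel_abs[OF Quotient3_psl2])
qed

lemma psl2_eq_mk:
  obtains a b c d where "a * d - b * c = 1" "g = mk a b c d"
proof -
  obtain A where A: "g = abs_psl2 A" "psl2_rel A A"
    using Quotient3_abs_rep[OF Quotient3_psl2] Quotient3_rep_reflp[OF Quotient3_psl2] by metis
  have "A = vector [vector [A$1$1, A$1$2], vector [A$2$1, A$2$2]]"
    by (simp add: vec_eq_iff forall_2)
  then show ?thesis
    using that[of "A$1$1" "A$2$2" "A$1$2" "A$2$1"] A
    by (metis mk_def psl2_rel_vector)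
qed

lemma moebius_mk:
  assumes "a * d - b * c = 1"
  shows "moebius (mk a b c d) z = (of_real a * z + of_real b) / (of_real c * z + of_real d)"
  unfolding mk_def using assms by (subst moebius.abs_eq) (simp_all add: psl2_rel_vector)

lemma affine_group_mk: "affine_group = {mk a b 0 (inverse a) | a b. a > 0}"
  by (simp add: affine_group_def mk_def)

abbreviation UH :: "complex set" where "UH \<equiv> upper_half_plane"

lemma UH_iff: "z \<in> UH \<longleftrightarrow> Im z > 0"
  by (simp add: upper_half_plane_def)

lemma denom_nz:
  assumes "a * d - b * c = (1::real)" "Im z > 0"
  shows "of_real c * z + of_real d \<noteq> 0"
proof
  assume "of_real c * z + of_real d = 0"
  then have "c * Im z = 0" "c * Re z + d = 0" by (auto simp: complex_eq_iff)
  then have "c = 0" "d = 0" using assms(2) by auto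
  then show False using assms(1) by simp
qed

lemma moebius_mk_deriv:
  assumes "a * d - b * c = 1" "Im z > 0"
  shows "(moebius (mk a b c d) has_field_derivative 1 / (of_real c * z + of_real d)\<^sup>2) (at z)"
proof -
  have e: "moebius (mk a b c d) = (\<lambda>z. (of_real a * z + of_real b) / (of_real c * z + of_real d))"
    using moebius_mk[OF assms(1)] by auto
  have nz: "of_real c * z + of_real d \<noteq> 0" using denom_nz assms by blast
  have "of_real a * of_real d - of_real b * of_real c = (1::complex)"
    by (metis assms(1) of_real_1 of_real_diff of_real_mult)
  then have eq: "(of_real a * (of_real c * z + of_real d) - (of_real a * z + of_real b) * of_real c) = (1::complex)"
    by (simp add: algebra_simps)
  show ?thesis unfolding e
    by (rule derivative_eq_intros refl nz | simp add: nz)+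
       (use eq in \<open>simp add: power2_eq_square algebra_simps\<close>)
qed

lemma push_mk:
  assumes "a * d - b * c = 1" "Im z > 0"
  shows "push (mk a b c d) (z, v) =
    ((of_real a * z + of_real b) / (of_real c * z + of_real d), v / (of_real c * z + of_real d)\<^sup>2)"
  using DERIV_imp_deriv[OF moebius_mk_deriv[OF assms]] moebius_mk[OF assms(1)]
  by (simp add: push_def)

lemma Im_moebius_mk:
  assumes "a * d - b * c = 1" "Im z > 0"
  shows "Im (moebius (mk a b c d) z) = Im z / (norm (of_real c * z + of_real d))\<^sup>2"
proof -
  let ?w = "of_real c * z + of_real d"
  have "moebius (mk a b c d) z = (of_real a * z + of_real b) * cnj ?w / of_real ((norm ?w)\<^sup>2)"
    using moebius_mk[OF assms(1)] by (simp add: complex_div_cnj[of _ ?w])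
  then have "Im (moebius (mk a b c d) z) = Im ((of_real a * z + of_real b) * cnj ?w) / (norm ?w)\<^sup>2"
    by (simp only: Im_divide_of_real)
  also have "Im ((of_real a * z + of_real b) * cnj ?w) = (a * d - b * c) * Im z"
    by (simp add: algebra_simps)
  finally show ?thesis using assms by simp
qed

lemma moebius_UH: "z \<in> UH \<Longrightarrow> moebius g z \<in> UH"
proof -
  assume z: "z \<in> UH"
  obtain a b c d where g: "a * d - b * c = 1" "g = mk a b c d" by (rule psl2_eq_mk)
  have "of_real c * z + of_real d \<noteq> 0" using denom_nz[OF g(1)] z by (simp add: UH_iff)
  then show ?thesis using z Im_moebius_mk[OF g(1), of z] g(2) by (simp add: UH_iff)
qed

lemma moebius_Im_pos: "Im z > 0 \<Longrightarrow> Im (moebius g z) > 0"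
  using moebius_UH by (simp add: UH_iff)

lemma moebius_diff:
  assumes "a * d - b * c = 1" "Im z > 0" "Im w > 0"
  shows "moebius (mk a b c d) z - moebius (mk a b c d) w =
     (z - w) / ((of_real c * z + of_real d) * (of_real c * w + of_real d))"
proof -
  have nz: "of_real c * z + of_real d \<noteq> 0" "of_real c * w + of_real d \<noteq> 0"
    using denom_nz assms by blast+
  have e: "of_real a * of_real d - of_real b * of_real c = (1::complex)"
    by (metis assms(1) of_real_1 of_real_diff of_real_mult)
  have "moebius (mk a b c d) z - moebius (mk a b c d) w =
    ((of_real a * z + of_real b) * (of_real c * w + of_real d) - (of_real a * w + of_real b) * (of_real c * z + of_real d))
    / ((of_real c * z + of_real d) * (of_real c * w + of_real d))"
    using nz by (simp add: moebius_mk[OF assms(1)] diff_frac_eq)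
  also have "((of_real a * z + of_real b) * (of_real c * w + of_real d) - (of_real a * w + of_real b) * (of_real c * z + of_real d))
     = (of_real a * of_real d - of_real b * of_real c) * (z - w)"
    by (simp add: algebra_simps)
  finally show ?thesis by (simp add: e)
qed

text \<open>Equal to \<open>2 * (cosh d - 1)\<close>, where \<open>d\<close> is the hyperbolic distance.\<close>

definition sep :: "complex \<Rightarrow> complex \<Rightarrow> real" where
  "sep z w = (norm (z - w))\<^sup>2 / (Im z * Im w)"

lemma sep_moebius:
  assumes "z \<in> UH" "w \<in> UH"
  shows "sep (moebius g z) (moebius g w) = sep z w"
proof -
  obtain a b c d where g: "a * d - b * c = 1" "g = mk a b c d" by (rule psl2_eq_mk)
  have p: "Im z > 0" "Im w > 0" using assms by (auto simp: UH_iff)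
  have nz: "norm (of_real c * z + of_real d) \<noteq> 0" "norm (of_real c * w + of_real d) \<noteq> 0"
    using denom_nz[OF g(1)] p by auto
  define X where "X = norm (of_real c * z + of_real d)"
  define Y where "Y = norm (of_real c * w + of_real d)"
  have "(n / (X * Y))\<^sup>2 / (x / X\<^sup>2 * (y / Y\<^sup>2)) = n\<^sup>2 / (x * y)" for n x y :: real
    using nz by (simp add: X_def[symmetric] Y_def[symmetric] power_divide power_mult_distrib)
  then show ?thesis
    unfolding sep_def g(2) moebius_diff[OF g(1) p] Im_moebius_mk[OF g(1) p(1)]
      Im_moebius_mk[OF g(1) p(2)] norm_divide norm_mult X_def[symmetric] Y_def[symmetric] .
qed

lemma hyp_dist_moebius:
  assumes "z \<in> UH" "w \<in> UH"
  shows "hyp_dist (moebius g z) (moebius g w) = hyp_dist z w"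
proof -
  have "hyp_dist x y = arcosh (1 + sep x y / 2)" for x y
    by (simp add: hyp_dist_def sep_def mult_ac)
  then show ?thesis using sep_moebius[OF assms] by simp
qed

lemma moebius_mult:
  assumes "z \<in> UH"
  shows "moebius (g * h) z = moebius g (moebius h z)"
proof -
  obtain a b c d where g: "a * d - b * c = 1" "g = mk a b c d" by (rule psl2_eq_mk)
  obtain a' b' c' d' where h: "a' * d' - b' * c' = 1" "h = mk a' b' c' d'" by (rule psl2_eq_mk)
  have gh: "(a * a' + b * c') * (c * b' + d * d') - (a * b' + b * d') * (c * a' + d * c') = 1"
  proof -
    have "(a * a' + b * c') * (c * b' + d * d') - (a * b' + b * d') * (c * a' + d * c')
      = (a * d - b * c) * (a' * d' - b' * c')" by (simp add: algebra_simps)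
    then show ?thesis using g h by simp
  qed
  have z: "Im z > 0" using assms by (simp add: UH_iff)
  have nz: "of_real c' * z + of_real d' \<noteq> 0" using denom_nz h z by blast
  have nz2: "of_real c * moebius h z + of_real d \<noteq> 0"
    using denom_nz g moebius_Im_pos[OF z] by blast
  have nz3: "of_real (c * a' + d * c') * z + of_real (c * b' + d * d') \<noteq> 0"
    using denom_nz[OF gh] z by blast
  show ?thesis
    unfolding g(2) h(2) mk_mult[OF g(1) h(1)] moebius_mk[OF gh]
    unfolding moebius_mk[OF h(1)] moebius_mk[OF g(1)]
    using nz nz2 nz3 unfolding h(2) moebius_mk[OF h(1)]
    by (simp add: divide_simps) (simp add: algebra_simps)
qed

lemma moebius_1: "moebius 1 z = z"
  by (simp add: mk_one[symmetric] moebius_mk)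

lemma push_mult:
  assumes "z \<in> UH"
  shows "push (g * h) (z, v) = push g (push h (z, v))"
proof -
  have d: "\<exists>D. (moebius g has_field_derivative D) (at z)" if "z \<in> UH" for g z
    using moebius_mk_deriv that psl2_eq_mk[of g] unfolding UH_iff by metis
  obtain D1 where D1: "(moebius h has_field_derivative D1) (at z)" using d assms by blast
  obtain D2 where D2: "(moebius g has_field_derivative D2) (at (moebius h z))"
    using d moebius_UH assms by blast
  have op: "open UH" unfolding upper_half_plane_def by (simp add: open_halfspace_Im_gt)
  have "((moebius g \<circ> moebius h) has_field_derivative D2 * D1) (at z)"
    by (rule DERIV_chain[OF D2 D1])
  then have "(moebius (g * h) has_field_derivative D2 * D1) (at z)"
    by (rule has_field_derivative_transform_within_open[OF _ op assms]) (simp add: moebius_mult)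
  then show ?thesis using D1 D2 assms
    by (auto simp: push_def moebius_mult dest!: DERIV_imp_deriv)
qed

lemma psl2_inverse: obtains h where "g * h = 1" "h * g = (1::psl2)"
proof -
  obtain a b c d where g: "a * d - b * c = 1" "g = mk a b c d" by (rule psl2_eq_mk)
  have i: "d * a - (- b) * (- c) = 1" using g(1) by (simp add: algebra_simps)
  have "g * mk d (- b) (- c) a = mk 1 0 0 1"
    unfolding g(2) mk_mult[OF g(1) i] using g(1) by (simp add: algebra_simps)
  moreover have "mk d (- b) (- c) a * g = mk 1 0 0 1"
    unfolding g(2) mk_mult[OF i g(1)] using g(1) by (simp add: algebra_simps)
  ultimately show ?thesis using that mk_one by metis
qed

lemma psl2_left_cancel: "g * h = g * h' \<Longrightarrow> h = (h'::psl2)"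
  by (metis mult.assoc mult_1_left psl2_inverse[of g])

lemma psl2_right_cancel: "h * g = h' * g \<Longrightarrow> h = (h'::psl2)"
proof -
  assume e: "h * g = h' * g"
  obtain k where k: "g * k = 1" by (rule psl2_inverse)
  have "h * (g * k) = h' * (g * k)" by (simp only: mult.assoc[symmetric] e)
  then show ?thesis by (simp add: k)
qed

lemma psl2_solve: obtains c where "g * c = (h::psl2)"
proof -
  obtain g' where "g * g' = 1" by (rule psl2_inverse)
  then have "g * (g' * h) = h" by (simp only: mult.assoc[symmetric] mult_1_left)
  then show ?thesis by (rule that)
qed

text \<open>The usual identification of \<open>PSL(2,R)\<close> with the unit tangent bundle of the half plane.\<close>

definition tvec :: "psl2 \<Rightarrow> complex \<times> complex" where "tvec g = push g base_vector"

lemma ii_UH: "\<i> \<in> UH" by (simp add: UH_iff)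

lemma tvec_mk: "a * d - b * c = 1 \<Longrightarrow> tvec (mk a b c d) =
    ((of_real a * \<i> + of_real b) / (of_real c * \<i> + of_real d), \<i> / (of_real c * \<i> + of_real d)\<^sup>2)"
  by (simp add: tvec_def base_vector_def push_mk)

lemma fst_tvec: "fst (tvec g) = moebius g \<i>"
  by (simp add: tvec_def push_def base_vector_def)

lemma tvec_mult: "tvec (g * h) = push g (tvec h)"
  by (simp add: tvec_def base_vector_def push_mult ii_UH)

lemma push_unit_tangent:
  assumes "u \<in> unit_tangent UH" shows "push g u \<in> unit_tangent UH"
proof -
  obtain a b c d where g: "a * d - b * c = 1" "g = mk a b c d" by (rule psl2_eq_mk)
  obtain z v where u: "u = (z, v)" "Im z > 0" "norm v = Im z"
    using assms by (auto simp: unit_tangent_def UH_iff field_simps)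
  have "push g u = (moebius g z, v / (of_real c * z + of_real d)\<^sup>2)"
    using push_mk[OF g(1) u(2)] by (simp add: u(1) g(2) moebius_mk[OF g(1)])
  then show ?thesis
    using moebius_Im_pos[OF u(2), of g] Im_moebius_mk[OF g(1) u(2)] u(2,3) denom_nz[OF g(1) u(2)]
    by (auto simp: unit_tangent_def UH_iff g(2) norm_divide norm_power)
qed

lemma tvec_in: "tvec g \<in> unit_tangent UH"
  unfolding tvec_def by (rule push_unit_tangent) (simp add: base_vector_def unit_tangent_def ii_UH)

text \<open>With \<open>v = \<i> / j\<^sup>2\<close>, the lower row of the matrix consists of the imaginary and real part of \<open>j\<close>, and
its upper row of those of \<open>z * j\<close>.\<close>

lemma tvec_surj:
  assumes "u \<in> unit_tangent UH" obtains g where "u = tvec g"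
proof -
  obtain z v where u: "u = (z, v)" "Im z > 0" "norm v = Im z"
    using assms by (auto simp: unit_tangent_def UH_iff field_simps)
  then have v0: "v \<noteq> 0" by auto
  define j where "j = csqrt (\<i> / v)"
  have j: "j\<^sup>2 = \<i> / v" by (simp add: j_def)
  then have j0: "j \<noteq> 0" using v0 by auto
  have nj: "(norm j)\<^sup>2 * Im z = 1"
    using arg_cong[OF j, of norm] u by (auto simp: norm_power norm_divide)
  have det: "Im (z * j) * Re j - Re (z * j) * Im j = 1"
    using nj unfolding cmod_power2 by (simp add: algebra_simps power2_eq_square)
  have zj: "of_real (Im (z * j)) * \<i> + of_real (Re (z * j)) = z * j"
    by (auto simp: complex_eq_iff)
  have jj: "of_real (Im j) * \<i> + of_real (Re j) = j"
    by (auto simp: complex_eq_iff)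
  have "tvec (mk (Im (z * j)) (Re (z * j)) (Im j) (Re j)) = (z, \<i> / j\<^sup>2)"
    unfolding tvec_mk[OF det] zj jj using j0 by simp
  then have "tvec (mk (Im (z * j)) (Re (z * j)) (Im j) (Re j)) = u"
    using u v0 by (simp add: j)
  then show ?thesis using that by metis
qed

lemma tvec_inj: assumes "tvec g = tvec h" shows "g = h"
proof -
  obtain a b c d where g: "a * d - b * c = 1" "g = mk a b c d" by (rule psl2_eq_mk)
  obtain a' b' c' d' where h: "a' * d' - b' * c' = 1" "h = mk a' b' c' d'" by (rule psl2_eq_mk)
  let ?j = "of_real c * \<i> + of_real d :: complex" and ?k = "of_real c' * \<i> + of_real d' :: complex"
  have nz: "?j \<noteq> 0" "?k \<noteq> 0" using denom_nz[OF g(1)] denom_nz[OF h(1)] by auto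
  have e1: "(of_real a * \<i> + of_real b) / ?j = (of_real a' * \<i> + of_real b') / ?k"
    and "\<i> / ?j\<^sup>2 = \<i> / ?k\<^sup>2"
    using assms unfolding g(2) h(2) tvec_mk[OF g(1)] tvec_mk[OF h(1)] by auto
  then have "?j\<^sup>2 = ?k\<^sup>2" using nz by (simp add: divide_simps)
  then consider "?j = ?k" | "?j = - ?k" by (metis power2_eq_iff)
  then show ?thesis
  proof cases
    case 1
    then have "of_real a * \<i> + of_real b = of_real a' * \<i> + of_real b'" using e1 nz by simp
    with 1 have "a = a'" "b = b'" "c = c'" "d = d'" by (auto simp: complex_eq_iff)
    then show ?thesis by (simp add: g h)
  next
    case 2
    then have "of_real a * \<i> + of_real b = - (of_real a' * \<i> + of_real b')"
    proof -
      have "P = - Q" if "P / - K = Q / K" "K \<noteq> 0" for P Q K :: complex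
      proof -
        have "P = P / - K * - K" using that(2) by simp
        also have "\<dots> = - Q" unfolding that(1) using that(2) by simp
        finally show ?thesis .
      qed
      then show ?thesis using e1 nz(2) unfolding 2 by blast
    qed
    with 2 have "a = - a'" "b = - b'" "c = - c'" "d = - d'" by (auto simp: complex_eq_iff)
    then show ?thesis unfolding g(2) h(2) by (simp only: mk_uminus[OF h(1)])
  qed
qed

lemma right_translate_tvec: "right_translate (tvec g) c = tvec (g * c)"
proof -
  have "(THE g'. push g' base_vector = tvec g) = g"
    using tvec_inj by (intro the_equality) (auto simp: tvec_def)
  then show ?thesis by (simp add: right_translate_def tvec_def)
qed

lemma tvec_in_unit_tangent: "tvec g \<in> unit_tangent D \<longleftrightarrow> moebius g \<i> \<in> D"
  using tvec_in[of g] fst_tvec[of g] by (auto simp: unit_tangent_def split: prod.splits)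

lemma unit_tangent_tvec:
  assumes "u \<in> unit_tangent D" obtains g where "u = tvec g" "moebius g \<i> \<in> D"
proof -
  have "u \<in> unit_tangent UH" using assms by (auto simp: unit_tangent_def)
  then obtain g where "u = tvec g" by (rule tvec_surj)
  then show ?thesis using that assms tvec_in_unit_tangent by metis
qed

lemma moebius_transitive: assumes "z \<in> UH" obtains g where "moebius g \<i> = z"
proof -
  have "(z, of_real (Im z)) \<in> unit_tangent UH" using assms by (auto simp: unit_tangent_def UH_iff)
  then show ?thesis using tvec_surj fst_tvec that by (metis fst_conv)
qed

text \<open>Cocycles are known only through their action on the points of a plaque. This cross-ratio formula
for the derivative turns continuity of the action on points into continuity of the action on
tangent vectors.\<close>

lemma push_three_points:
  assumes "z \<in> UH" "p \<in> UH" "q \<in> UH" "z \<noteq> p" "z \<noteq> q" "p \<noteq> q"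
  shows "push g (z, v) = (moebius g z, v * ((moebius g z - moebius g p) * (moebius g z - moebius g q) * (p - q)
    / ((z - p) * (z - q) * (moebius g p - moebius g q))))"
    and "moebius g p \<noteq> moebius g q"
proof -
  obtain a b c d where g: "a * d - b * c = 1" "g = mk a b c d" by (rule psl2_eq_mk)
  have p: "Im z > 0" "Im p > 0" "Im q > 0" using assms by (auto simp: UH_iff)
  let ?f = "\<lambda>z::complex. of_real c * z + of_real d"
  have nz: "?f z \<noteq> 0" "?f p \<noteq> 0" "?f q \<noteq> 0" using denom_nz[OF g(1)] p by blast+
  define x y w where "x = ?f z" "y = ?f p" "w = ?f q"
  have pf: "push g (z, v) = (moebius g z, v / x\<^sup>2)"
    using push_mk[OF g(1) p(1)] by (simp add: g(2) moebius_mk[OF g(1)] x_y_w_def)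
  have "A / (x * y) * (B / (x * w)) * C / (A * B * (C / (y * w))) = 1 / x\<^sup>2"
    if "A \<noteq> 0" "B \<noteq> 0" "C \<noteq> 0" for A B C
    using nz[folded x_y_w_def] that by (simp add: field_simps power2_eq_square)
  from this[of "z - p" "z - q" "p - q"]
  have "(z - p) / (x * y) * ((z - q) / (x * w)) * (p - q) / ((z - p) * (z - q) * ((p - q) / (y * w))) = 1 / x\<^sup>2"
    using assms(4-6) by simp
  then show "push g (z, v) = (moebius g z, v * ((moebius g z - moebius g p) * (moebius g z - moebius g q) * (p - q)
    / ((z - p) * (z - q) * (moebius g p - moebius g q))))"
    unfolding pf unfolding g(2) moebius_diff[OF g(1) p(1) p(2)] moebius_diff[OF g(1) p(1) p(3)] moebius_diff[OF g(1) p(2) p(3)]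
    using nz assms(4-6) by (simp add: x_y_w_def[symmetric])
  show "moebius g p \<noteq> moebius g q"
    using moebius_diff[OF g(1) p(2) p(3)] nz assms(6) g(2) by auto
qed

lemma two_more_points:
  assumes "open (W :: complex set)" "z \<in> W"
  obtains p q where "p \<in> W" "q \<in> W" "z \<noteq> p" "z \<noteq> q" "p \<noteq> q"
proof -
  have lp: "z islimpt W" using assms by (simp add: interior_limit_point interior_open)
  obtain p where p: "p \<in> W" "p \<noteq> z" using lp by (meson islimptE open_UNIV UNIV_I)
  obtain q where q: "q \<in> W" "q \<noteq> z" "q \<in> ball z (dist z p)"
    using islimptE[OF lp, of "ball z (dist z p)"] p(2) by (metis centre_in_ball open_ball zero_less_dist_iff)
  have "p \<noteq> q" using q(3) by auto
  then show ?thesis using that[of p q] p q by blast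
qed

text \<open>Three values determine the image of a tangent vector, and the image of one tangent vector
determines the group element.\<close>

lemma moebius_identity:
  assumes "open W" "W \<noteq> {}" "W \<subseteq> UH" "\<And>z. z \<in> W \<Longrightarrow> moebius g z = moebius h z"
  shows "g = h"
proof -
  obtain z where z: "z \<in> W" using assms by blast
  obtain p q where p: "p \<in> W" and q: "q \<in> W" and ne: "z \<noteq> p" "z \<noteq> q" "p \<noteq> q"
    by (rule two_more_points[OF assms(1) z])
  obtain f where f: "(z, of_real (Im z)) = tvec f"
  proof -
    have "Im z > 0" using z assms(3) by (auto simp: UH_iff)
    then have "(z, of_real (Im z)) \<in> unit_tangent UH" by (simp add: unit_tangent_def UH_iff)
    then show ?thesis using that by (metis tvec_surj)
  qed
  have "push g (z, of_real (Im z)) = push h (z, of_real (Im z))"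
  proof -
    have UH: "z \<in> UH" "p \<in> UH" "q \<in> UH" using z p q assms(3) by auto
    show ?thesis
      unfolding push_three_points(1)[OF UH ne] by (simp only: assms(4)[OF z] assms(4)[OF p] assms(4)[OF q])
  qed
  then have "tvec (g * f) = tvec (h * f)" by (simp add: tvec_mult f)
  then have "g * f = h * f" by (rule tvec_inj)
  then show ?thesis by (metis mult.assoc mult_1_right psl2_inverse)
qed

text \<open>Right multiplication in terms of tangent vectors. For a matrix with lower row \<open>c, d\<close> put
\<open>j = c * \<i> + d\<close>; the tangent vector \<open>(z, v)\<close> of the matrix satisfies \<open>v / (\<i> * Im z) = cnj j / j\<close>. The
numerator and the denominator of the image of \<open>w\<close>, both multiplied by \<open>2 / j\<close>, depend on the
matrix only through \<open>z\<close> and this quotient, which removes the ambiguity of sign. The denominator is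
\<open>rtden\<close>, and \<open>rtf\<close> is the resulting vector.\<close>

definition rtden :: "complex \<times> complex \<Rightarrow> complex \<Rightarrow> complex" where
  "rtden u w = (1 - snd u / (\<i> * of_real (Im (fst u)))) * w / \<i> + (1 + snd u / (\<i> * of_real (Im (fst u))))"

definition rtf :: "complex \<times> complex \<Rightarrow> complex \<times> complex \<Rightarrow> complex \<times> complex" where
  "rtf u s = (let om = snd u / (\<i> * of_real (Im (fst u))) in
     (((fst u - cnj (fst u) * om) * fst s / \<i> + (fst u + cnj (fst u) * om)) / rtden u (fst s),
      snd s * (snd u / \<i>) * 4 / (rtden u (fst s))\<^sup>2))"

lemma tvec_mult_rtf: "tvec (g * h) = rtf (tvec g) (tvec h)" and rtden_nz: "rtden (tvec g) (fst (tvec h)) \<noteq> 0"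
proof -
  obtain a b c d where g: "a * d - b * c = 1" "g = mk a b c d" by (rule psl2_eq_mk)
  obtain w s where ws: "tvec h = (w, s)" by fastforce
  have w: "Im w > 0" using tvec_in[of h] ws by (auto simp: unit_tangent_def UH_iff)
  define j where "j = of_real c * \<i> + (of_real d :: complex)"
  define z where "z = (of_real a * \<i> + of_real b) / j"
  have j0: "j \<noteq> 0" unfolding j_def using denom_nz[OF g(1), of \<i>] by simp
  have frg: "tvec g = (z, \<i> / j\<^sup>2)" unfolding g(2) tvec_mk[OF g(1)] z_def j_def by simp
  have zm: "z = moebius g \<i>" using frg fst_tvec by (metis fst_conv)
  have Imz: "Im z = 1 / (norm j)\<^sup>2" using Im_moebius_mk[OF g(1), of \<i>] by (simp add: zm g(2) j_def)
  have om: "\<i> / j\<^sup>2 / (\<i> * of_real (Im z)) = cnj j / j"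
    using j0 complex_norm_square[of j] by (simp add: Imz power2_eq_square field_simps)
  have zj: "z * j = of_real a * \<i> + of_real b" using j0 by (simp add: z_def)
  then have czj: "cnj z * cnj j = - of_real a * \<i> + of_real b"
    by (metis complex_cnj_add complex_cnj_complex_of_real complex_cnj_i complex_cnj_mult mult_minus_left mult_minus_right)
  have cj: "cnj j = - of_real c * \<i> + of_real d" by (simp add: j_def)
  have den: "rtden (tvec g) w * j = 2 * (of_real c * w + of_real d)"
  proof -
    have "rtden (tvec g) w * j = (j - cnj j) * w / \<i> + (j + cnj j)"
      unfolding rtden_def frg fst_conv snd_conv om using j0 by (simp add: field_simps)
    also have "\<dots> = 2 * (of_real c * w + of_real d)" unfolding cj by (simp add: j_def field_simps)
    finally show ?thesis .
  qed
  have den': "rtden (tvec g) w = 2 * (of_real c * w + of_real d) / j"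
    using den j0 by (simp add: field_simps)
  have nz: "of_real c * w + of_real d \<noteq> 0" using denom_nz[OF g(1) w] .
  then show "rtden (tvec g) (fst (tvec h)) \<noteq> 0" using j0 by (simp add: ws den' del: distrib_left_numeral)
  have num: "(z - cnj z * (cnj j / j)) * w / \<i> + (z + cnj z * (cnj j / j)) = 2 * (of_real a * w + of_real b) / j"
  proof -
    have "((z - cnj z * (cnj j / j)) * w / \<i> + (z + cnj z * (cnj j / j))) * j
       = (z * j - cnj z * cnj j) * w / \<i> + (z * j + cnj z * cnj j)"
      using j0 by (simp add: field_simps)
    also have "\<dots> = 2 * (of_real a * w + of_real b)" unfolding zj czj by (simp add: field_simps)
    finally show ?thesis using j0 by (simp add: field_simps)
  qed
  have "tvec (g * h) = ((of_real a * w + of_real b) / (of_real c * w + of_real d), s / (of_real c * w + of_real d)\<^sup>2)"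
    unfolding tvec_mult ws g(2) push_mk[OF g(1) w] ..
  also have "\<dots> = rtf (tvec g) (tvec h)"
    unfolding rtf_def Let_def ws fst_conv snd_conv den'
    unfolding frg fst_conv snd_conv om num
  proof -
    have "(P / Q, s / Q\<^sup>2) = (2 * P / j / (2 * Q / j), s * (\<i> / j\<^sup>2 / \<i>) * 4 / (2 * Q / j)\<^sup>2)"
      if "Q \<noteq> 0" for P Q :: complex
      using that j0 by (simp add: power_divide power_mult_distrib)
    from this[OF nz] show "((of_real a * w + of_real b) / (of_real c * w + of_real d), s / (of_real c * w + of_real d)\<^sup>2)
       = (2 * (of_real a * w + of_real b) / j / (2 * (of_real c * w + of_real d) / j),
          s * (\<i> / j\<^sup>2 / \<i>) * 4 / (2 * (of_real c * w + of_real d) / j)\<^sup>2)" .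
  qed
  finally show "tvec (g * h) = rtf (tvec g) (tvec h)" .
qed

lemma rtf_continuous:
  "continuous_on (unit_tangent UH \<times> unit_tangent UH) (\<lambda>(u, s). rtf u s)"
proof -
  have nz: "rtden u (fst s) \<noteq> 0" "Im (fst u) \<noteq> 0" if "u \<in> unit_tangent UH" "s \<in> unit_tangent UH" for u s
  proof -
    show "rtden u (fst s) \<noteq> 0" using that tvec_surj rtden_nz by metis
    show "Im (fst u) \<noteq> 0" using that(1) by (auto simp: unit_tangent_def UH_iff)
  qed
  show ?thesis
    unfolding case_prod_unfold rtf_def Let_def
    using nz unfolding rtden_def
    by (intro continuous_intros) (auto simp: mem_Times_iff)
qed

section \<open>Extending local right actions of the group\<close>

text \<open>How far a group element moves the point \<open>\<i>\<close>. The value does not change under multiplication by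
rotations about \<open>\<i>\<close> on either side, and rotations have size zero.\<close>

definition size_of :: "psl2 \<Rightarrow> real" where "size_of g = sep \<i> (moebius g \<i>)"

lemma sep_moebius_i: "sep (moebius g \<i>) (moebius (g * c) \<i>) = size_of c"
  by (simp add: size_of_def moebius_mult ii_UH sep_moebius moebius_UH)

lemma size_fix: "moebius k \<i> = \<i> \<Longrightarrow> size_of k = 0"
  by (simp add: size_of_def sep_def)

lemma size_fix_left: "moebius k \<i> = \<i> \<Longrightarrow> size_of (k * c) = size_of c"
  using sep_moebius_i[of k c] by (simp add: size_of_def)

lemma size_fix_right: "moebius k \<i> = \<i> \<Longrightarrow> size_of (c * k) = size_of c"
  by (simp add: size_of_def moebius_mult ii_UH)

text \<open>The horocyclic and the geodesic one-parameter subgroup; together they generate the affine group.\<close>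

definition horo :: "real \<Rightarrow> psl2" where "horo x = mk 1 x 0 1"
definition geod :: "real \<Rightarrow> psl2" where "geod s = mk (exp (s/2)) 0 0 (exp (- s/2))"

lemma det_geod: "exp (s/2) * exp (- s/2) - 0 * 0 = (1::real)"
  by (simp add: exp_minus)

lemma horo_add: "horo x * horo y = horo (x + y)"
  by (simp add: horo_def mk_mult add.commute)

lemma geod_add: "geod s * geod r = geod (s + r)"
  unfolding geod_def mk_mult[OF det_geod det_geod]
  by (simp add: exp_add[symmetric] add_divide_distrib diff_divide_distrib)

lemma horo_0: "horo 0 = 1" and geod_0: "geod 0 = 1"
  by (simp_all add: horo_def geod_def mk_one)

lemma geod_horo: "geod s * horo q = horo (exp s * q) * geod s"
proof -
  have 1: "1 * 1 - x * 0 = (1::real)" for x by simp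
  have e: "exp (s / 2) = exp s * exp (- s/2)" by (simp add: exp_add[symmetric])
  show ?thesis
    unfolding geod_def horo_def mk_mult[OF det_geod 1] mk_mult[OF 1 det_geod]
    using e by (simp add: mult_ac)
qed

lemma moebius_horo_geod: "moebius (horo x * geod s) \<i> = Complex x (exp s)"
proof -
  have e: "exp s = exp (s/2) / exp (- s/2)" by (simp add: exp_diff[symmetric])
  have "moebius (geod s) \<i> = Complex 0 (exp s)"
    unfolding geod_def moebius_mk[OF det_geod] e by (auto simp: complex_eq_iff)
  moreover have "moebius (horo x) z = z + of_real x" for z
    unfolding horo_def by (subst moebius_mk) auto
  ultimately show ?thesis
    by (simp add: moebius_mult ii_UH complex_eq_iff)
qed

text \<open>The affine group acts simply transitively on the half plane, and the stabilizer of \<open>\<i>\<close> is the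
rotation group.\<close>

lemma iwasawa:
  obtains x s k where "g = horo x * geod s * k" "moebius k \<i> = \<i>"
proof -
  define x where "x = Re (moebius g \<i>)"
  define s where "s = ln (Im (moebius g \<i>))"
  have p: "Im (moebius g \<i>) > 0" by (simp add: moebius_Im_pos)
  have e: "moebius (horo x * geod s) \<i> = moebius g \<i>"
    using p by (simp add: moebius_horo_geod x_def s_def)
  obtain h where h: "(horo x * geod s) * h = 1" "h * (horo x * geod s) = 1" by (rule psl2_inverse)
  have "moebius (h * g) \<i> = moebius h (moebius (horo x * geod s) \<i>)"
    by (simp add: e moebius_mult ii_UH)
  also have "\<dots> = \<i>" using h(2) by (metis ii_UH moebius_1 moebius_mult)
  finally have "moebius (h * g) \<i> = \<i>" .
  moreover have "g = horo x * geod s * (h * g)" using h(1) by (metis mult.assoc mult_1_left)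
  ultimately show ?thesis using that by blast
qed

lemma iwasawa_unique:
  assumes "horo x * geod s * k = horo x' * geod s' * k'" "moebius k \<i> = \<i>" "moebius k' \<i> = \<i>"
  shows "x = x' \<and> s = s' \<and> k = k'"
proof -
  have "moebius (horo x * geod s) \<i> = moebius (horo x' * geod s') \<i>"
    using assms by (metis ii_UH moebius_mult)
  then have "x = x'" "s = s'" by (auto simp: moebius_horo_geod)
  then show ?thesis using assms(1) psl2_left_cancel by blast
qed

lemma size_horo_geod: "size_of (horo x * geod s) = (x\<^sup>2 + (exp s - 1)\<^sup>2) / exp s"
  by (simp add: size_of_def sep_def moebius_horo_geod cmod_power2 power2_commute)

lemma size_horo_geod_small:
  assumes "\<epsilon> > 0"
  obtains e where "e > 0" "\<And>x s. \<bar>x\<bar> < e \<Longrightarrow> \<bar>s\<bar> < e \<Longrightarrow> size_of (horo x * geod s) < \<epsilon>"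
proof -
  let ?f = "\<lambda>p::real\<times>real. ((fst p)\<^sup>2 + (exp (snd p) - 1)\<^sup>2) / exp (snd p)"
  have "continuous_on UNIV ?f" by (intro continuous_intros) auto
  then have "open {p. ?f p < \<epsilon>}"
    by (intro open_Collect_less) (auto intro: continuous_intros)
  moreover have "(0, 0) \<in> {p. ?f p < \<epsilon>}" using assms by simp
  ultimately obtain d where d: "d > 0" "ball (0,0) d \<subseteq> {p. ?f p < \<epsilon>}"
    by (meson openE)
  show ?thesis
  proof (rule that[of "d/2"])
    fix x s :: real assume "\<bar>x\<bar> < d/2" "\<bar>s\<bar> < d/2"
    moreover have "norm (x, s) \<le> \<bar>x\<bar> + \<bar>s\<bar>"
      by (simp add: norm_Pair sqrt_sum_squares_le_sum_abs)
    ultimately have "(x, s) \<in> ball (0,0) d" by (simp add: zero_prod_def[symmetric])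
    then show "size_of (horo x * geod s) < \<epsilon>" using d(2) by (auto simp: size_horo_geod)
  qed (use d in auto)
qed

text \<open>With \<open>n = norm (z - w) / Im z\<close> the hypothesis gives \<open>n\<^sup>2 \<le> t\<^sup>2 * (1 + n)\<close>, and this bounds \<open>n\<close>.\<close>

lemma sep_small_imp_near:
  assumes "z \<in> UH" "w \<in> UH" "t \<ge> 0" "sep z w \<le> t\<^sup>2"
  shows "norm (z - w) \<le> (t\<^sup>2 + t) * Im z"
proof -
  define n where "n = norm (z - w) / Im z"
  have p: "Im z > 0" "Im w > 0" using assms by (auto simp: UH_iff)
  have n0: "n \<ge> 0" using p by (simp add: n_def)
  have "(norm (z - w))\<^sup>2 \<le> t\<^sup>2 * (Im z * Im w)"
    using assms(4) p by (simp add: sep_def divide_le_eq)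
  moreover have "Im w \<le> Im z + norm (z - w)"
    using abs_Im_le_cmod[of "z - w"] by simp
  ultimately have "(norm (z - w))\<^sup>2 \<le> t\<^sup>2 * (Im z * (Im z + norm (z - w)))"
    using p by (meson less_imp_le mult_left_mono order_trans zero_le_power2)
  moreover have nz: "norm (z - w) = n * Im z" using p by (simp add: n_def)
  ultimately have "n\<^sup>2 * (Im z)\<^sup>2 \<le> (t\<^sup>2 * (1 + n)) * (Im z)\<^sup>2"
    by (simp add: power2_eq_square algebra_simps)
  then have le: "n\<^sup>2 \<le> t\<^sup>2 * (1 + n)" using p by simp
  have "n \<le> t\<^sup>2 + t"
  proof (rule ccontr)
    assume c: "\<not> n \<le> t\<^sup>2 + t"
    then have "n * n \<ge> (t\<^sup>2 + t) * n" using n0 by (intro mult_right_mono) auto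
    then have "t * n \<le> t\<^sup>2" using le by (simp add: power2_eq_square algebra_simps)
    moreover have "n * n > 0"
    proof -
      have "n > 0" using c assms(3) zero_le_power2[of t] by linarith
      then show ?thesis by simp
    qed
    moreover have "t\<^sup>2 \<ge> 0" by simp
    ultimately show False
    proof (cases "t = 0")
      case True then show False using le \<open>n * n > 0\<close> by (simp add: power2_eq_square)
    next
      case False
      then have "n \<le> t" using \<open>t * n \<le> t\<^sup>2\<close> assms(3) by (simp add: power2_eq_square)
      then show False using c \<open>t\<^sup>2 \<ge> 0\<close> by linarith
    qed
  qed
  then show ?thesis using p nz by (simp add: mult_right_mono)
qed

lemma size_horo_geod_small_conv:
  assumes "e > 0"
  obtains d where "d > 0" "\<And>x s. size_of (horo x * geod s) < d \<Longrightarrow> \<bar>x\<bar> < e \<and> \<bar>s\<bar> < e"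
proof -
  have "isCont ln (1::real)" by (rule isCont_ln) simp
  then obtain r where r: "r > 0" "\<And>y. \<bar>y - 1\<bar> < r \<Longrightarrow> \<bar>ln y\<bar> < e"
    using assms unfolding continuous_at_eps_delta by (metis dist_real_def ln_one diff_zero)
  define r' where "r' = min r e"
  define t where "t = min 1 (r' / 3)"
  have r': "r' > 0" using r assms by (simp add: r'_def)
  then have t: "t > 0" "t \<le> 1" "t \<le> r' / 3" by (auto simp: t_def)
  show ?thesis
  proof (rule that[of "t\<^sup>2"])
    fix x s assume *: "size_of (horo x * geod s) < t\<^sup>2"
    have "norm (\<i> - Complex x (exp s)) \<le> (t\<^sup>2 + t) * Im \<i>"
      using * t(1) by (intro sep_small_imp_near) (auto simp: size_of_def moebius_horo_geod UH_iff)
    also have "\<dots> \<le> 2 * t" using t by (simp add: power2_eq_square mult_left_le)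
    also have "\<dots> < r'" using t r' by simp
    finally have n: "norm (\<i> - Complex x (exp s)) < r'" .
    have "\<bar>x\<bar> < r'" using abs_Re_le_cmod[of "\<i> - Complex x (exp s)"] n by simp
    moreover have "\<bar>exp s - 1\<bar> < r'" using abs_Im_le_cmod[of "\<i> - Complex x (exp s)"] n by simp
    ultimately show "\<bar>x\<bar> < e \<and> \<bar>s\<bar> < e" using r(2)[of "exp s"] by (simp add: r'_def)
  qed (use t in auto)
qed

lemma real_step: assumes "(e::real) > 0" obtains n :: nat where "n > 0" "\<bar>x / real n\<bar> < e"
proof -
  obtain n :: nat where n: "\<bar>x\<bar> / e < real n" using reals_Archimedean2 by blast
  have p: "real n > 0"
  proof -
    have "0 \<le> \<bar>x\<bar> / e" using assms by simp
    then show ?thesis using n by linarith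
  qed
  then have "\<bar>x / real n\<bar> < e" using n assms by (simp add: field_simps)
  then show ?thesis using that p by simp
qed

lemma real_generated:
  fixes Q :: "real \<Rightarrow> bool"
  assumes "e > 0" "\<And>x. \<bar>x\<bar> < e \<Longrightarrow> Q x" "\<And>x y. Q x \<Longrightarrow> Q y \<Longrightarrow> Q (x + y)"
  shows "Q x"
proof -
  obtain n :: nat where n: "n > 0" "\<bar>x / real n\<bar> < e" using real_step assms(1) by blast
  have "Q (real k * (x / real n))" for k
  proof (induction k)
    case 0 show ?case using assms(1,2) by simp
  next
    case (Suc k)
    then have "Q (real k * (x / real n) + x / real n)" using assms(2,3) n by blast
    then show ?case by (simp only: of_nat_Suc distrib_right mult_1_left add.commute)
  qed
  from this[of n] n show ?thesis by simp
qed

text \<open>Every neighbourhood of the rotation group generates the group, by the Iwasawa decomposition.\<close>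

lemma psl2_generated:
  assumes "d > 0" "\<And>c. size_of c < d \<Longrightarrow> Q c" "\<And>g h. Q g \<Longrightarrow> Q h \<Longrightarrow> Q (g * h)"
  shows "Q g"
proof -
  obtain e where e: "e > 0" "\<And>x s. \<bar>x\<bar> < e \<Longrightarrow> \<bar>s\<bar> < e \<Longrightarrow> size_of (horo x * geod s) < d"
    using size_horo_geod_small[OF assms(1)] by blast
  have "Q (horo x)" for x
    using e(1) by (rule real_generated)
      (use e assms in \<open>metis geod_0 abs_zero mult_1_right, metis horo_add\<close>)
  moreover have "Q (geod s)" for s
    using e(1) by (rule real_generated)
      (use e assms in \<open>metis horo_0 abs_zero mult_1_left, metis geod_add\<close>)
  moreover obtain x s k where "g = horo x * geod s * k" "moebius k \<i> = \<i>" by (rule iwasawa)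
  ultimately show ?thesis using assms by (metis size_fix)
qed

lemma funpow_commute_comp:
  assumes "\<And>m. f (g m) = g (h m)"
  shows "(f ^^ n) (g m) = g ((h ^^ n) m)"
  by (induction n) (simp_all add: assms)

lemma funpow_comp_commute:
  assumes "\<And>m. f (g m) = g (f m)"
  shows "((\<lambda>m. f (g m)) ^^ n) m = (f ^^ n) ((g ^^ n) m)"
proof (induction n)
  case (Suc n)
  have "g ((f ^^ n) m) = (f ^^ n) (g m)" for m
    using funpow_commute_comp[of f g f n m] assms by simp
  then show ?case using Suc by simp
qed simp

text \<open>A local flow extends to a global one: the map of time \<open>x\<close> is the \<open>n\<close>-fold iterate of the map of
time \<open>x / n\<close>. Two choices \<open>n\<close> and \<open>k\<close> agree because both iterates equal the \<open>n * k\<close>-fold iterate of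
the map of time \<open>x / (n * k)\<close>.\<close>

lemma one_parameter_extension:
  fixes T :: "real \<Rightarrow> 'a \<Rightarrow> 'a"
  assumes e: "e > 0" and T0: "\<And>m. T 0 m = m"
    and T: "\<And>x y m. \<bar>x\<bar> < e \<Longrightarrow> \<bar>y\<bar> < e \<Longrightarrow> \<bar>x + y\<bar> < e \<Longrightarrow> T y (T x m) = T (x + y) m"
  shows "\<exists>\<Phi>. (\<forall>x y m. \<Phi> y (\<Phi> x m) = \<Phi> (x + y) m) \<and> (\<forall>x m. \<bar>x\<bar> < e \<longrightarrow> \<Phi> x m = T x m)"
proof -
  have A: "(T (x / real n) ^^ n) m = T x m" if "\<bar>x\<bar> < e" "n > 0" for x n m
  proof -
    have small: "\<bar>real k * (x / real n)\<bar> < e" if "k \<le> n" for k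
    proof -
      have "\<bar>real k * (x / real n)\<bar> = (real k / real n) * \<bar>x\<bar>" by (simp add: abs_mult)
      also have "\<dots> \<le> 1 * \<bar>x\<bar>" using that by (intro mult_right_mono) (auto simp: divide_le_eq_1)
      finally show ?thesis using \<open>\<bar>x\<bar> < e\<close> by simp
    qed
    have "k \<le> n \<Longrightarrow> (T (x / real n) ^^ k) m = T (real k * (x / real n)) m" for k
    proof (induction k)
      case (Suc k)
      have eq: "real (Suc k) * (x / real n) = real k * (x / real n) + x / real n"
        by (simp only: of_nat_Suc distrib_right mult_1_left add.commute)
      have "T (x / real n) (T (real k * (x / real n)) m) = T (real (Suc k) * (x / real n)) m"
        unfolding eq
        using small[of k] small[of 1] small[of "Suc k"] Suc(2) that(2) unfolding eq by (intro T) auto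
      then show ?case using Suc by simp
    qed (simp add: T0)
    from this[of n] that show ?thesis by simp
  qed
  have B: "(T (x / real n) ^^ n) m = (T (x / real k) ^^ k) m"
    if "n > 0" "k > 0" "\<bar>x / real n\<bar> < e" "\<bar>x / real k\<bar> < e" for x n k m
  proof -
    have e1: "T (x / real n) = T (x / real n / real k) ^^ k"
      by (rule ext, rule A[symmetric, OF that(3) that(2)])
    have e2: "T (x / real k) = T (x / real k / real n) ^^ n"
      by (rule ext, rule A[symmetric, OF that(4) that(1)])
    have "(T (x / real n) ^^ n) m = (T (x / (real n * real k)) ^^ (k * n)) m"
      by (subst e1) (simp only: funpow_mult divide_divide_eq_left)
    moreover have "(T (x / real k) ^^ k) m = (T (x / (real n * real k)) ^^ (k * n)) m"
      by (subst e2) (simp only: funpow_mult divide_divide_eq_left mult.commute)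
    ultimately show ?thesis by simp
  qed
  define N where "N x = (SOME n::nat. n > 0 \<and> \<bar>x / real n\<bar> < e)" for x
  have N: "N x > 0 \<and> \<bar>x / real (N x)\<bar> < e" for x
    unfolding N_def by (rule someI_ex) (use real_step e in blast)
  define \<Phi> where "\<Phi> x m = (T (x / real (N x)) ^^ N x) m" for x m
  have P: "\<Phi> x m = (T (x / real n) ^^ n) m" if "n > 0" "\<bar>x / real n\<bar> < e" for x n m
    unfolding \<Phi>_def using B N that by blast
  show ?thesis
  proof (intro exI[of _ \<Phi>] conjI allI impI)
    show "\<Phi> x m = T x m" if "\<bar>x\<bar> < e" for x m
      using P[of 1 x m] that by simp
    show "\<Phi> y (\<Phi> x m) = \<Phi> (x + y) m" for x y m
    proof -
      obtain n :: nat where n: "n > 0" "\<bar>(\<bar>x\<bar> + \<bar>y\<bar>) / real n\<bar> < e" using real_step e by blast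
      have b: "\<bar>z / real n\<bar> < e" if "\<bar>z\<bar> \<le> \<bar>x\<bar> + \<bar>y\<bar>" for z
      proof -
        have "\<bar>z / real n\<bar> \<le> \<bar>(\<bar>x\<bar> + \<bar>y\<bar>) / real n\<bar>"
          using that n by (simp add: abs_divide divide_right_mono)
        then show ?thesis using n by linarith
      qed
      have b3: "\<bar>x / real n\<bar> < e" "\<bar>y / real n\<bar> < e" "\<bar>(x + y) / real n\<bar> < e" by (rule b, linarith)+
      have eq: "T ((x + y) / real n) m = T (y / real n) (T (x / real n) m)"
        "T ((x + y) / real n) m = T (x / real n) (T (y / real n) m)" for m
        using T[of "x / real n" "y / real n" m] T[of "y / real n" "x / real n" m] b3
        by (simp_all only: add_divide_distrib add.commute[of "y / real n"])
      have "\<Phi> y (\<Phi> x m) = (T (y / real n) ^^ n) ((T (x / real n) ^^ n) m)"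
        using P n(1) b3 by simp
      also have "\<dots> = ((\<lambda>m. T (y / real n) (T (x / real n) m)) ^^ n) m"
        by (rule funpow_comp_commute[symmetric]) (simp only: eq(1)[symmetric] eq(2)[symmetric])
      also have "\<dots> = (T ((x + y) / real n) ^^ n) m" by (simp only: eq(1)[symmetric])
      also have "\<dots> = \<Phi> (x + y) m" using P n(1) b3 by simp
      finally show ?thesis .
    qed
  qed
qed

text \<open>A local action extends to the group because the quotient by the rotations is the hyperbolic
plane, which is simply connected. The proof makes this explicit. The horocyclic and the geodesic
flow extend by iteration. Their commutation relation \<open>geod_horo\<close> holds for small parameters and
therefore for all, so the two flows form an action of the affine group; the Iwasawa decomposition
defines the action of the other elements. That a small step on the right acts correctly follows
by moving it past the rotation, which preserves its size.\<close>

lemma local_action_extension: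
  fixes T :: "psl2 \<Rightarrow> 'a \<Rightarrow> 'a"
  assumes d: "d > 0" and T1: "\<And>m. T 1 m = m"
    and T: "\<And>a b m. size_of a < d \<Longrightarrow> size_of b < d \<Longrightarrow> size_of (a * b) < d \<Longrightarrow> T b (T a m) = T (a * b) m"
  obtains act d' where "d' > 0" "d' \<le> d" "\<And>m. act m 1 = m" "\<And>m g h. act (act m g) h = act m (g * h)"
    "\<And>m c. size_of c < d' \<Longrightarrow> act m c = T c m"
proof -
  obtain e where e: "e > 0" "\<And>x s. \<bar>x\<bar> < e \<Longrightarrow> \<bar>s\<bar> < e \<Longrightarrow> size_of (horo x * geod s) < d"
    using size_horo_geod_small[OF d] by blast
  have sn: "size_of (horo x) < d" if "\<bar>x\<bar> < e" for x using e(2)[of x 0] that e(1) by (simp add: geod_0)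
  have sa: "size_of (geod x) < d" if "\<bar>x\<bar> < e" for x using e(2)[of 0 x] that e(1) by (simp add: horo_0)
  have TN0: "T (horo 0) m = m" for m by (simp add: horo_0 T1)
  have TN: "T (horo y) (T (horo x) m) = T (horo (x + y)) m" if "\<bar>x\<bar> < e" "\<bar>y\<bar> < e" "\<bar>x + y\<bar> < e" for x y m
    using T[of "horo x" "horo y" m] sn that by (simp only: horo_add)
  obtain N where EN: "(\<forall>x y m. N y (N x m) = N (x + y) m) \<and> (\<forall>x m. \<bar>x\<bar> < e \<longrightarrow> N x m = T (horo x) m)"
  proof -
    have "\<exists>\<Phi>. (\<forall>x y m. \<Phi> y (\<Phi> x m) = \<Phi> (x + y) m) \<and> (\<forall>x m. \<bar>x\<bar> < e \<longrightarrow> \<Phi> x m = T (horo x) m)"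
      by (rule one_parameter_extension[OF e(1)], rule TN0, rule TN; assumption)
    then show ?thesis using that by (elim exE)
  qed
  have N: "N y (N x m) = N (x + y) m" "\<bar>x\<bar> < e \<Longrightarrow> N x m = T (horo x) m" for x y m
    using EN by simp_all
  have TA0: "T (geod 0) m = m" for m by (simp add: geod_0 T1)
  have TA: "T (geod y) (T (geod x) m) = T (geod (x + y)) m" if "\<bar>x\<bar> < e" "\<bar>y\<bar> < e" "\<bar>x + y\<bar> < e" for x y m
    using T[of "geod x" "geod y" m] sa that by (simp only: geod_add)
  obtain A where EA: "(\<forall>x y m. A y (A x m) = A (x + y) m) \<and> (\<forall>x m. \<bar>x\<bar> < e \<longrightarrow> A x m = T (geod x) m)"
  proof -
    have "\<exists>\<Phi>. (\<forall>x y m. \<Phi> y (\<Phi> x m) = \<Phi> (x + y) m) \<and> (\<forall>x m. \<bar>x\<bar> < e \<longrightarrow> \<Phi> x m = T (geod x) m)"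
      by (rule one_parameter_extension[OF e(1)], rule TA0, rule TA; assumption)
    then show ?thesis using that by (elim exE)
  qed
  have A: "A y (A x m) = A (x + y) m" "\<bar>x\<bar> < e \<Longrightarrow> A x m = T (geod x) m" for x y m
    using EA by simp_all
  define e3 where "e3 = min e 1 / 3"
  have e3: "e3 > 0" "e3 \<le> e" "e3 \<le> 1 / 3" using e by (auto simp: e3_def)
  have c1: "N q (T (geod s) m) = T (geod s) (N (exp s * q) m)" if s: "\<bar>s\<bar> < e3" and q: "\<bar>q\<bar> < e3" for s q m
  proof -
    have "exp s \<le> exp 1" using s e3 by simp
    then have "exp s \<le> 3" using exp_le by linarith
    then have "exp s * \<bar>q\<bar> \<le> 3 * \<bar>q\<bar>" by (intro mult_right_mono) auto
    then have q': "\<bar>exp s * q\<bar> < e" using q by (simp add: abs_mult e3_def)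
    have "N q (T (geod s) m) = T (horo q) (T (geod s) m)" using N(2) q e3 by simp
    also have "\<dots> = T (geod s * horo q) m"
      using sn sa e3 s q e(2)[OF q'] by (intro T) (auto simp: geod_horo)
    also have "\<dots> = T (geod s) (T (horo (exp s * q)) m)"
      unfolding geod_horo using sn sa e3 s q e(2)[OF q'] q' by (intro T[symmetric]) auto
    finally show ?thesis using N(2) q' by simp
  qed
  have c2: "N q (T (geod s) m) = T (geod s) (N (exp s * q) m)" if s: "\<bar>s\<bar> < e3" for s q m
  proof -
    have "\<forall>m. N q (T (geod s) m) = T (geod s) (N (exp s * q) m)"
    proof (rule real_generated[OF e3(1), where Q = "\<lambda>q. \<forall>m. N q (T (geod s) m) = T (geod s) (N (exp s * q) m)"])
      fix x y
      assume "\<forall>m. N x (T (geod s) m) = T (geod s) (N (exp s * x) m)" "\<forall>m. N y (T (geod s) m) = T (geod s) (N (exp s * y) m)"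
      then show "\<forall>m. N (x + y) (T (geod s) m) = T (geod s) (N (exp s * (x + y)) m)"
        by (metis N(1) distrib_left)
    qed (use c1 s in blast)
    then show ?thesis by blast
  qed
  have c3: "N q (A s m) = A s (N (exp s * q) m)" for s q m
  proof -
    have "\<forall>q m. N q (A s m) = A s (N (exp s * q) m)"
    proof (rule real_generated[OF e3(1), where Q = "\<lambda>s. \<forall>q m. N q (A s m) = A s (N (exp s * q) m)"])
      fix x y
      assume *: "\<forall>q m. N q (A x m) = A x (N (exp x * q) m)" "\<forall>q m. N q (A y m) = A y (N (exp y * q) m)"
      show "\<forall>q m. N q (A (x + y) m) = A (x + y) (N (exp (x + y) * q) m)"
        using * by (simp add: A(1)[symmetric] exp_add mult.assoc)
    qed (use c2 A(2) e3 in simp)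
    then show ?thesis by blast
  qed
  define P where "P g = (SOME p. g = horo (fst p) * geod (fst (snd p)) * snd (snd p) \<and> moebius (snd (snd p)) \<i> = \<i>)" for g
  define act where "act m g = T (snd (snd (P g))) (A (fst (snd (P g))) (N (fst (P g)) m))" for m g
  have act: "act m (horo x * geod s * k) = T k (A s (N x m))" if k: "moebius k \<i> = \<i>" for m x s k
  proof -
    let ?p = "P (horo x * geod s * k)"
    have "horo x * geod s * k = horo (fst ?p) * geod (fst (snd ?p)) * snd (snd ?p) \<and> moebius (snd (snd ?p)) \<i> = \<i>"
      unfolding P_def by (rule someI[of _ "(x, s, k)"]) (simp add: k)
    then have "x = fst ?p \<and> s = fst (snd ?p) \<and> k = snd (snd ?p)"
      using iwasawa_unique k by blast
    then show ?thesis unfolding act_def by auto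
  qed
  obtain d1 where d1: "d1 > 0" "\<And>x s. size_of (horo x * geod s) < d1 \<Longrightarrow> \<bar>x\<bar> < e \<and> \<bar>s\<bar> < e"
    using size_horo_geod_small_conv e(1) by blast
  define d' where "d' = min d d1"
  have step: "T c (act m g) = act m (g * c)" if c: "size_of c < d'" for c m g
  proof -
    obtain x s k where g: "g = horo x * geod s * k" "moebius k \<i> = \<i>" by (rule iwasawa)
    obtain q r k' where kc: "k * c = horo q * geod r * k'" "moebius k' \<i> = \<i>" by (rule iwasawa)
    have sz: "size_of (horo q * geod r) = size_of c"
      using size_fix_left[OF g(2), of c] size_fix_right[OF kc(2)] kc(1) by metis
    have qr: "\<bar>q\<bar> < e" "\<bar>r\<bar> < e" using d1(2)[of q r] c sz by (auto simp: d'_def)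
    let ?m = "A s (N x m)"
    have "T c (act m g) = T c (T k ?m)" using act g by simp
    also have "\<dots> = T (k * c) ?m"
      using c g(2) d size_fix size_fix_left by (intro T) (auto simp: d'_def)
    also have "\<dots> = T k' (T (horo q * geod r) ?m)"
      unfolding kc using c sz kc(2) d size_fix size_fix_right by (intro T[symmetric]) (auto simp: d'_def)
    also have "T (horo q * geod r) ?m = T (geod r) (T (horo q) ?m)"
      using qr sn sa e(2) by (intro T[symmetric]) auto
    also have "\<dots> = A r (N q ?m)" using qr A(2) N(2) by simp
    also have "\<dots> = A (s + r) (N (x + exp s * q) m)" by (simp add: c3 A(1) N(1))
    also have "T k' \<dots> = act m (horo (x + exp s * q) * geod (s + r) * k')" using act kc(2) by simp
    also have "horo (x + exp s * q) * geod (s + r) * k' = horo x * (horo (exp s * q) * geod s) * (geod r * k')"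
      by (simp add: horo_add[symmetric] geod_add[symmetric] mult.assoc)
    also have "\<dots> = horo x * geod s * (horo q * geod r * k')"
      by (simp add: geod_horo[symmetric] mult.assoc)
    also have "\<dots> = g * c" using g kc(1) by (simp add: mult.assoc)
    finally show ?thesis .
  qed
  have act1: "act m 1 = m" for m
  proof -
    have "act m (horo 0 * geod 0 * 1) = T 1 (A 0 (N 0 m))" by (rule act) (simp add: moebius_1)
    then show ?thesis using N(2)[of 0] A(2)[of 0] e(1) by (simp add: horo_0 geod_0 T1)
  qed
  have d'0: "d' > 0" using d d1 by (simp add: d'_def)
  have small: "act m c = T c m" if "size_of c < d'" for m c
    using step[OF that, of m 1] by (simp add: act1)
  have "\<forall>m g. act (act m g) h = act m (g * h)" for h
  proof (rule psl2_generated[OF d'0, where Q = "\<lambda>h. \<forall>m g. act (act m g) h = act m (g * h)"])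
    fix c assume "size_of c < d'" then show "\<forall>m g. act (act m g) c = act m (g * c)"
      using small step by simp
  next
    fix g h assume "\<forall>m ga. act (act m ga) g = act m (ga * g)" "\<forall>m g. act (act m g) h = act m (g * h)"
    then show "\<forall>m ga. act (act m ga) (g * h) = act m (ga * (g * h))" by (metis mult.assoc)
  qed
  then have assoc: "act (act m g) h = act m (g * h)" for m g h by blast
  have "d' \<le> d" by (simp add: d'_def)
  then show ?thesis by (rule that[OF d'0 _ act1 assoc small])
qed

section \<open>Charts and unit tangent vectors of the lamination\<close>

text \<open>Hyperbolic disks are Euclidean disks, hence convex; so the overlap of two charts inside a plaque
is connected.\<close>

lemma hyp_disk_eq_ball:
  assumes "c \<in> UH" "r > 0"
  shows "hyp_disk c r = ball (Complex (Re c) (Im c * cosh r)) (Im c * sinh r)"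
proof -
  have c: "Im c > 0" using assms by (simp add: UH_iff)
  have "z \<in> hyp_disk c r \<longleftrightarrow> z \<in> ball (Complex (Re c) (Im c * cosh r)) (Im c * sinh r)" for z
  proof -
    have ball: "z \<in> ball (Complex (Re c) (Im c * cosh r)) (Im c * sinh r) \<longleftrightarrow>
      (Re c - Re z)\<^sup>2 + (Im c * cosh r - Im z)\<^sup>2 < (Im c * sinh r)\<^sup>2"
    proof -
      have "Im c * sinh r \<ge> 0" using c assms by simp
      then have "norm w < Im c * sinh r \<longleftrightarrow> (norm w)\<^sup>2 < (Im c * sinh r)\<^sup>2" for w :: complex
        by (metis norm_ge_zero power2_less_imp_less power_strict_mono zero_less_numeral)
      then show ?thesis by (simp add: dist_norm cmod_power2)
    qed
    have eq: "(Re c - Re z)\<^sup>2 + (Im c * cosh r - Im z)\<^sup>2 - (Im c * sinh r)\<^sup>2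
      = (norm (c - z))\<^sup>2 - 2 * Im c * Im z * (cosh r - 1)"
    proof -
      have "(Im c * cosh r)\<^sup>2 - (Im c * sinh r)\<^sup>2 = (Im c)\<^sup>2"
        using cosh_square_eq[of r] by (simp add: power_mult_distrib algebra_simps)
      moreover have "(norm (c - z))\<^sup>2 = (Re c - Re z)\<^sup>2 + (Im c - Im z)\<^sup>2" by (simp add: cmod_power2)
      ultimately show ?thesis by (simp add: power2_eq_square algebra_simps)
    qed
    show ?thesis
    proof (cases "Im z > 0")
      case True
      let ?q = "1 + (norm (c - z))\<^sup>2 / (2 * Im c * Im z)"
      have q: "?q \<ge> 1" using c True by simp
      have "hyp_dist c z < r \<longleftrightarrow> cosh (arcosh ?q) < cosh r"
        unfolding hyp_dist_def using arcosh_nonneg_real[OF q] assms(2)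
        by (subst cosh_real_nonneg_less_iff) auto
      also have "\<dots> \<longleftrightarrow> ?q < cosh r" by (simp add: cosh_arcosh_real[OF q])
      also have "\<dots> \<longleftrightarrow> (norm (c - z))\<^sup>2 / (2 * Im c * Im z) < cosh r - 1" by linarith
      also have "\<dots> \<longleftrightarrow> (norm (c - z))\<^sup>2 < (cosh r - 1) * (2 * Im c * Im z)"
        using c True by (intro pos_divide_less_eq) simp
      also have "\<dots> \<longleftrightarrow> (norm (c - z))\<^sup>2 - 2 * Im c * Im z * (cosh r - 1) < 0"
        by (simp add: algebra_simps)
      finally show ?thesis unfolding ball eq[symmetric] hyp_disk_def using True by (auto simp: UH_iff)
    next
      case False
      have "cosh r - 1 \<ge> 0" using cosh_real_ge_1 by simp
      then have "2 * Im c * Im z * (cosh r - 1) \<le> 0" using False c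
        by (intro mult_nonpos_nonneg[OF mult_nonneg_nonpos]) auto
      then have "(norm (c - z))\<^sup>2 - 2 * Im c * Im z * (cosh r - 1) \<ge> 0"
        using zero_le_power2[of "norm (c - z)"] by linarith
      then show ?thesis unfolding ball hyp_disk_def using False eq by (auto simp: UH_iff)
    qed
  qed
  then show ?thesis by blast
qed

lemma moebius_in_hyp_disk:
  assumes "z \<in> UH" "c \<in> UH" "g * h = 1" "h * g = 1"
  shows "moebius g z \<in> hyp_disk c r \<longleftrightarrow> z \<in> hyp_disk (moebius h c) r"
proof -
  have "hyp_dist (moebius h c) z = hyp_dist (moebius h c) (moebius h (moebius g z))"
    using assms by (metis moebius_1 moebius_mult)
  also have "\<dots> = hyp_dist c (moebius g z)" using assms moebius_UH by (intro hyp_dist_moebius) auto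
  finally show ?thesis using assms moebius_UH by (simp add: hyp_disk_def)
qed

locale hyp_lam =
  fixes L :: "('m, 'i, 't) lamination"
  assumes lam: "compact_hyperbolic_lamination L"
begin

abbreviation "X \<equiv> ambient L"
abbreviation "U \<equiv> chart_dom L"
abbreviation "D \<equiv> disk L"
abbreviation "TT a \<equiv> topspace (trans_space L a)"
abbreviation "pt a z t \<equiv> chart_inv L a (z, t)"
abbreviation "coc \<equiv> cocycle L"
abbreviation "hol \<equiv> holonomy L"
abbreviation "cz a x \<equiv> fst (chart L a x)"
abbreviation "ct a x \<equiv> snd (chart L a x)"

lemma compact_X: "compact_space X" and metrizable_X: "metrizable_space X"
  and open_U: "openin X (U a)" and cover_U: "(\<Union>a. U a) = topspace X"
  and disk_ex: "\<exists>c\<in>UH. \<exists>r>0. D a = hyp_disk c r"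
  and chart_homeo: "homeomorphic_map (subtopology X (U a))
        (prod_topology (top_of_set (D a)) (trans_space L a)) (chart L a)"
  using lam unfolding compact_hyperbolic_lamination_def by blast+

lemma transition:
  "(y, t) \<in> chart L b ` (U a \<inter> U b) \<Longrightarrow> chart L a (pt b y t) = (moebius (coc a b t) y, hol a b t)"
  using lam unfolding compact_hyperbolic_lamination_def by blast

lemma Hausdorff_X: "Hausdorff_space X"
  by (simp add: metrizable_X metrizable_imp_Hausdorff_space)

lemma U_sub: "U a \<subseteq> topspace X" using open_U openin_subset by blast

lemma disk_ball: "\<exists>p s. D a = ball p s \<and> s > 0"
proof -
  obtain c r where "c \<in> UH" "r > 0" "D a = hyp_disk c r" using disk_ex by blast
  then have "D a = ball (Complex (Re c) (Im c * cosh r)) (Im c * sinh r)" "Im c * sinh r > 0"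
    using hyp_disk_eq_ball by (auto simp: UH_iff)
  then show ?thesis by blast
qed

lemma D_open: "open (D a)" and D_convex: "convex (D a)" and D_ne: "D a \<noteq> {}"
proof -
  obtain p s where D: "D a = ball p s" "s > 0" using disk_ball by blast
  then have "p \<in> D a" by simp
  then show "open (D a)" "convex (D a)" "D a \<noteq> {}" using D by auto
qed

lemma D_UH: "D a \<subseteq> UH"
  using disk_ex[of a] by (auto simp: hyp_disk_def)

lemma convex_overlap: "convex {z \<in> D a. moebius g z \<in> D b}"
proof -
  obtain c r where c: "c \<in> UH" "r > 0" "D b = hyp_disk c r" using disk_ex by blast
  obtain h where h: "g * h = 1" "h * g = 1" by (rule psl2_inverse)
  have "{z \<in> D a. moebius g z \<in> D b} = D a \<inter> hyp_disk (moebius h c) r"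
    using c moebius_in_hyp_disk[OF _ c(1) h] D_UH[of a] by blast
  also have "hyp_disk (moebius h c) r = ball (Complex (Re (moebius h c)) (Im (moebius h c) * cosh r)) (Im (moebius h c) * sinh r)"
    by (rule hyp_disk_eq_ball) (use c moebius_UH in auto)
  finally show ?thesis by (simp add: convex_Int D_convex)
qed

lemma chart_bij: "bij_betw (chart L a) (U a) (D a \<times> TT a)"
proof -
  have "topspace (subtopology X (U a)) = U a" using U_sub by auto
  then show ?thesis
    using homeomorphic_imp_surjective_map[OF chart_homeo[of a]]
      homeomorphic_imp_injective_map[OF chart_homeo[of a]]
    by (simp add: bij_betw_def)
qed

lemma pt_in: "z \<in> D a \<Longrightarrow> t \<in> TT a \<Longrightarrow> pt a z t \<in> U a"
  and chart_pt: "z \<in> D a \<Longrightarrow> t \<in> TT a \<Longrightarrow> chart L a (pt a z t) = (z, t)"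
  using chart_bij[of a] unfolding chart_inv_def bij_betw_def
  by (metis inv_into_into mem_Sigma_iff, metis f_inv_into_f mem_Sigma_iff)

lemma cz_in: "x \<in> U a \<Longrightarrow> cz a x \<in> D a"
  using bij_betw_apply[OF chart_bij[of a]] by (simp add: mem_Times_iff)

lemma ct_in: "x \<in> U a \<Longrightarrow> ct a x \<in> TT a"
  using bij_betw_apply[OF chart_bij[of a]] by (simp add: mem_Times_iff)

lemma pt_chart: "x \<in> U a \<Longrightarrow> pt a (cz a x) (ct a x) = x"
  using chart_bij[of a] by (simp add: chart_inv_def bij_betw_def)

lemma continuous_chart:
  "continuous_map (subtopology X (U a)) (prod_topology (top_of_set (D a)) (trans_space L a)) (chart L a)"
  using chart_homeo homeomorphic_imp_continuous_map by blast

lemma continuous_pt: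
  "continuous_map (prod_topology (top_of_set (D a)) (trans_space L a)) X (chart_inv L a)"
proof -
  let ?Y = "prod_topology (top_of_set (D a)) (trans_space L a)"
  obtain g where g: "homeomorphic_maps (subtopology X (U a)) ?Y (chart L a) g"
    using chart_homeo homeomorphic_map_maps by blast
  have ts: "topspace (subtopology X (U a)) = U a" using U_sub by auto
  have "continuous_map ?Y (subtopology X (U a)) g" using g by (simp add: homeomorphic_maps_def)
  then have "continuous_map ?Y X g" using continuous_map_in_subtopology by blast
  moreover have "g p = chart_inv L a p" if "p \<in> topspace ?Y" for p
  proof -
    have "chart L a (g p) = p" "g p \<in> U a"
      using g that ts unfolding homeomorphic_maps_def continuous_map_def by auto
    then show ?thesis using pt_chart by (metis prod.collapse)
  qed
  ultimately show ?thesis by (rule continuous_map_eq)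
qed

lemma continuous_pt1: "t \<in> TT a \<Longrightarrow> continuous_map (top_of_set (D a)) X (\<lambda>z. pt a z t)"
proof -
  assume "t \<in> TT a"
  then have "continuous_map (top_of_set (D a)) (prod_topology (top_of_set (D a)) (trans_space L a)) (\<lambda>z. (z, t))"
    by (simp add: continuous_map_pairedI)
  from continuous_map_compose[OF this continuous_pt] show ?thesis by (simp add: o_def)
qed

lemma continuous_pt2: "z \<in> D a \<Longrightarrow> continuous_map (trans_space L a) X (\<lambda>t. pt a z t)"
proof -
  assume "z \<in> D a"
  then have "continuous_map (trans_space L a) (prod_topology (top_of_set (D a)) (trans_space L a)) (\<lambda>t. (z, t))"
    by (simp add: continuous_map_pairedI)
  from continuous_map_compose[OF this continuous_pt] show ?thesis by (simp add: o_def)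
qed

lemma open_slice:
  assumes "openin X V" "t \<in> TT a" shows "open {z \<in> D a. pt a z t \<in> V}"
  using openin_continuous_map_preimage[OF continuous_pt1[OF assms(2)] assms(1)]
    openin_open_eq[OF D_open] by auto

lemma chart_overlap:
  assumes "x \<in> U a" "x \<in> U b"
  shows "chart L b x = (moebius (coc b a (ct a x)) (cz a x), hol b a (ct a x))"
proof -
  have "(cz a x, ct a x) \<in> chart L a ` (U b \<inter> U a)" using assms by auto
  from transition[OF this] show ?thesis unfolding pt_chart[OF assms(1)] .
qed

lemma pt_overlap:
  assumes "z \<in> D a" "t \<in> TT a" "pt a z t \<in> U b"
  shows "moebius (coc b a t) z \<in> D b" "hol b a t \<in> TT b"
    "pt a z t = pt b (moebius (coc b a t) z) (hol b a t)"
proof -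
  have c: "chart L b (pt a z t) = (moebius (coc b a t) z, hol b a t)"
    using chart_overlap[of "pt a z t" a b] assms by (simp add: pt_in chart_pt)
  show "moebius (coc b a t) z \<in> D b" "hol b a t \<in> TT b"
    using cz_in[OF assms(3)] ct_in[OF assms(3)] by (simp_all add: c)
  show "pt a z t = pt b (moebius (coc b a t) z) (hol b a t)"
    using pt_chart[OF assms(3)] by (simp add: c)
qed

text \<open>The points of the overlap of the two disks at which the charts describe the same point of \<open>M\<close> form
an open set, which is also closed because \<open>M\<close> is Hausdorff. The overlap is convex.\<close>

lemma overlap_propagates:
  assumes z: "z \<in> D a" and t: "t \<in> TT a" and x: "pt a z t \<in> U b"
    and z': "z' \<in> D a" "moebius (coc b a t) z' \<in> D b"
  shows "pt a z' t \<in> U b"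
proof -
  let ?g = "coc b a t" and ?h = "hol b a t"
  let ?S = "{z \<in> D a. moebius ?g z \<in> D b}"
  have hT: "?h \<in> TT b" and gz: "moebius ?g z \<in> D b" using pt_overlap[OF z t x] by auto
  have cm: "continuous_on UH (moebius ?g)"
  proof -
    have "\<exists>D. (moebius ?g has_field_derivative D) (at z)" if "z \<in> UH" for z
      using moebius_mk_deriv that psl2_eq_mk[of ?g] unfolding UH_iff by metis
    then show ?thesis by (meson DERIV_isCont continuous_at_imp_continuous_on)
  qed
  show ?thesis
  proof (rule connected_induction_simple[of ?S z z' "\<lambda>z. pt a z t \<in> U b"])
    show "connected ?S" by (simp add: convex_connected convex_overlap)
    fix w assume w: "w \<in> ?S"
    let ?y = "pt b (moebius ?g w) ?h"
    have oS: "openin (top_of_set ?S) {v \<in> D a. pt a v t \<in> V \<and> v \<in> ?S}" if "openin X V" for V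
      using open_slice[OF that t] by (auto simp: openin_open)
    show "\<exists>T. openin (top_of_set ?S) T \<and> w \<in> T \<and> (\<forall>u\<in>T. \<forall>v\<in>T. pt a u t \<in> U b \<longrightarrow> pt a v t \<in> U b)"
    proof (cases "pt a w t \<in> U b")
      case True
      show ?thesis
        using oS[OF open_U[of b]] w True by (intro exI[of _ "{v \<in> D a. pt a v t \<in> U b \<and> v \<in> ?S}"]) auto
    next
      case False
      have yU: "?y \<in> U b" using w hT by (auto simp: pt_in)
      then have ne: "pt a w t \<noteq> ?y" using False by auto
      moreover have "pt a w t \<in> topspace X" "?y \<in> topspace X"
        using w t pt_in U_sub yU by blast+
      ultimately obtain V W where VW: "openin X V" "openin X W" "pt a w t \<in> V" "?y \<in> W" "disjnt V W"
        using Hausdorff_X unfolding Hausdorff_space_def by metis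
      let ?T = "{v \<in> D a. pt a v t \<in> V \<and> v \<in> ?S} \<inter> {v \<in> ?S. pt b (moebius ?g v) ?h \<in> W}"
      have "openin (top_of_set ?S) (?S \<inter> moebius ?g -` {y \<in> D b. pt b y ?h \<in> W})"
        using open_slice[OF VW(2) hT] D_UH[of a]
        by (intro continuous_openin_preimage_gen continuous_on_subset[OF cm]) auto
      moreover have "?S \<inter> moebius ?g -` {y \<in> D b. pt b y ?h \<in> W} = {v \<in> ?S. pt b (moebius ?g v) ?h \<in> W}"
        by auto
      ultimately have "openin (top_of_set ?S) ?T" using oS[OF VW(1)] by (simp add: openin_Int)
      moreover have "w \<in> ?T" using VW w by auto
      moreover have "pt a u t \<notin> U b" if u: "u \<in> ?T" for u
      proof
        assume "pt a u t \<in> U b"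
        then have "pt a u t = pt b (moebius ?g u) ?h" using pt_overlap(3)[of u a t b] u t by auto
        then show False using u VW(5) by (auto simp: disjnt_iff)
      qed
      ultimately show ?thesis by blast
    qed
  qed (use z z' gz x in auto)
qed

lemma coc_self: assumes "t \<in> TT a" shows "coc a a t = 1" "hol a a t = t"
proof -
  have *: "moebius (coc a a t) z = z \<and> hol a a t = t" if "z \<in> D a" for z
    using chart_overlap[of "pt a z t" a a] that assms by (simp add: pt_in chart_pt)
  then show "hol a a t = t" using D_ne[of a] by blast
  show "coc a a t = 1"
    by (rule moebius_identity[OF D_open[of a] D_ne D_UH]) (use * in \<open>simp add: moebius_1\<close>)
qed

text \<open>Both sides act in the same way on the open set of points of the plaque that lie in all three
charts.\<close>

lemma coc_comp:
  assumes z: "z \<in> D a" and t: "t \<in> TT a" and x: "pt a z t \<in> U b" "pt a z t \<in> U c"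
  shows "coc c b (hol b a t) * coc b a t = coc c a t" "hol c b (hol b a t) = hol c a t"
proof -
  let ?W = "{z \<in> D a. pt a z t \<in> U b \<inter> U c}"
  have *: "moebius (coc c b (hol b a t)) (moebius (coc b a t) z) = moebius (coc c a t) z \<and>
      hol c b (hol b a t) = hol c a t" if "z \<in> ?W" for z
  proof -
    have w: "z \<in> D a" "pt a z t \<in> U a" "pt a z t \<in> U b" "pt a z t \<in> U c" using that t pt_in by auto
    show ?thesis using chart_overlap[OF w(2,3)] chart_overlap[OF w(2,4)] chart_overlap[OF w(3,4)]
      by (simp add: chart_pt[OF w(1) t])
  qed
  have "open ?W" by (intro open_slice openin_Int open_U t)
  moreover have "z \<in> ?W" using z x by auto
  ultimately show "coc c b (hol b a t) * coc b a t = coc c a t" "hol c b (hol b a t) = hol c a t"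
    using * D_UH[of a] by (auto intro!: moebius_identity[of ?W] simp: moebius_mult subset_iff)
qed

text \<open>The vector with coordinates \<open>g\<close> and \<open>t\<close> in the chart \<open>a\<close>, the unit tangent vectors of the disk being
written as group elements. In these coordinates right multiplication is literally \<open>g \<mapsto> g * c\<close>.\<close>

definition P where "P a g t = bundle_chart_inv L a (tvec g, t)"
definition valid where "valid a g t \<longleftrightarrow> moebius g \<i> \<in> D a \<and> t \<in> TT a"

lemma valid_pt: "valid a g t \<Longrightarrow> pt a (moebius g \<i>) t \<in> U a"
  and chart_valid: "valid a g t \<Longrightarrow> chart L a (pt a (moebius g \<i>) t) = (moebius g \<i>, t)"
  by (simp_all add: valid_def pt_in chart_pt)

lemma tangent_reps_iff:
  "(a, x, u) \<in> tangent_reps L \<longleftrightarrow> (\<exists>g t. valid a g t \<and> x = pt a (moebius g \<i>) t \<and> u = tvec g)"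
proof
  assume *: "(a, x, u) \<in> tangent_reps L"
  then have u: "x \<in> U a" "u \<in> unit_tangent (D a)" "fst u = cz a x" by (auto simp: tangent_reps_def)
  obtain g where g: "u = tvec g" "moebius g \<i> \<in> D a" using unit_tangent_tvec[OF u(2)] by blast
  then show "\<exists>g t. valid a g t \<and> x = pt a (moebius g \<i>) t \<and> u = tvec g"
    using u pt_chart[OF u(1)] ct_in[OF u(1)] by (intro exI[of _ g] exI[of _ "ct a x"]) (auto simp: valid_def fst_tvec)
next
  assume "\<exists>g t. valid a g t \<and> x = pt a (moebius g \<i>) t \<and> u = tvec g"
  then obtain g t where *: "valid a g t" "x = pt a (moebius g \<i>) t" "u = tvec g" by blast
  then show "(a, x, u) \<in> tangent_reps L" using valid_pt chart_valid
    by (auto simp: tangent_reps_def tvec_in_unit_tangent valid_def fst_tvec)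
qed

lemma tangent_reps_cases:
  assumes "r \<in> tangent_reps L"
  obtains a g t where "r = (a, pt a (moebius g \<i>) t, tvec g)" "valid a g t"
proof -
  obtain a x u where "r = (a, x, u)" by (metis surj_pair)
  then show ?thesis using assms that tangent_reps_iff by blast
qed

lemma tangent_rel_iff:
  assumes "valid a g t" "valid b g' t'"
  shows "((a, pt a (moebius g \<i>) t, tvec g), (b, pt b (moebius g' \<i>) t', tvec g')) \<in> tangent_rel L \<longleftrightarrow>
    pt a (moebius g \<i>) t \<in> U b \<and> t' = hol b a t \<and> g' = coc b a t * g" (is "?l \<longleftrightarrow> ?r")
proof
  assume l: ?l
  then have e: "pt b (moebius g' \<i>) t' = pt a (moebius g \<i>) t" "tvec g' = push (coc b a (ct a (pt a (moebius g \<i>) t))) (tvec g)"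
    by (auto simp: tangent_rel_def)
  then have "g' = coc b a t * g" using tvec_inj by (simp add: chart_valid[OF assms(1)] tvec_mult[symmetric])
  moreover have "t' = hol b a t"
    using chart_overlap[of "pt a (moebius g \<i>) t" a b] valid_pt[OF assms(1)] valid_pt[OF assms(2)]
      chart_valid[OF assms(1)] chart_valid[OF assms(2)] e(1) by simp
  ultimately show ?r using valid_pt[OF assms(2)] e(1) by simp
next
  assume r: ?r
  have a: "moebius g \<i> \<in> D a" "t \<in> TT a" using assms by (auto simp: valid_def)
  have "pt b (moebius g' \<i>) t' = pt a (moebius g \<i>) t"
    using r pt_overlap(3)[OF a, of b] by (simp add: moebius_mult ii_UH)
  moreover have "(a, pt a (moebius g \<i>) t, tvec g) \<in> tangent_reps L"
    "(b, pt b (moebius g' \<i>) t', tvec g') \<in> tangent_reps L"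
    using assms tangent_reps_iff by blast+
  ultimately show ?l using r assms(1)
    unfolding tangent_rel_def by (simp add: chart_valid tvec_mult)
qed

lemma valid_transport:
  assumes "valid a g t" "pt a (moebius g \<i>) t \<in> U b"
  shows "valid b (coc b a t * g) (hol b a t)"
  using pt_overlap[of "moebius g \<i>" a t b] assms by (simp add: valid_def moebius_mult ii_UH)

lemma pt_transport:
  assumes "valid a g t" "pt a (moebius g \<i>) t \<in> U b"
  shows "pt b (moebius (coc b a t * g) \<i>) (hol b a t) = pt a (moebius g \<i>) t"
  using pt_overlap[of "moebius g \<i>" a t b] assms by (simp add: valid_def moebius_mult ii_UH)

lemma tangent_equiv: "equiv (tangent_reps L) (tangent_rel L)"
proof (rule equivI)
  show "tangent_rel L \<subseteq> tangent_reps L \<times> tangent_reps L"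
    by (auto simp: tangent_rel_def)
  show "refl_on (tangent_reps L) (tangent_rel L)"
  proof (rule refl_onI)
    fix r assume "r \<in> tangent_reps L"
    then obtain a g t where r: "r = (a, pt a (moebius g \<i>) t, tvec g)" "valid a g t"
      by (rule tangent_reps_cases)
    then show "(r, r) \<in> tangent_rel L"
      using tangent_rel_iff[OF r(2) r(2)] valid_pt[OF r(2)] coc_self[of t a] by (simp add: valid_def)
  qed
  show "sym (tangent_rel L)"
  proof (rule symI)
    fix r s assume rs: "(r, s) \<in> tangent_rel L"
    then have rs': "r \<in> tangent_reps L" "s \<in> tangent_reps L" by (auto simp: tangent_rel_def)
    obtain a g t where r: "r = (a, pt a (moebius g \<i>) t, tvec g)" "valid a g t"
      by (rule tangent_reps_cases[OF rs'(1)])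
    obtain b g' t' where s: "s = (b, pt b (moebius g' \<i>) t', tvec g')" "valid b g' t'"
      by (rule tangent_reps_cases[OF rs'(2)])
    have *: "pt a (moebius g \<i>) t \<in> U b" "t' = hol b a t" "g' = coc b a t * g"
      using rs tangent_rel_iff[OF r(2) s(2)] r s by auto
    have "coc a b t' * coc b a t = coc a a t" "hol a b t' = hol a a t"
      using coc_comp[of "moebius g \<i>" a t b a] * r(2) valid_pt[OF r(2)] by (auto simp: valid_def)
    then have "coc a b t' * g' = g" "hol a b t' = t"
      using coc_self[of t a] r(2) * by (auto simp: valid_def mult.assoc[symmetric])
    moreover have "pt b (moebius g' \<i>) t' \<in> U a"
      using pt_transport[OF r(2) *(1)] * valid_pt[OF r(2)] by simp
    ultimately show "(s, r) \<in> tangent_rel L"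
      using tangent_rel_iff[OF s(2) r(2)] r(1) s(1) by simp
  qed
  show "trans (tangent_rel L)"
  proof (rule transI)
    fix r s q assume rs: "(r, s) \<in> tangent_rel L" and sq: "(s, q) \<in> tangent_rel L"
    then have rsq: "r \<in> tangent_reps L" "s \<in> tangent_reps L" "q \<in> tangent_reps L" by (auto simp: tangent_rel_def)
    obtain a g t where r: "r = (a, pt a (moebius g \<i>) t, tvec g)" "valid a g t"
      by (rule tangent_reps_cases[OF rsq(1)])
    obtain b g' t' where s: "s = (b, pt b (moebius g' \<i>) t', tvec g')" "valid b g' t'"
      by (rule tangent_reps_cases[OF rsq(2)])
    obtain c k w where q: "q = (c, pt c (moebius k \<i>) w, tvec k)" "valid c k w"
      by (rule tangent_reps_cases[OF rsq(3)])
    have *: "pt a (moebius g \<i>) t \<in> U b" "t' = hol b a t" "g' = coc b a t * g"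
      using rs tangent_rel_iff[OF r(2) s(2)] r s by auto
    have **: "pt b (moebius g' \<i>) t' \<in> U c" "w = hol c b t'" "k = coc c b t' * g'"
      using sq tangent_rel_iff[OF s(2) q(2)] q s by auto
    have "pt a (moebius g \<i>) t \<in> U c" using **(1) * pt_transport[OF r(2) *(1)] by simp
    moreover from this have "coc c b t' * coc b a t = coc c a t" "hol c b t' = hol c a t"
      using coc_comp[of "moebius g \<i>" a t b c] * r(2) by (auto simp: valid_def)
    ultimately show "(r, q) \<in> tangent_rel L"
      using tangent_rel_iff[OF r(2) q(2)] r(1) q(1) * ** by (simp add: mult.assoc[symmetric])
  qed
qed

lemma P_eq_iff:
  assumes "valid a g t" "valid b g' t'"
  shows "P a g t = P b g' t' \<longleftrightarrow> pt a (moebius g \<i>) t \<in> U b \<and> t' = hol b a t \<and> g' = coc b a t * g"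
proof -
  have "(a, pt a (moebius g \<i>) t, tvec g) \<in> tangent_reps L" "(b, pt b (moebius g' \<i>) t', tvec g') \<in> tangent_reps L"
    using assms tangent_reps_iff by blast+
  then show ?thesis
    using eq_equiv_class_iff[OF tangent_equiv] tangent_rel_iff[OF assms]
    by (simp add: P_def bundle_chart_inv_def fst_tvec)
qed

lemma unit_bundle_iff: "m \<in> unit_bundle L \<longleftrightarrow> (\<exists>a g t. valid a g t \<and> m = P a g t)"
proof
  assume "m \<in> unit_bundle L"
  then obtain r where r: "r \<in> tangent_reps L" "m = tangent_rel L `` {r}"
    unfolding unit_bundle_def by (rule quotientE)
  then obtain a g t where "r = (a, pt a (moebius g \<i>) t, tvec g)" "valid a g t"
    by (elim tangent_reps_cases)
  then show "\<exists>a g t. valid a g t \<and> m = P a g t"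
    using r(2) by (auto simp: P_def bundle_chart_inv_def fst_tvec)
next
  assume "\<exists>a g t. valid a g t \<and> m = P a g t"
  then obtain a g t where *: "valid a g t" "m = P a g t" by blast
  then have "(a, pt a (moebius g \<i>) t, tvec g) \<in> tangent_reps L" using tangent_reps_iff by blast
  then show "m \<in> unit_bundle L"
    unfolding *(2) by (auto simp: P_def bundle_chart_inv_def fst_tvec unit_bundle_def intro!: quotientI)
qed

lemma P_in: "valid a g t \<Longrightarrow> P a g t \<in> unit_bundle L" using unit_bundle_iff by blast

lemma P_transport:
  assumes "valid a g t" "pt a (moebius g \<i>) t \<in> U b"
  shows "P a g t = P b (coc b a t * g) (hol b a t)"
  using P_eq_iff[OF assms(1) valid_transport[OF assms]] assms(2) by simp

definition base where "base m = (SOME x. \<exists>a g t. valid a g t \<and> m = P a g t \<and> x = pt a (moebius g \<i>) t)"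

lemma base_P: assumes "valid a g t" shows "base (P a g t) = pt a (moebius g \<i>) t"
  unfolding base_def
proof (rule some_equality)
  show "\<exists>b g' t'. valid b g' t' \<and> P a g t = P b g' t' \<and> pt a (moebius g \<i>) t = pt b (moebius g' \<i>) t'"
    using assms by blast
  fix x assume "\<exists>b g' t'. valid b g' t' \<and> P a g t = P b g' t' \<and> x = pt b (moebius g' \<i>) t'"
  then obtain b g' t' where *: "valid b g' t'" "P a g t = P b g' t'" "x = pt b (moebius g' \<i>) t'" by blast
  then show "x = pt a (moebius g \<i>) t" using P_eq_iff[OF assms *(1)] pt_transport[OF assms] by simp
qed

lemma base_in: "m \<in> unit_bundle L \<Longrightarrow> base m \<in> topspace X"
  using unit_bundle_iff base_P valid_pt U_sub by (metis subsetD)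

lemma in_chart:
  assumes "m \<in> unit_bundle L" "base m \<in> U a"
  obtains g t where "valid a g t" "m = P a g t"
proof -
  obtain b g t where *: "valid b g t" "m = P b g t" using assms unit_bundle_iff by blast
  then have "pt b (moebius g \<i>) t \<in> U a" using assms base_P by simp
  then show ?thesis using that P_transport[OF *(1)] valid_transport[OF *(1)] *(2) by metis
qed

lemma base_in_U: "valid a g t \<Longrightarrow> base (P a g t) \<in> U a" by (simp add: base_P valid_pt)

lemma P_inj: "valid a g t \<Longrightarrow> valid a g' t' \<Longrightarrow> P a g t = P a g' t' \<Longrightarrow> g = g' \<and> t = t'"
  using P_eq_iff[of a g t a g' t'] coc_self[of t a] by (auto simp: valid_def)

text \<open>A right multiplication that can be carried out in two charts has the same result in both: the
cocycle multiplies on the left.\<close>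

lemma local_unique:
  assumes "valid a g t" "valid a (g * c) t" "valid b g' t'" "valid b (g' * c) t'" "P a g t = P b g' t'"
  shows "P a (g * c) t = P b (g' * c) t'"
proof -
  have *: "pt a (moebius g \<i>) t \<in> U b" "t' = hol b a t" "g' = coc b a t * g"
    using P_eq_iff[OF assms(1,3)] assms(5) by auto
  have "moebius (coc b a t) (moebius (g * c) \<i>) = moebius (g' * c) \<i>"
    unfolding *(3) by (simp only: moebius_mult[OF ii_UH, symmetric] mult.assoc)
  then have "pt a (moebius (g * c) \<i>) t \<in> U b"
    using assms(1,2,4) *(1) overlap_propagates[of "moebius g \<i>" a t b "moebius (g * c) \<i>"]
    by (simp add: valid_def)
  then show ?thesis using P_eq_iff[OF assms(2,4)] *(2,3) by (simp add: mult.assoc)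
qed

end

section \<open>The global right action\<close>

lemma sep_small_nbhd:
  assumes "z \<in> UH" "d > 0"
  obtains W where "open W" "z \<in> W" "W \<subseteq> UH" "\<forall>v\<in>W. \<forall>w\<in>W. sep v w < d"
proof -
  have op: "open UH" unfolding upper_half_plane_def by (simp add: open_halfspace_Im_gt)
  have "continuous_on (UH \<times> UH) (\<lambda>p. sep (fst p) (snd p))"
    unfolding sep_def by (intro continuous_intros) (auto simp: UH_iff)
  then have "open ((UH \<times> UH) \<inter> (\<lambda>p. sep (fst p) (snd p)) -` {..<d})"
    by (rule continuous_open_preimage) (simp_all add: op open_Times)
  moreover have "(z, z) \<in> (UH \<times> UH) \<inter> (\<lambda>p. sep (fst p) (snd p)) -` {..<d}"
    using assms by (simp add: sep_def)
  ultimately obtain A B where AB: "open A" "open B" "(z, z) \<in> A \<times> B"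
    "A \<times> B \<subseteq> (UH \<times> UH) \<inter> (\<lambda>p. sep (fst p) (snd p)) -` {..<d}"
    by (rule open_prod_elim)
  show ?thesis
  proof (rule that[of "A \<inter> B"])
    show "\<forall>v\<in>A \<inter> B. \<forall>w\<in>A \<inter> B. sep v w < d"
    proof (intro ballI)
      fix v w assume "v \<in> A \<inter> B" "w \<in> A \<inter> B"
      then have "(v, w) \<in> A \<times> B" by simp
      then show "sep v w < d" using AB(4) by auto
    qed
    show "A \<inter> B \<subseteq> UH"
    proof
      fix v assume "v \<in> A \<inter> B"
      then have "(v, v) \<in> A \<times> B" by simp
      then show "v \<in> UH" using AB(4) by auto
    qed
  qed (use AB in auto)
qed

context hyp_lam
begin

definition flow_box where "flow_box a W S = {x \<in> U a. cz a x \<in> W \<and> ct a x \<in> S}"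

lemma open_box:
  assumes "open W" "openin (trans_space L a) S"
  shows "openin X (flow_box a W S)"
proof -
  let ?Y = "prod_topology (top_of_set (D a)) (trans_space L a)"
  have "openin ?Y ((D a \<inter> W) \<times> S)"
    using assms by (simp add: openin_prod_Times_iff openin_open_Int)
  then have "openin (subtopology X (U a)) {x \<in> topspace (subtopology X (U a)). chart L a x \<in> (D a \<inter> W) \<times> S}"
    by (rule openin_continuous_map_preimage[OF continuous_chart])
  moreover have "{x \<in> topspace (subtopology X (U a)). chart L a x \<in> (D a \<inter> W) \<times> S} = flow_box a W S"
    using U_sub[of a] cz_in[of _ a] by (auto simp: flow_box_def mem_Times_iff)
  ultimately show ?thesis using openin_trans_full[OF _ open_U] by metis
qed

text \<open>The last condition is the room around \<open>W\<close>; the bounds make the set of frames over \<open>W\<close> bounded.\<close>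

definition roomy where
  "roomy a d W \<longleftrightarrow> open W \<and> W \<subseteq> D a \<and> bounded W \<and> (\<exists>e>0. \<forall>z\<in>W. e \<le> Im z) \<and>
     (\<forall>z\<in>W. \<forall>w\<in>UH. sep z w < d \<longrightarrow> w \<in> D a)"

text \<open>A slightly smaller concentric disk works, because the imaginary part is bounded on it and so a
hyperbolically small displacement is small in the Euclidean sense.\<close>

lemma roomy_ex:
  assumes "z \<in> D a"
  obtains W d where "d > 0" "roomy a d W" "z \<in> W"
proof -
  obtain p s where D: "D a = ball p s" "s > 0" using disk_ball by blast
  define s1 where "s1 = (dist p z + s) / 2"
  have s1: "dist p z < s1" "s1 < s" using assms D by (auto simp: s1_def)
  define s2 where "s2 = (s1 + s) / 2"
  have s2: "s1 < s2" "s2 < s" using s1 by (auto simp: s2_def)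
  have s10: "s1 > 0" using s1(1) zero_le_dist[of p z] by linarith
  have "p - \<i> * of_real s2 \<in> D a" using s2 s10 by (simp add: D dist_norm norm_mult)
  then have ps: "Im p > s2" using D_UH[of a] by (auto simp: UH_iff)
  define K where "K = Im p + s1"
  have K: "K > 0" using ps s10 s2 by (simp add: K_def)
  define t where "t = min 1 ((s - s1) / (2 * K))"
  have t: "t > 0" "t \<le> 1" "2 * t * K \<le> s - s1"
  proof -
    show "t > 0" "t \<le> 1" using s1 K by (auto simp: t_def)
    have "t \<le> (s - s1) / (2 * K)" by (simp add: t_def)
    then show "2 * t * K \<le> s - s1" using K by (simp add: field_simps)
  qed
  have "w \<in> D a" if "z \<in> ball p s1" "w \<in> UH" "sep z w < t\<^sup>2" for z w
  proof -
    have zU: "z \<in> UH" using that(1) s1 D_UH[of a] unfolding D by auto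
    have Imz: "Im z \<le> K" "Im z > 0"
      using abs_Im_le_cmod[of "z - p"] that(1) zU by (auto simp: K_def dist_norm norm_minus_commute UH_iff)
    have "norm (z - w) \<le> (t\<^sup>2 + t) * Im z"
      using zU that t by (intro sep_small_imp_near) auto
    also have "\<dots> \<le> (t + t) * Im z"
      using t Imz by (intro mult_right_mono add_right_mono) (auto simp: power2_eq_square mult_left_le)
    also have "\<dots> \<le> (t + t) * K" using t Imz by (intro mult_left_mono) auto
    also have "\<dots> \<le> s - s1" using t(3) by (simp add: algebra_simps)
    finally have "dist z w \<le> s - s1" by (simp add: dist_norm)
    then show ?thesis using that(1) dist_triangle[of p w z] unfolding D mem_ball by linarith
  qed
  moreover have "s2 - s1 \<le> Im v" if "v \<in> ball p s1" for v
    using abs_Im_le_cmod[of "p - v"] that ps by (auto simp: dist_norm)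
  ultimately have "roomy a (t\<^sup>2) (ball p s1)"
    unfolding roomy_def using s1 s2 by (intro conjI exI[of _ "s2 - s1"]) (auto simp: D)
  then show ?thesis using that[of "t\<^sup>2" "ball p s1"] t s1 by simp
qed

text \<open>Compactness of \<open>M\<close>, with \<open>Fin\<close> standing for any property that small open sets of transverse
parameters have. The number \<open>d\<close> plays the role of a Lebesgue number.\<close>

lemma finite_box_cover:
  assumes Fin: "\<And>a t. t \<in> TT a \<Longrightarrow> \<exists>S. openin (trans_space L a) S \<and> t \<in> S \<and> Fin a S"
  obtains F d where "finite F" "d > 0"
    "\<And>a W S. (a, W, S) \<in> F \<Longrightarrow> roomy a d W \<and> openin (trans_space L a) S \<and> Fin a S"
    "\<And>x. x \<in> topspace X \<Longrightarrow> \<exists>(a, W, S)\<in>F. x \<in> flow_box a W S"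
proof -
  define K where "K = {(a, W, S). (\<exists>d>0. roomy a d W) \<and> openin (trans_space L a) S \<and> Fin a S}"
  have opn: "openin X B" if "B \<in> (\<lambda>(a, W, S). flow_box a W S) ` K" for B
    using that by (auto simp: K_def roomy_def intro!: open_box)
  have cov: "topspace X \<subseteq> \<Union>((\<lambda>(a, W, S). flow_box a W S) ` K)"
  proof
    fix x assume "x \<in> topspace X"
    then obtain a where a: "x \<in> U a" using cover_U by blast
    obtain W d where W: "d > 0" "roomy a d W" "cz a x \<in> W" using roomy_ex[OF cz_in[OF a]] by blast
    obtain S where S: "openin (trans_space L a) S" "ct a x \<in> S" "Fin a S" using Fin[OF ct_in[OF a]] by blast
    have "(a, W, S) \<in> K" using W S by (auto simp: K_def)
    moreover have "x \<in> flow_box a W S" using a W S by (simp add: flow_box_def)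
    ultimately show "x \<in> \<Union>((\<lambda>(a, W, S). flow_box a W S) ` K)" by force
  qed
  obtain \<F> where \<F>: "finite \<F>" "\<F> \<subseteq> (\<lambda>(a, W, S). flow_box a W S) ` K" "topspace X \<subseteq> \<Union>\<F>"
    using compact_X opn cov unfolding compact_space_alt by metis
  obtain F where F: "F \<subseteq> K" "finite F" "\<F> = (\<lambda>(a, W, S). flow_box a W S) ` F"
    using finite_subset_image[OF \<F>(1,2)] by blast
  have "\<forall>k\<in>F. \<exists>d>0. roomy (fst k) d (fst (snd k))"
    using F(1) by (auto simp: K_def)
  then obtain dd where dd: "\<And>k. k \<in> F \<Longrightarrow> dd k > 0 \<and> roomy (fst k) (dd k) (fst (snd k))" by metis
  define d where "d = Min (insert 1 (dd ` F))"
  have d: "d > 0" using F(2) dd by (simp add: d_def)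
  have dle: "d \<le> dd k" if "k \<in> F" for k using F(2) that by (simp add: d_def)
  show ?thesis
  proof (rule that[OF F(2) d])
    fix a W S assume k: "(a, W, S) \<in> F"
    have "roomy a d W"
      using dd[OF k] dle[OF k] unfolding roomy_def fst_conv snd_conv by (meson less_le_trans)
    then show "roomy a d W \<and> openin (trans_space L a) S \<and> Fin a S"
      using k F(1) by (auto simp: K_def)
  next
    fix x assume "x \<in> topspace X"
    then show "\<exists>(a, W, S)\<in>F. x \<in> flow_box a W S" using \<F>(3) unfolding F(3) by force
  qed
qed

lemma uniform_room:
  obtains d where "d > 0"
    "\<And>m. m \<in> unit_bundle L \<Longrightarrow> \<exists>a g t. valid a g t \<and> m = P a g t \<and> (\<forall>c. size_of c < d \<longrightarrow> valid a (g * c) t)"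
proof -
  show ?thesis
  proof (rule finite_box_cover[of "\<lambda>_ _. True"])
    show "\<exists>S. openin (trans_space L a) S \<and> t \<in> S \<and> True" if "t \<in> TT a" for a t
      using that by blast
    fix F d
    assume F: "d > 0"
      "\<And>a W S. (a, W, S) \<in> F \<Longrightarrow> roomy a d W \<and> openin (trans_space L a) S \<and> True"
      "\<And>x. x \<in> topspace X \<Longrightarrow> \<exists>(a, W, S)\<in>F. x \<in> flow_box a W S"
    have "\<exists>a g t. valid a g t \<and> m = P a g t \<and> (\<forall>c. size_of c < d \<longrightarrow> valid a (g * c) t)"
      if m: "m \<in> unit_bundle L" for m
    proof -
    obtain a W S where k: "(a, W, S) \<in> F" "base m \<in> flow_box a W S" using F(3)[OF base_in[OF m]] by auto
    then have bU: "base m \<in> U a" "cz a (base m) \<in> W" by (auto simp: flow_box_def)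
    obtain g t where gt: "valid a g t" "m = P a g t" using in_chart[OF m bU(1)] by blast
    have W: "moebius g \<i> \<in> W" using bU(2) gt by (simp add: base_P chart_valid)
    have r: "roomy a d W" using F(2)[OF k(1)] by blast
    have "valid a (g * c) t" if "size_of c < d" for c
    proof -
      have "moebius (g * c) \<i> \<in> UH" by (simp add: moebius_UH ii_UH)
      then have "moebius (g * c) \<i> \<in> D a" using r W that unfolding roomy_def by (metis sep_moebius_i)
      then show ?thesis using gt(1) by (simp add: valid_def)
    qed
    then show "\<exists>a g t. valid a g t \<and> m = P a g t \<and> (\<forall>c. size_of c < d \<longrightarrow> valid a (g * c) t)"
      using gt by blast
    qed
    then show thesis by (rule that[OF F(1)])
  qed
qed

text \<open>A single right multiplication inside some chart. Where none is possible, \<open>local_act\<close> takes the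
default value \<open>m\<close>, so that its laws hold on the whole type.\<close>

definition steps where
  "steps c m n \<longleftrightarrow> (\<exists>a g t. valid a g t \<and> valid a (g * c) t \<and> m = P a g t \<and> n = P a (g * c) t)"

definition local_act where
  "local_act c m = (if \<exists>n. steps c m n then SOME n. steps c m n else m)"

lemma local_act_P:
  assumes "valid a g t" "valid a (g * c) t"
  shows "local_act c (P a g t) = P a (g * c) t"
proof -
  have s: "steps c (P a g t) (P a (g * c) t)" using assms unfolding steps_def by blast
  have "n = P a (g * c) t" if "steps c (P a g t) n" for n
    using that local_unique assms unfolding steps_def by metis
  then show ?thesis using s unfolding local_act_def by (metis someI)
qed

lemma local_act_outside: "m \<notin> unit_bundle L \<Longrightarrow> local_act c m = m"
  using P_in by (auto simp: local_act_def steps_def)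

lemma act_ex: "\<exists>act d. d > 0 \<and> (\<forall>m. act m 1 = m) \<and> (\<forall>m g h. act (act m g) h = act m (g * h)) \<and>
   (\<forall>m c. size_of c < d \<longrightarrow> act m c = local_act c m)"
proof -
  obtain d where d: "d > 0"
    "\<And>m. m \<in> unit_bundle L \<Longrightarrow> \<exists>a g t. valid a g t \<and> m = P a g t \<and> (\<forall>c. size_of c < d \<longrightarrow> valid a (g * c) t)"
    using uniform_room by blast
  have 1: "local_act 1 m = m" for m
  proof (cases "m \<in> unit_bundle L")
    case True
    then obtain a g t where "valid a g t" "m = P a g t" using unit_bundle_iff by blast
    then show ?thesis using local_act_P[of a g t 1] by simp
  qed (simp add: local_act_outside)
  have 2: "local_act b (local_act a m) = local_act (a * b) m"
    if ab: "size_of a < d" "size_of b < d" "size_of (a * b) < d" for a b m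
  proof (cases "m \<in> unit_bundle L")
    case True
    then obtain i g t where *: "valid i g t" "m = P i g t" "\<And>c. size_of c < d \<Longrightarrow> valid i (g * c) t"
      using d(2) by blast
    have "valid i (g * a * b) t" using *(3)[OF ab(3)] by (simp add: mult.assoc)
    then have "local_act b (P i (g * a) t) = P i (g * a * b) t"
      using local_act_P[OF *(3)[OF ab(1)]] by blast
    then show ?thesis
      using local_act_P[OF *(1) *(3)[OF ab(1)]] local_act_P[OF *(1) *(3)[OF ab(3)]]
      by (simp add: *(2) mult.assoc)
  qed (simp add: local_act_outside)
  show ?thesis
  proof (rule local_action_extension[of d local_act, OF d(1) 1 2])
    fix act d' assume "d' > 0" "d' \<le> d" "\<And>m. act m 1 = m" "\<And>m g h. act (act m g) h = act m (g * h)"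
      "\<And>m c. size_of c < d' \<Longrightarrow> act m c = local_act c m"
    then show ?thesis by (intro exI[of _ act] exI[of _ d'] conjI allI impI)
  qed
qed

text \<open>Some extension of the local action to the group. The lemmas \<open>act_P\<close> and \<open>right_mult_iff\<close> show that
there is no choice.\<close>

definition act where
  "act = (SOME act. \<exists>d>0. (\<forall>m. act m 1 = m) \<and> (\<forall>m g h. act (act m g) h = act m (g * h)) \<and>
   (\<forall>m c. size_of c < d \<longrightarrow> act m c = local_act c m))"

lemma act_spec: "\<exists>d>0. (\<forall>m. act m 1 = m) \<and> (\<forall>m g h. act (act m g) h = act m (g * h)) \<and>
   (\<forall>m c. size_of c < d \<longrightarrow> act m c = local_act c m)"
  unfolding act_def by (rule someI_ex[OF act_ex])

lemma act_1: "act m 1 = m" and act_act: "act (act m g) h = act m (g * h)"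
  using act_spec by blast+

lemma act_small:
  obtains d where "d > 0" "\<And>m c. size_of c < d \<Longrightarrow> act m c = local_act c m"
  using act_spec by blast

lemma act_room:
  obtains d where "d > 0" "\<And>m. m \<in> unit_bundle L \<Longrightarrow> \<exists>a g t. valid a g t \<and> m = P a g t \<and>
     (\<forall>c. size_of c < d \<longrightarrow> valid a (g * c) t \<and> act m c = P a (g * c) t)"
proof -
  obtain d1 where d1: "d1 > 0"
    "\<And>m. m \<in> unit_bundle L \<Longrightarrow> \<exists>a g t. valid a g t \<and> m = P a g t \<and> (\<forall>c. size_of c < d1 \<longrightarrow> valid a (g * c) t)"
    using uniform_room by blast
  obtain d2 where d2: "d2 > 0" "\<And>m c. size_of c < d2 \<Longrightarrow> act m c = local_act c m" using act_small by blast
  show ?thesis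
  proof (rule that[of "min d1 d2"])
    fix m assume "m \<in> unit_bundle L"
    then obtain a g t where "valid a g t" "m = P a g t" "\<And>c. size_of c < d1 \<Longrightarrow> valid a (g * c) t"
      using d1(2) by blast
    then show "\<exists>a g t. valid a g t \<and> m = P a g t \<and>
     (\<forall>c. size_of c < min d1 d2 \<longrightarrow> valid a (g * c) t \<and> act m c = P a (g * c) t)"
      using d2(2) local_act_P by (intro exI[of _ a] exI[of _ g] exI[of _ t]) auto
  qed (use d1 d2 in auto)
qed

lemma act_in: assumes "m \<in> unit_bundle L" shows "act m g \<in> unit_bundle L"
proof -
  obtain d where d: "d > 0" "\<And>m. m \<in> unit_bundle L \<Longrightarrow> \<exists>a g t. valid a g t \<and> m = P a g t \<and>
     (\<forall>c. size_of c < d \<longrightarrow> valid a (g * c) t \<and> act m c = P a (g * c) t)" using act_room by blast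
  have "\<forall>m\<in>unit_bundle L. act m g \<in> unit_bundle L"
  proof (rule psl2_generated[OF d(1), where Q = "\<lambda>g. \<forall>m\<in>unit_bundle L. act m g \<in> unit_bundle L"], rule ballI)
    fix c m assume c: "size_of c < d" and m: "m \<in> unit_bundle L"
    obtain a g t where "valid a (g * c) t" "act m c = P a (g * c) t" using d(2)[OF m] c by blast
    then show "act m c \<in> unit_bundle L" by (simp add: P_in)
  next
    fix g h
    assume "\<forall>m\<in>unit_bundle L. act m g \<in> unit_bundle L" "\<forall>m\<in>unit_bundle L. act m h \<in> unit_bundle L"
    then show "\<forall>m\<in>unit_bundle L. act m (g * h) \<in> unit_bundle L" by (simp add: act_act[symmetric])
  qed
  then show ?thesis using assms by blast
qed

text \<open>Steps of arbitrary size inside a chart are composed of small ones: the base points of the disk at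
which the action agrees with multiplication in the chart form an open and closed set.\<close>

lemma act_P:
  assumes v: "valid a g t" "valid a (g * c) t"
  shows "act (P a g t) c = P a (g * c) t"
proof -
  obtain d where d: "d > 0" "\<And>m c. size_of c < d \<Longrightarrow> act m c = local_act c m" using act_small by blast
  have t: "t \<in> TT a" using v by (simp add: valid_def)
  let ?Q = "\<lambda>z. \<forall>c. moebius (g * c) \<i> = z \<longrightarrow> act (P a g t) c = P a (g * c) t"
  have "?Q (moebius (g * c) \<i>)"
  proof (rule connected_induction_simple[of "D a" "moebius g \<i>" "moebius (g * c) \<i>" ?Q])
    show "connected (D a)" by (simp add: convex_connected D_convex)
    show "moebius g \<i> \<in> D a" "moebius (g * c) \<i> \<in> D a" using v by (auto simp: valid_def)
    show "?Q (moebius g \<i>)"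
    proof (intro allI impI)
      fix c assume c: "moebius (g * c) \<i> = moebius g \<i>"
      then have "size_of c = 0" using sep_moebius_i[of g c] by (simp add: sep_def)
      then show "act (P a g t) c = P a (g * c) t"
        using d v(1) c by (simp add: local_act_P valid_def)
    qed
    fix z assume z: "z \<in> D a"
    have zU: "z \<in> UH" using z D_UH[of a] by blast
    obtain W where W: "open W" "z \<in> W" "W \<subseteq> UH" "\<forall>v\<in>W. \<forall>w\<in>W. sep v w < d"
      by (rule sep_small_nbhd[OF zU d(1)])
    have "?Q w" if "v \<in> W \<inter> D a" "w \<in> W \<inter> D a" "?Q v" for v w
    proof (intro allI impI)
      fix k assume k: "moebius (g * k) \<i> = w"
      have "v \<in> UH" using that(1) W(3) by blast
      then obtain f where f: "moebius f \<i> = v" by (rule moebius_transitive)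
      obtain h where h: "g * h = f" by (rule psl2_solve)
      obtain e where e: "h * e = k" by (rule psl2_solve)
      have ge: "g * h * e = g * k" by (simp add: mult.assoc e)
      have "size_of e = sep v w" using sep_moebius_i[of "g * h" e] unfolding ge k unfolding h f by (rule sym)
      then have se: "size_of e < d" using W that by auto
      have val: "valid a (g * h) t" "valid a (g * h * e) t"
        using that(1,2) t unfolding valid_def ge k unfolding h f by auto
      have "act (P a g t) k = act (act (P a g t) h) e" by (simp add: act_act e)
      also have "act (P a g t) h = P a (g * h) t" using that(3) h f by blast
      also have "act (P a (g * h) t) e = P a (g * h * e) t" using d(2)[OF se] local_act_P[OF val] by simp
      finally show "act (P a g t) k = P a (g * k) t" by (simp only: ge)
    qed
    then show "\<exists>T. openin (top_of_set (D a)) T \<and> z \<in> T \<and> (\<forall>x\<in>T. \<forall>y\<in>T. ?Q x \<longrightarrow> ?Q y)"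
      using W z by (intro exI[of _ "D a \<inter> W"] conjI) (auto simp: openin_open_Int)
  qed
  then show ?thesis by blast
qed

text \<open>In one direction a chain of chart steps follows the action by \<open>act_P\<close>; in the other, small group
elements act by single steps and generate the group.\<close>

lemma right_mult_iff: "right_mult L v b w \<longleftrightarrow> v \<in> unit_bundle L \<and> w = act v b"
proof
  assume "right_mult L v b w"
  then show "v \<in> unit_bundle L \<and> w = act v b"
  proof induction
    case unit then show ?case by (simp add: act_1)
  next
    case (step b a u t c)
    obtain g where g: "u = tvec g" "moebius g \<i> \<in> D a" using unit_tangent_tvec[OF step.hyps(2)] by blast
    have val: "valid a g t" "valid a (g * c) t"
      using g step.hyps(3,4) by (auto simp: valid_def right_translate_tvec tvec_in_unit_tangent)
    have "act v b = P a g t" using step.IH g by (simp add: P_def)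
    then have "act v (b * c) = P a (g * c) t" using act_P[OF val] by (metis act_act)
    then show ?case using step.IH by (simp add: g P_def right_translate_tvec)
  qed
next
  assume vw: "v \<in> unit_bundle L \<and> w = act v b"
  obtain d where d: "d > 0" "\<And>m. m \<in> unit_bundle L \<Longrightarrow> \<exists>a g t. valid a g t \<and> m = P a g t \<and>
     (\<forall>c. size_of c < d \<longrightarrow> valid a (g * c) t \<and> act m c = P a (g * c) t)" using act_room by blast
  let ?Q = "\<lambda>h. \<forall>g w. right_mult L v g w \<longrightarrow> right_mult L v (g * h) (act w h)"
  have inb: "w \<in> unit_bundle L" if "right_mult L v g w" for g w
    using that
  proof induction
    case (step b a u t c)
    obtain g where g: "right_translate u c = tvec g" "moebius g \<i> \<in> D a" using unit_tangent_tvec[OF step.hyps(4)] by blast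
    then show ?case using P_in[of a g t] step.hyps(3) by (simp add: P_def valid_def)
  qed
  have "?Q b"
  proof (rule psl2_generated[OF d(1), where Q = ?Q])
    fix c assume c: "size_of c < d"
    show "?Q c"
    proof (intro allI impI)
      fix g w assume r: "right_mult L v g w"
      obtain a f t where *: "valid a f t" "w = P a f t" "valid a (f * c) t" "act w c = P a (f * c) t"
        using d(2)[OF inb[OF r]] c by blast
      have "right_mult L v (g * c) (bundle_chart_inv L a (right_translate (tvec f) c, t))"
        using r * by (intro right_mult.step) (auto simp: valid_def P_def right_translate_tvec tvec_in_unit_tangent)
      then show "right_mult L v (g * c) (act w c)" using * by (simp add: P_def right_translate_tvec)
    qed
  next
    fix g h assume "?Q g" "?Q h"
    then show "?Q (g * h)" by (simp add: act_act[symmetric] mult.assoc[symmetric])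
  qed
  then show "right_mult L v b w" using vw right_mult.unit[of v L] by (metis mult_1_left)
qed

lemma right_action_eq: "v \<in> unit_bundle L \<Longrightarrow> right_action L v b = act v b"
  by (simp add: right_action_def right_mult_iff)

end

section \<open>The topology of the unit tangent bundle\<close>

text \<open>For \<open>p\<^sup>2 + q\<^sup>2 = 1\<close>, a rotation about \<open>\<i>\<close>; it turns vectors by twice the angle of \<open>(p, - q)\<close>.\<close>

definition rot :: "real \<Rightarrow> real \<Rightarrow> psl2" where "rot p q = mk p (- q) q p"

lemma tvec_rot:
  assumes "p\<^sup>2 + q\<^sup>2 = 1"
  shows "tvec (rot p q) = (\<i>, \<i> / (of_real p + \<i> * of_real q)\<^sup>2)"
proof -
  have d: "p * p - (- q) * q = 1" using assms by (simp add: power2_eq_square)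
  have "of_real q * \<i> + (of_real p::complex) \<noteq> 0" using denom_nz[OF d, of \<i>] by simp
  moreover have "of_real p * \<i> + of_real (- q) = (\<i>::complex) * (of_real q * \<i> + of_real p)"
    by (simp add: algebra_simps)
  ultimately have "(of_real p * \<i> + of_real (- q)) / (of_real q * \<i> + of_real p) = (\<i>::complex)"
    by (simp add: divide_eq_eq)
  then show ?thesis unfolding rot_def tvec_mk[OF d] by (simp add: add.commute mult.commute)
qed

lemma rot_fixes: "p\<^sup>2 + q\<^sup>2 = 1 \<Longrightarrow> moebius (rot p q) \<i> = \<i>"
  using tvec_rot fst_tvec by (metis fst_conv)

lemma tvec_mult_rot:
  assumes "p\<^sup>2 + q\<^sup>2 = 1"
  shows "tvec (g * rot p q) = (fst (tvec g), snd (tvec g) / (of_real p + \<i> * of_real q)\<^sup>2)"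
proof -
  have 1: "x * \<i> / \<i> = x" for x by (rule nonzero_mult_div_cancel_right) simp
  have 2: "rtden u \<i> = 2" for u unfolding rtden_def 1 by simp
  show ?thesis unfolding tvec_mult_rtf tvec_rot[OF assms] rtf_def Let_def fst_conv snd_conv 1 2
    by simp
qed

context hyp_lam
begin

abbreviation "Mhat \<equiv> unit_bundle L"
abbreviation "Mhat_top \<equiv> bundle_topology L"
abbreviation "coord_top \<equiv> bundle_chart_space L"
abbreviation "psi \<equiv> bundle_chart_inv L"

lemma topspace_coord_top: "topspace (coord_top a) = unit_tangent (D a) \<times> TT a"
  by (simp add: bundle_chart_space_def)

lemma coord_top_cases:
  assumes "p \<in> topspace (coord_top a)"
  obtains g t where "valid a g t" "p = (tvec g, t)" "psi a p = P a g t"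
proof -
  have u: "fst p \<in> unit_tangent (D a)" "snd p \<in> TT a" using assms by (auto simp: topspace_coord_top)
  obtain g where "fst p = tvec g" "moebius g \<i> \<in> D a" using u(1) by (rule unit_tangent_tvec)
  then show ?thesis using that[of g "snd p"] u(2) by (cases p) (auto simp: valid_def P_def)
qed

lemma tvec_in_coord_top: "(tvec g, t) \<in> topspace (coord_top a) \<longleftrightarrow> valid a g t"
  by (simp add: topspace_coord_top valid_def tvec_in_unit_tangent)

lemma psi_tvec: "psi a (tvec g, t) = P a g t" by (simp add: P_def)

lemma psi_in: "p \<in> topspace (coord_top a) \<Longrightarrow> psi a p \<in> Mhat"
  by (metis coord_top_cases P_in)

lemma openin_Mhat_top: "openin Mhat_top V \<longleftrightarrow> V \<subseteq> Mhat \<and> (\<forall>a. openin (coord_top a) {p \<in> topspace (coord_top a). psi a p \<in> V})"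
  by (rule openin_bundle_topology)

lemma topspace_Mhat_top: "topspace Mhat_top = Mhat"
proof -
  have "{p \<in> topspace (coord_top a). psi a p \<in> Mhat} = topspace (coord_top a)" for a using psi_in by blast
  then have "openin Mhat_top Mhat" by (simp add: openin_Mhat_top)
  then show ?thesis using openin_Mhat_top openin_subset by (metis openin_topspace subset_antisym)
qed

lemma continuous_psi: "continuous_map (coord_top a) Mhat_top (psi a)"
  using openin_Mhat_top psi_in by (auto simp: continuous_map_def topspace_Mhat_top)

lemma closedin_Mhat_top:
  "closedin Mhat_top C \<longleftrightarrow> C \<subseteq> Mhat \<and> (\<forall>a. closedin (coord_top a) {p \<in> topspace (coord_top a). psi a p \<in> C})"
proof -
  have "{p \<in> topspace (coord_top a). psi a p \<in> Mhat - C} = topspace (coord_top a) - {p \<in> topspace (coord_top a). psi a p \<in> C}" for a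
    using psi_in by blast
  then show ?thesis unfolding closedin_def topspace_Mhat_top openin_Mhat_top by auto
qed

lemma continuous_coord_top_pt:
  "continuous_map (coord_top a) (prod_topology (top_of_set (D a)) (trans_space L a)) (\<lambda>p. (fst (fst p), snd p))"
proof (rule continuous_map_pairedI)
  have "continuous_map (top_of_set (unit_tangent (D a))) (top_of_set (D a)) fst"
    by (auto simp: unit_tangent_def intro!: continuous_intros)
  from continuous_map_compose[OF continuous_map_fst this]
  show "continuous_map (coord_top a) (top_of_set (D a)) (\<lambda>p. fst (fst p))"
    by (simp add: bundle_chart_space_def o_def)
  show "continuous_map (coord_top a) (trans_space L a) snd"
    by (simp add: bundle_chart_space_def continuous_map_snd)
qed

lemma continuous_base_chart: "continuous_map (coord_top a) X (\<lambda>p. pt a (fst (fst p)) (snd p))"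
  using continuous_map_compose[OF continuous_coord_top_pt continuous_pt] by (simp add: o_def)

lemma continuous_point_chart:
  assumes "z \<in> D a" shows "continuous_map (coord_top a) X (\<lambda>p. pt a z (snd p))"
proof -
  have "continuous_map (coord_top a) (trans_space L a) snd"
    by (simp add: bundle_chart_space_def continuous_map_snd)
  from continuous_map_compose[OF this continuous_pt2[OF assms]] show ?thesis by (simp add: o_def)
qed

lemma continuous_chart_of:
  assumes "continuous_map Z X f" "f ` topspace Z \<subseteq> U b"
  shows "continuous_map Z euclidean (\<lambda>p. cz b (f p))" "continuous_map Z (trans_space L b) (\<lambda>p. ct b (f p))"
proof -
  have "continuous_map Z (subtopology X (U b)) f"
    using assms by (auto simp: continuous_map_in_subtopology)
  from continuous_map_compose[OF this continuous_chart]
  have c: "continuous_map Z (prod_topology (top_of_set (D b)) (trans_space L b)) (\<lambda>p. chart L b (f p))"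
    by (simp add: o_def)
  show "continuous_map Z euclidean (\<lambda>p. cz b (f p))"
    using continuous_map_compose[OF c continuous_map_fst] continuous_map_in_subtopology by (auto simp: o_def)
  show "continuous_map Z (trans_space L b) (\<lambda>p. ct b (f p))"
    using continuous_map_compose[OF c continuous_map_snd] by (simp add: o_def)
qed

definition overlap_vectors where "overlap_vectors a b = {p \<in> topspace (coord_top a). pt a (fst (fst p)) (snd p) \<in> U b}"
definition change_chart where "change_chart a b p = (push (coc b a (snd p)) (fst p), hol b a (snd p))"

lemma overlap_vectors_cases:
  assumes "p \<in> overlap_vectors a b"
  obtains g t where "valid a g t" "p = (tvec g, t)" "psi a p = P a g t" "pt a (moebius g \<i>) t \<in> U b"
    "change_chart a b p = (tvec (coc b a t * g), hol b a t)" "valid b (coc b a t * g) (hol b a t)" "psi a p = psi b (change_chart a b p)"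
proof -
  have "p \<in> topspace (coord_top a)" using assms by (simp add: overlap_vectors_def)
  then obtain g t where g: "valid a g t" "p = (tvec g, t)" "psi a p = P a g t" by (rule coord_top_cases)
  moreover have 1: "pt a (moebius g \<i>) t \<in> U b" using assms g by (simp add: overlap_vectors_def fst_tvec)
  moreover have 2: "change_chart a b p = (tvec (coc b a t * g), hol b a t)" by (simp add: change_chart_def g tvec_mult)
  moreover have "psi a p = psi b (change_chart a b p)" unfolding 2 psi_tvec g(3) by (rule P_transport[OF g(1) 1])
  ultimately show ?thesis using that valid_transport[OF g(1) 1] by blast
qed

lemma change_chart_in: "p \<in> overlap_vectors a b \<Longrightarrow> change_chart a b p \<in> topspace (coord_top b)"
  by (elim overlap_vectors_cases) (simp add: tvec_in_coord_top)

text \<open>Near a given vector two more points \<open>p\<close> and \<open>q\<close> of the plaque are held fixed. The images of the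
three points under the cocycle are read off from the charts of \<open>M\<close> and so vary continuously with
the transverse parameter, and the image of the vector is a rational function of them.\<close>

lemma openin_transition_preimage:
  assumes Q: "openin (coord_top b) Q"
  shows "openin (coord_top a) {p \<in> overlap_vectors a b. change_chart a b p \<in> Q}"
proof (subst openin_subopen, intro ballI)
  fix p0 assume p0: "p0 \<in> {p \<in> overlap_vectors a b. change_chart a b p \<in> Q}"
  define z0 where "z0 = fst (fst p0)"
  define t0 where "t0 = snd p0"
  have t0: "t0 \<in> TT a" and z0: "z0 \<in> D a" "pt a z0 t0 \<in> U b"
    using p0 by (auto simp: t0_def z0_def overlap_vectors_def topspace_coord_top unit_tangent_def)
  obtain p q where pq: "p \<in> D a" "pt a p t0 \<in> U b" "q \<in> D a" "pt a q t0 \<in> U b" "z0 \<noteq> p" "z0 \<noteq> q" "p \<noteq> q"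
    using two_more_points[OF open_slice[OF open_U t0], of z0 b] z0 by blast
  define N where "N = {x \<in> topspace (coord_top a). pt a (fst (fst x)) (snd x) \<in> U b} \<inter>
    {x \<in> topspace (coord_top a). pt a p (snd x) \<in> U b} \<inter> {x \<in> topspace (coord_top a). pt a q (snd x) \<in> U b} \<inter>
    {x \<in> topspace (coord_top a). (fst (fst x), snd x) \<in> (D a \<inter> - {p, q}) \<times> TT a}"
  have N: "openin (coord_top a) N"
    unfolding N_def
    by (intro openin_Int openin_continuous_map_preimage[OF continuous_base_chart open_U]
       openin_continuous_map_preimage[OF continuous_point_chart open_U]
       openin_continuous_map_preimage[OF continuous_coord_top_pt] pq)
      (simp add: openin_prod_Times_iff openin_open_Int open_Compl)
  have p0N: "p0 \<in> N"
    using p0 pq z0 t0 by (auto simp: N_def overlap_vectors_def z0_def t0_def)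
  have Ntw: "N \<subseteq> overlap_vectors a b" by (auto simp: N_def overlap_vectors_def)
  let ?Z = "subtopology (coord_top a) N"
  have tZ: "topspace ?Z = N" using N openin_subset by fastforce
  define S where "S = {x :: (complex \<times> complex) \<times> complex \<times> complex \<times> complex.
     fst (fst x) \<noteq> p \<and> fst (fst x) \<noteq> q \<and> fst (snd (snd x)) \<noteq> snd (snd (snd x))}"
  define E where "E x = (fst x, cz b (pt a (fst (fst x)) (snd x)), cz b (pt a p (snd x)), cz b (pt a q (snd x)))"
    for x :: "(complex \<times> complex) \<times> 't"
  define H where "H x = (fst (snd x), snd (fst x) * ((fst (snd x) - fst (snd (snd x))) * (fst (snd x) - snd (snd (snd x))) * (p - q)
    / ((fst (fst x) - p) * (fst (fst x) - q) * (fst (snd (snd x)) - snd (snd (snd x))))))"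
    for x :: "(complex \<times> complex) \<times> complex \<times> complex \<times> complex"
  have HE: "fst (change_chart a b x) = H (E x)" and ES: "E x \<in> S" if x: "x \<in> N" for x
  proof -
    have x': "x \<in> overlap_vectors a b" using x Ntw by blast
    have t: "snd x \<in> TT a" and z: "fst (fst x) \<in> D a" and zpq: "fst (fst x) \<noteq> p" "fst (fst x) \<noteq> q"
      and UU: "pt a (fst (fst x)) (snd x) \<in> U b" "pt a p (snd x) \<in> U b" "pt a q (snd x) \<in> U b"
      using x by (auto simp: N_def topspace_coord_top unit_tangent_def)
    have c: "cz b (pt a y (snd x)) = moebius (coc b a (snd x)) y" if "y \<in> D a" "pt a y (snd x) \<in> U b" for y
      using chart_overlap[OF pt_in[OF that(1) t] that(2)] chart_pt[OF that(1) t] by simp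
    have UHs: "fst (fst x) \<in> UH" "p \<in> UH" "q \<in> UH" using z pq D_UH[of a] by auto
    note three1 = push_three_points(1)[OF UHs zpq pq(7), of "coc b a (snd x)" "snd (fst x)"]
    note three2 = push_three_points(2)[OF UHs zpq pq(7), of "coc b a (snd x)"]
    show "fst (change_chart a b x) = H (E x)"
      unfolding change_chart_def H_def E_def fst_conv snd_conv c[OF z UU(1)] c[OF pq(1) UU(2)] c[OF pq(3) UU(3)]
      using three1 by simp
    show "E x \<in> S"
      unfolding S_def E_def using zpq three2 c[OF pq(1) UU(2)] c[OF pq(3) UU(3)] by simp
  qed
  have cH: "continuous_on S H"
    unfolding H_def S_def by (intro continuous_intros) auto
  have sub: "continuous_map ?Z X f" if "continuous_map (coord_top a) X f" for f
    using that by (rule continuous_map_from_subtopology)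
  have "continuous_map ?Z euclidean E"
    unfolding E_def
  proof (intro continuous_map_pairedI[of ?Z euclidean _ euclidean, unfolded prod_topology_euclidean]
      continuous_chart_of sub continuous_base_chart continuous_point_chart pq)
    have "continuous_map (coord_top a) (top_of_set (unit_tangent (D a))) fst"
      by (simp add: bundle_chart_space_def continuous_map_fst)
    then have "continuous_map (coord_top a) euclidean fst" by (simp add: continuous_map_in_subtopology)
    then show "continuous_map ?Z euclidean fst" by (rule continuous_map_from_subtopology)
  qed (auto simp: tZ N_def)
  then have "continuous_map ?Z (top_of_set S) E"
    using ES tZ by (auto simp: continuous_map_in_subtopology)
  moreover have "continuous_map (top_of_set S) euclidean H" using cH by simp
  ultimately have "continuous_map ?Z euclidean (H \<circ> E)" by (rule continuous_map_compose)
  then have "continuous_map ?Z euclidean (\<lambda>x. fst (change_chart a b x))"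
    by (rule continuous_map_eq) (use HE tZ in auto)
  then have "continuous_map ?Z (top_of_set (unit_tangent (D b))) (\<lambda>x. fst (change_chart a b x))"
    using change_chart_in Ntw tZ by (fastforce simp: continuous_map_in_subtopology topspace_coord_top)
  moreover have "continuous_map ?Z (trans_space L b) (\<lambda>x. snd (change_chart a b x))"
  proof (rule continuous_map_eq[OF continuous_chart_of(2)[OF sub[OF continuous_base_chart]]])
    show "(\<lambda>p. pt a (fst (fst p)) (snd p)) ` topspace ?Z \<subseteq> U b" by (auto simp: tZ N_def)
    fix x assume "x \<in> topspace ?Z"
    then have x: "x \<in> overlap_vectors a b" using tZ Ntw by blast
    then obtain g t where g: "valid a g t" "x = (tvec g, t)" "pt a (moebius g \<i>) t \<in> U b" by (metis overlap_vectors_cases)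
    then show "ct b (pt a (fst (fst x)) (snd x)) = snd (change_chart a b x)"
      using chart_overlap[OF valid_pt[OF g(1)] g(3)] chart_valid[OF g(1)] by (simp add: change_chart_def fst_tvec)
  qed
  ultimately have "continuous_map ?Z (coord_top b) (\<lambda>x. (fst (change_chart a b x), snd (change_chart a b x)))"
    unfolding bundle_chart_space_def by (rule continuous_map_pairedI)
  then have "openin ?Z {x \<in> topspace ?Z. change_chart a b x \<in> Q}"
    using openin_continuous_map_preimage[OF _ Q] by fastforce
  then have "openin (coord_top a) {x \<in> N. change_chart a b x \<in> Q}"
    unfolding tZ by (rule openin_trans_full[OF _ N])
  then show "\<exists>T. openin (coord_top a) T \<and> p0 \<in> T \<and> T \<subseteq> {p \<in> overlap_vectors a b. change_chart a b p \<in> Q}"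
    using p0 p0N Ntw by (intro exI[of _ "{x \<in> N. change_chart a b x \<in> Q}"]) auto
qed

text \<open>Read in another chart, the image of \<open>Q\<close> is the preimage of \<open>Q\<close> under the transition map.\<close>

lemma open_psi:
  assumes Q: "openin (coord_top a) Q" shows "openin Mhat_top (psi a ` Q)"
  unfolding openin_Mhat_top
proof (intro conjI allI)
  have Qs: "Q \<subseteq> topspace (coord_top a)" using Q openin_subset by blast
  then show "psi a ` Q \<subseteq> Mhat" using psi_in by blast
  fix b
  have "{p \<in> topspace (coord_top b). psi b p \<in> psi a ` Q} = {p \<in> overlap_vectors b a. change_chart b a p \<in> Q}"
  proof safe
    fix u t x s assume p: "(u, t) \<in> topspace (coord_top b)" and x: "(x, s) \<in> Q" and e: "psi b (u, t) = psi a (x, s)"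
    obtain g where g: "valid b g t" "u = tvec g" using coord_top_cases[OF p] by (metis prod.inject)
    have "(x, s) \<in> topspace (coord_top a)" using x Qs by blast
    then obtain k where k: "valid a k s" "x = tvec k" by (metis coord_top_cases prod.inject)
    have *: "pt b (moebius g \<i>) t \<in> U a" "s = hol a b t" "k = coc a b t * g"
      using P_eq_iff[OF g(1) k(1)] e by (auto simp: g k psi_tvec)
    show "(u, t) \<in> overlap_vectors b a" using * p by (simp add: overlap_vectors_def g fst_tvec)
    show "change_chart b a (u, t) \<in> Q" using * x by (simp add: change_chart_def g k tvec_mult)
  next
    fix u t assume "(u, t) \<in> overlap_vectors b a" "change_chart b a (u, t) \<in> Q"
    then show "psi b (u, t) \<in> psi a ` Q" by (metis overlap_vectors_cases imageI)
  qed (simp add: overlap_vectors_def)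
  then show "openin (coord_top b) {p \<in> topspace (coord_top b). psi b p \<in> psi a ` Q}"
    using openin_transition_preimage[OF Q] by simp
qed

lemma continuous_act_small:
  obtains d where "d > 0" "\<forall>c. size_of c < d \<longrightarrow> continuous_map Mhat_top Mhat_top (\<lambda>m. act m c)"
proof -
  obtain d where d: "d > 0" "\<And>m. m \<in> Mhat \<Longrightarrow> \<exists>a g t. valid a g t \<and> m = P a g t \<and>
     (\<forall>c. size_of c < d \<longrightarrow> valid a (g * c) t \<and> act m c = P a (g * c) t)" using act_room by blast
  have "continuous_map Mhat_top Mhat_top (\<lambda>m. act m c)" if c: "size_of c < d" for c
    unfolding continuous_map_def topspace_Mhat_top
  proof (intro conjI allI impI)
    show "(\<lambda>m. act m c) \<in> Mhat \<rightarrow> Mhat" using act_in by blast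
    fix V assume V: "openin Mhat_top V"
    show "openin Mhat_top {m \<in> Mhat. act m c \<in> V}"
    proof (subst openin_subopen, intro ballI)
      fix m assume m: "m \<in> {m \<in> Mhat. act m c \<in> V}"
      then obtain a g t where g: "valid a g t" "m = P a g t" "valid a (g * c) t" "act m c = P a (g * c) t"
        using d(2) c by blast
      let ?Y' = "prod_topology (top_of_set (unit_tangent UH)) (trans_space L a)"
      let ?r = "\<lambda>p. (rtf (fst p) (tvec c), snd p)"
      have frc: "tvec c \<in> unit_tangent UH" by (rule tvec_in)
      have utD: "unit_tangent (D a) \<subseteq> unit_tangent UH" using D_UH[of a] by (auto simp: unit_tangent_def)
      have "continuous_on (unit_tangent UH) (\<lambda>u. (u, tvec c))" by (intro continuous_intros)
      then have "continuous_on (unit_tangent UH) (\<lambda>u. (\<lambda>(u, s). rtf u s) (u, tvec c))"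
        by (rule continuous_on_compose2[OF rtf_continuous]) (use frc in auto)
      then have "continuous_on (unit_tangent (D a)) (\<lambda>u. rtf u (tvec c))"
        using utD continuous_on_subset by auto
      moreover have "rtf u (tvec c) \<in> unit_tangent UH" if u: "u \<in> unit_tangent (D a)" for u
      proof -
        obtain k where "u = tvec k" "moebius k \<i> \<in> D a" by (rule unit_tangent_tvec[OF u])
        then show ?thesis using tvec_in by (simp add: tvec_mult_rtf[symmetric])
      qed
      ultimately have "continuous_map (top_of_set (unit_tangent (D a))) (top_of_set (unit_tangent UH)) (\<lambda>u. rtf u (tvec c))"
        by (simp add: image_subset_iff Pi_iff)
      from continuous_map_compose[OF continuous_map_fst this]
      have "continuous_map (coord_top a) (top_of_set (unit_tangent UH)) (\<lambda>p. rtf (fst p) (tvec c))"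
        by (simp add: bundle_chart_space_def o_def)
      then have cr: "continuous_map (coord_top a) ?Y' ?r"
        by (rule continuous_map_pairedI) (simp add: bundle_chart_space_def continuous_map_snd)
      have oD: "openin (top_of_set (unit_tangent UH)) (unit_tangent (D a))"
      proof -
        have "unit_tangent (D a) = unit_tangent UH \<inter> D a \<times> UNIV" using D_UH[of a] by (auto simp: unit_tangent_def)
        then show ?thesis using D_open[of a] by (simp add: openin_open_Int open_Times)
      qed
      have oY: "openin ?Y' (unit_tangent (D a) \<times> TT a)" using oD by (simp add: openin_prod_Times_iff)
      have eqY: "subtopology ?Y' (unit_tangent (D a) \<times> TT a) = coord_top a"
        using utD by (simp add: subtopology_Times bundle_chart_space_def subtopology_subtopology Int_absorb1)
      have "openin (coord_top a) {p \<in> topspace (coord_top a). psi a p \<in> V}" using V by (simp add: openin_Mhat_top)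
      then have "openin ?Y' {p \<in> topspace (coord_top a). psi a p \<in> V}"
        using openin_trans_full[OF _ oY] unfolding eqY by blast
      from openin_continuous_map_preimage[OF cr this]
      have oQ: "openin (coord_top a) {p \<in> topspace (coord_top a). ?r p \<in> {p \<in> topspace (coord_top a). psi a p \<in> V}}" (is "openin _ ?Q") .
      have "psi a ` ?Q \<subseteq> {m \<in> Mhat. act m c \<in> V}"
      proof safe
        fix u s assume p: "(u, s) \<in> topspace (coord_top a)" and r: "?r (u, s) \<in> topspace (coord_top a)" and v: "psi a (?r (u, s)) \<in> V"
        show "psi a (u, s) \<in> Mhat" using p by (rule psi_in)
        obtain k where k: "valid a k s" "u = tvec k" using coord_top_cases[OF p] by (metis prod.inject)
        have r': "?r (u, s) = (tvec (k * c), s)" by (simp add: k tvec_mult_rtf)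
        have "valid a (k * c) s" using r unfolding r' by (simp add: tvec_in_coord_top)
        then have "act (P a k s) c = P a (k * c) s" using act_P k(1) by blast
        then show "act (psi a (u, s)) c \<in> V" using v unfolding r' by (simp add: k psi_tvec)
      qed
      moreover have "m \<in> psi a ` ?Q"
      proof -
        have "act m c \<in> V" using m by blast
        then have "(tvec g, t) \<in> ?Q" unfolding g(4) using g(1,3)
          by (simp add: tvec_in_coord_top psi_tvec tvec_mult_rtf[symmetric])
        then have "psi a (tvec g, t) \<in> psi a ` ?Q" by (rule imageI)
        then show ?thesis unfolding g(2) psi_tvec .
      qed
      ultimately show "\<exists>T. openin Mhat_top T \<and> m \<in> T \<and> T \<subseteq> {m \<in> Mhat. act m c \<in> V}"
        using open_psi[OF oQ] by blast
    qed
  qed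
  then show ?thesis using that d(1) by blast
qed

lemma continuous_act: "continuous_map Mhat_top Mhat_top (\<lambda>m. act m c)"
proof -
  obtain d where d: "d > 0" "\<forall>c. size_of c < d \<longrightarrow> continuous_map Mhat_top Mhat_top (\<lambda>m. act m c)"
    by (rule continuous_act_small)
  show ?thesis
  proof (rule psl2_generated[OF d(1), where Q = "\<lambda>c. continuous_map Mhat_top Mhat_top (\<lambda>m. act m c)"])
    fix g h assume "continuous_map Mhat_top Mhat_top (\<lambda>m. act m g)" "continuous_map Mhat_top Mhat_top (\<lambda>m. act m h)"
    from continuous_map_compose[OF this] show "continuous_map Mhat_top Mhat_top (\<lambda>m. act m (g * h))"
      by (simp add: o_def act_act)
  qed (use d in blast)
qed

definition rotated where "rotated K C = {m \<in> Mhat. \<exists>k\<in>K. act m (rot (fst k) (snd k)) \<in> C}"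

text \<open>In a chart the set is a projection along the compact set \<open>K\<close>, and such projections are closed
maps.\<close>

lemma closed_rotated:
  assumes K: "compact K" "\<And>k. k \<in> K \<Longrightarrow> (fst k)\<^sup>2 + (snd k)\<^sup>2 = 1" and C: "closedin Mhat_top C"
  shows "closedin Mhat_top (rotated K C)"
  unfolding closedin_Mhat_top
proof (intro conjI allI)
  show "rotated K C \<subseteq> Mhat" by (auto simp: rotated_def)
  fix a
  let ?Ca = "{p \<in> topspace (coord_top a). psi a p \<in> C}"
  have Ca: "closedin (coord_top a) ?Ca" using C closedin_Mhat_top by blast
  let ?Z = "prod_topology (top_of_set K) (coord_top a)"
  let ?f = "\<lambda>x. (fst (fst (snd x)), snd (fst (snd x)) / (of_real (fst (fst x)) + \<i> * of_real (snd (fst x)))\<^sup>2)"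
  let ?r = "\<lambda>x. (?f x, snd (snd x))"
  have rot: "?r (k, (tvec g, t)) = (tvec (g * rot (fst k) (snd k)), t)" if "k \<in> K" for k g t
    using tvec_mult_rot[OF K(2)[OF that]] by simp
  have nz: "of_real p + \<i> * of_real q \<noteq> 0" if "p\<^sup>2 + q\<^sup>2 = 1" for p q
    using that by (auto simp: complex_eq_iff)
  have "continuous_on (K \<times> unit_tangent (D a)) (\<lambda>x. (fst (snd x), snd (snd x) / (of_real (fst (fst x)) + \<i> * of_real (snd (fst x)))\<^sup>2))"
    using nz[OF K(2)] by (intro continuous_intros) auto
  moreover have "(fst (snd x), snd (snd x) / (of_real (fst (fst x)) + \<i> * of_real (snd (fst x)))\<^sup>2) \<in> unit_tangent (D a)"
    if x: "x \<in> K \<times> unit_tangent (D a)" for x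
  proof -
    have k: "fst x \<in> K" using x by auto
    obtain g where g: "snd x = tvec g" "moebius g \<i> \<in> D a" using unit_tangent_tvec x by (metis mem_Times_iff)
    have "tvec (g * rot (fst (fst x)) (snd (fst x))) \<in> unit_tangent (D a)"
      using g rot_fixes[OF K(2)[OF k]] by (simp add: tvec_in_unit_tangent moebius_mult ii_UH)
    then show ?thesis using tvec_mult_rot[OF K(2)[OF k], of g] g by simp
  qed
  ultimately have c1: "continuous_map (top_of_set (K \<times> unit_tangent (D a))) (top_of_set (unit_tangent (D a)))
     (\<lambda>x. (fst (snd x), snd (snd x) / (of_real (fst (fst x)) + \<i> * of_real (snd (fst x)))\<^sup>2))"
    by (simp add: image_subset_iff Pi_iff)
  have c2: "continuous_map ?Z (top_of_set (K \<times> unit_tangent (D a))) (\<lambda>x. (fst x, fst (snd x)))"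
  proof -
    have "continuous_map (coord_top a) (top_of_set (unit_tangent (D a))) fst"
      by (simp add: bundle_chart_space_def continuous_map_fst)
    from continuous_map_compose[OF continuous_map_snd this]
    have "continuous_map ?Z (top_of_set (unit_tangent (D a))) (\<lambda>x. fst (snd x))" by (simp add: o_def)
    with continuous_map_fst
    have "continuous_map ?Z (prod_topology (top_of_set K) (top_of_set (unit_tangent (D a)))) (\<lambda>x. (fst x, fst (snd x)))"
      by (rule continuous_map_pairedI)
    then show ?thesis by (simp add: subtopology_Times[symmetric] prod_topology_euclidean)
  qed
  have "continuous_map ?Z (top_of_set (unit_tangent (D a))) ?f"
    using continuous_map_compose[OF c2 c1] by (simp add: o_def)
  moreover have c3: "continuous_map (coord_top a) (trans_space L a) snd"
    by (simp add: bundle_chart_space_def continuous_map_snd)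
  have "continuous_map ?Z (trans_space L a) (\<lambda>x. snd (snd x))"
    using continuous_map_compose[OF continuous_map_snd c3] by (simp add: o_def)
  ultimately have "continuous_map ?Z (prod_topology (top_of_set (unit_tangent (D a))) (trans_space L a)) ?r"
    by (rule continuous_map_pairedI)
  then have "continuous_map ?Z (coord_top a) ?r" by (simp add: bundle_chart_space_def)
  from closedin_continuous_map_preimage[OF this Ca]
  have cl: "closedin ?Z {x \<in> topspace ?Z. ?r x \<in> ?Ca}" .
  have "closed_map ?Z (coord_top a) snd"
    by (rule closed_map_snd, rule compact_space_subtopology) (simp add: K(1))
  then have "closedin (coord_top a) (snd ` {x \<in> topspace ?Z. ?r x \<in> ?Ca})"
    using cl by (simp add: closed_map_def)
  moreover have "snd ` {x \<in> topspace ?Z. ?r x \<in> ?Ca} = {p \<in> topspace (coord_top a). psi a p \<in> rotated K C}"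
  proof -
    have key: "?r (k, p) \<in> ?Ca \<longleftrightarrow> act (psi a p) (rot (fst k) (snd k)) \<in> C"
      if k: "k \<in> K" and p: "p \<in> topspace (coord_top a)" for k p
    proof -
      obtain g t where g: "valid a g t" "p = (tvec g, t)" "psi a p = P a g t" using p by (rule coord_top_cases)
      have v: "valid a (g * rot (fst k) (snd k)) t"
        using g(1) rot_fixes[OF K(2)[OF k]] by (simp add: valid_def moebius_mult ii_UH)
      show ?thesis unfolding g(2) rot[OF k] using act_P[OF g(1) v] v by (simp add: tvec_in_coord_top psi_tvec)
    qed
    show ?thesis
    proof (intro equalityI subsetI)
      fix p assume "p \<in> snd ` {x \<in> topspace ?Z. ?r x \<in> ?Ca}"
      then obtain k where k: "k \<in> K" "p \<in> topspace (coord_top a)" "?r (k, p) \<in> ?Ca" by auto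
      then show "p \<in> {p \<in> topspace (coord_top a). psi a p \<in> rotated K C}"
        using key[OF k(1,2)] psi_in[OF k(2)] unfolding rotated_def by blast
    next
      fix p assume p: "p \<in> {p \<in> topspace (coord_top a). psi a p \<in> rotated K C}"
      then obtain k where k: "k \<in> K" "act (psi a p) (rot (fst k) (snd k)) \<in> C" unfolding rotated_def by blast
      then have "?r (k, p) \<in> ?Ca" using key p by blast
      then have "(k, p) \<in> {x \<in> topspace ?Z. ?r x \<in> ?Ca}" using k p by simp
      then show "p \<in> snd ` {x \<in> topspace ?Z. ?r x \<in> ?Ca}" by (metis (no_types, lifting) imageI snd_conv)
    qed
  qed
  ultimately show "closedin (coord_top a) {p \<in> topspace (coord_top a). psi a p \<in> rotated K C}" by simp
qed

text \<open>The section that assigns to each point of the chart the vector pointing upwards in the half plane.\<close>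

definition sect where "sect a x = psi a ((cz a x, \<i> * of_real (Im (cz a x))), ct a x)"

lemma sect_P:
  assumes "x \<in> U a"
  obtains g where "valid a g (ct a x)" "sect a x = P a g (ct a x)" "moebius g \<i> = cz a x"
proof -
  have "cz a x \<in> D a" "cz a x \<in> UH" using cz_in[OF assms] D_UH[of a] by auto
  then have "(cz a x, \<i> * of_real (Im (cz a x))) \<in> unit_tangent (D a)"
    by (auto simp: unit_tangent_def UH_iff norm_mult)
  then obtain g where g: "(cz a x, \<i> * of_real (Im (cz a x))) = tvec g" "moebius g \<i> \<in> D a"
    by (rule unit_tangent_tvec)
  have "moebius g \<i> = cz a x" using g(1) fst_tvec by (metis fst_conv)
  then show ?thesis using that[of g] g ct_in[OF assms] by (simp add: valid_def sect_def psi_tvec)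
qed

lemma sect_in: "x \<in> U a \<Longrightarrow> sect a x \<in> Mhat"
  by (metis sect_P P_in)

lemma base_sect: "x \<in> U a \<Longrightarrow> base (sect a x) = x"
  by (metis sect_P base_P pt_chart)

lemma continuous_sect: "continuous_map (subtopology X (U a)) Mhat_top (sect a)"
proof -
  let ?Y = "prod_topology (top_of_set (D a)) (trans_space L a)"
  have 1: "continuous_map (top_of_set (D a)) (top_of_set (unit_tangent (D a))) (\<lambda>z. (z, \<i> * of_real (Im z)))"
    using D_UH[of a] by (auto simp: unit_tangent_def UH_iff norm_mult intro!: continuous_intros)
  have 2: "continuous_map ?Y (top_of_set (unit_tangent (D a))) (\<lambda>y. (fst y, \<i> * of_real (Im (fst y))))"
    using continuous_map_compose[OF continuous_map_fst 1] by (simp add: o_def)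
  have "continuous_map ?Y (coord_top a) (\<lambda>y. ((fst y, \<i> * of_real (Im (fst y))), snd y))"
    unfolding bundle_chart_space_def by (rule continuous_map_pairedI[OF 2 continuous_map_snd])
  from continuous_map_compose[OF continuous_map_compose[OF continuous_chart this] continuous_psi]
  show ?thesis by (simp add: o_def sect_def[abs_def])
qed

lemma closed_by_charts:
  assumes "Q \<subseteq> topspace X" "\<And>a. closedin (subtopology X (U a)) (Q \<inter> U a)"
  shows "closedin X Q"
proof -
  have "openin X (U a - Q)" for a
  proof -
    have "topspace (subtopology X (U a)) = U a" using U_sub by auto
    then have "openin (subtopology X (U a)) (U a - Q \<inter> U a)" using assms(2) by (metis closedin_def)
    moreover have "U a - Q \<inter> U a = U a - Q" by blast
    ultimately show ?thesis using openin_trans_full open_U by metis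
  qed
  then have "openin X (\<Union>a. U a - Q)" by blast
  moreover have "(\<Union>a. U a - Q) = topspace X - Q" using cover_U by blast
  ultimately show ?thesis using assms(1) by (simp add: closedin_def)
qed

end

section \<open>Haar measure in matrix coordinates\<close>

type_synonym frame = "(real^2) \<times> (real^2)"

definition fdet :: "frame \<Rightarrow> real" where
  "fdet A = fst A $ 1 * snd A $ 2 - snd A $ 1 * fst A $ 2"

definition lin :: "real \<Rightarrow> real \<Rightarrow> real \<Rightarrow> real \<Rightarrow> real^2 \<Rightarrow> real^2" where
  "lin p q r s v = vector [p * v $ 1 + q * v $ 2, r * v $ 1 + s * v $ 2]"

text \<open>The group element of a frame, a pair of columns with positive determinant, scaled to determinant
one.\<close>

definition elt :: "frame \<Rightarrow> psl2" where
  "elt A = mk (fst A $ 1 / sqrt (fdet A)) (snd A $ 1 / sqrt (fdet A)) (fst A $ 2 / sqrt (fdet A)) (snd A $ 2 / sqrt (fdet A))"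

lemma elt_det: "fdet A > 0 \<Longrightarrow>
  fst A $ 1 / sqrt (fdet A) * (snd A $ 2 / sqrt (fdet A)) - snd A $ 1 / sqrt (fdet A) * (fst A $ 2 / sqrt (fdet A)) = 1"
  by (simp add: diff_divide_distrib[symmetric]) (simp add: fdet_def)

lemma fdet_lin: "p * s - q * r = 1 \<Longrightarrow> fdet (lin p q r s (fst A), lin p q r s (snd A)) = fdet A"
proof -
  assume a: "p * s - q * r = 1"
  have "fdet (lin p q r s (fst A), lin p q r s (snd A)) = (p * s - q * r) * fdet A"
    by (simp add: fdet_def lin_def algebra_simps)
  then show ?thesis using a by simp
qed

lemma elt_left:
  assumes "p * s - q * r = 1" "fdet A > 0"
  shows "fdet (lin p q r s (fst A), lin p q r s (snd A)) = fdet A"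
    "elt (lin p q r s (fst A), lin p q r s (snd A)) = mk p q r s * elt A"
proof -
  show 1: "fdet (lin p q r s (fst A), lin p q r s (snd A)) = fdet A" by (rule fdet_lin[OF assms(1)])
  show "elt (lin p q r s (fst A), lin p q r s (snd A)) = mk p q r s * elt A"
    unfolding elt_def 1 mk_mult[OF assms(1) elt_det[OF assms(2)]]
    by (simp add: lin_def add_divide_distrib)
qed

text \<open>Right multiplication by the matrix with rows \<open>p, q\<close> and \<open>r, s\<close>.\<close>

definition rmul :: "real \<Rightarrow> real \<Rightarrow> real \<Rightarrow> real \<Rightarrow> frame \<Rightarrow> frame" where
  "rmul p q r s A = (p *\<^sub>R fst A + r *\<^sub>R snd A, q *\<^sub>R fst A + s *\<^sub>R snd A)"

lemma fdet_rmul: "p * s - q * r = 1 \<Longrightarrow> fdet (rmul p q r s A) = fdet A"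
proof -
  assume a: "p * s - q * r = 1"
  have "fdet (rmul p q r s A) = (p * s - q * r) * fdet A"
    by (simp add: fdet_def rmul_def algebra_simps)
  then show ?thesis using a by simp
qed

lemma elt_right:
  assumes "p * s - q * r = 1" "fdet A > 0"
  shows "fdet (rmul p q r s A) = fdet A" "elt (rmul p q r s A) = elt A * mk p q r s"
proof -
  show 1: "fdet (rmul p q r s A) = fdet A" by (rule fdet_rmul[OF assms(1)])
  show "elt (rmul p q r s A) = elt A * mk p q r s"
    unfolding elt_def 1 mk_mult[OF elt_det[OF assms(2)] assms(1)]
    by (simp add: rmul_def add_divide_distrib mult.commute)
qed

lemma elt_surj:
  assumes "e > 0" obtains A where "fdet A = e" "elt A = g"
proof -
  obtain a b c d where g: "a * d - b * c = 1" "g = mk a b c d" by (rule psl2_eq_mk)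
  let ?s = "sqrt e"
  let ?A = "(vector [?s * a, ?s * c], vector [?s * b, ?s * d]) :: frame"
  have s: "?s * ?s = e" "?s > 0" using assms by simp_all
  have "fdet ?A = (?s * ?s) * (a * d - b * c)" by (simp add: fdet_def algebra_simps)
  then have d: "fdet ?A = e" using g s by simp
  then have "elt ?A = g" using s(2) by (simp add: elt_def g)
  then show ?thesis using that d by blast
qed

lemma tvec_elt:
  assumes "fdet A > 0"
  shows "tvec (elt A) = ((of_real (fst A $ 1) * \<i> + of_real (snd A $ 1)) / (of_real (fst A $ 2) * \<i> + of_real (snd A $ 2)),
     \<i> * of_real (fdet A) / (of_real (fst A $ 2) * \<i> + of_real (snd A $ 2))\<^sup>2)"
    and "of_real (fst A $ 2) * \<i> + of_real (snd A $ 2) \<noteq> (0::complex)"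
proof -
  define s :: complex where "s = of_real (sqrt (fdet A))"
  have s: "s \<noteq> 0" "s\<^sup>2 = of_real (fdet A)"
    using assms by (simp_all add: s_def of_real_power[symmetric])
  have *: "of_real (x / sqrt (fdet A)) * \<i> + of_real (y / sqrt (fdet A)) = (of_real x * \<i> + of_real y) / s" for x y
    by (simp add: s_def add_divide_distrib)
  show nz: "of_real (fst A $ 2) * \<i> + of_real (snd A $ 2) \<noteq> (0::complex)"
    using assms by (auto simp: complex_eq_iff fdet_def)
  show "tvec (elt A) = ((of_real (fst A $ 1) * \<i> + of_real (snd A $ 1)) / (of_real (fst A $ 2) * \<i> + of_real (snd A $ 2)),
     \<i> * of_real (fdet A) / (of_real (fst A $ 2) * \<i> + of_real (snd A $ 2))\<^sup>2)"
    unfolding elt_def tvec_mk[OF elt_det[OF assms]] * s(2)[symmetric] using s(1) nz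
    by (simp add: power_divide)
qed

lemma continuous_tvec_elt: "continuous_on {A. fdet A > 0} (\<lambda>A. tvec (elt A))"
proof -
  have "continuous_on {A. fdet A > 0} (\<lambda>A. ((of_real (fst A $ 1) * \<i> + of_real (snd A $ 1)) / (of_real (fst A $ 2) * \<i> + of_real (snd A $ 2)),
     \<i> * of_real (fdet A) / (of_real (fst A $ 2) * \<i> + of_real (snd A $ 2))\<^sup>2))"
    unfolding fdet_def using tvec_elt(2)[unfolded fdet_def]
    by (intro continuous_intros) auto
  then show ?thesis by (rule continuous_on_eq) (simp add: tvec_elt(1))
qed

lemma continuous_fdet: "continuous_on S fdet"
  unfolding fdet_def by (intro continuous_intros)

text \<open>Scaling to determinant one turns Lebesgue measure on this set into a Haar measure on the group. The
bounds are strict so that sets of frames given by open conditions are open.\<close>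

definition shell :: "frame set" where "shell = {A. 1 < fdet A \<and> fdet A < 2}"

lemma open_shell: "open shell"
  unfolding shell_def by (intro open_Collect_conj open_Collect_less continuous_fdet continuous_intros)

lemma shell_pos: "A \<in> shell \<Longrightarrow> fdet A > 0" by (simp add: shell_def)

lemma open_shell_over:
  assumes "open W" shows "open {A \<in> shell. moebius (elt A) \<i> \<in> W}"
proof -
  have "continuous_on shell (\<lambda>A. fst (tvec (elt A)))"
    by (intro continuous_intros continuous_on_subset[OF continuous_tvec_elt]) (auto simp: shell_def)
  then have "open (shell \<inter> (\<lambda>A. fst (tvec (elt A))) -` W)"
    using open_shell assms by (rule continuous_open_preimage)
  moreover have "shell \<inter> (\<lambda>A. fst (tvec (elt A))) -` W = {A \<in> shell. moebius (elt A) \<i> \<in> W}"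
    by (auto simp: fst_tvec)
  ultimately show ?thesis by simp
qed

text \<open>With \<open>j\<close> and \<open>z\<close> as for tangent vectors, \<open>(norm j)\<^sup>2 = fdet A / Im z\<close> is bounded; \<open>j\<close> consists of the
lower entries of the frame and \<open>z * j\<close> of the upper ones.\<close>

lemma bounded_shell_over:
  assumes "bounded W" "e > 0" "\<forall>z\<in>W. e \<le> Im z"
  shows "bounded {A \<in> shell. moebius (elt A) \<i> \<in> W}"
proof -
  obtain K where K: "K > 0" "\<And>z. z \<in> W \<Longrightarrow> norm z \<le> K" using assms(1) by (metis bounded_pos)
  define R where "R = sqrt (2 / e)"
  have R: "R > 0" using assms by (simp add: R_def)
  have "norm A \<le> (R + K * R) + (R + K * R)" if A: "A \<in> shell" "moebius (elt A) \<i> \<in> W" for A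
  proof -
    define j where "j = of_real (fst A $ 2) * \<i> + (of_real (snd A $ 2) :: complex)"
    define z where "z = moebius (elt A) \<i>"
    have pos: "fdet A > 0" using A shell_pos by blast
    have zj: "z = (of_real (fst A $ 1) * \<i> + of_real (snd A $ 1)) / j"
      using tvec_elt(1)[OF pos] fst_tvec[of "elt A"] by (simp add: z_def j_def)
    have j0: "j \<noteq> 0" unfolding j_def using tvec_elt(2)[OF pos] .
    have "norm (snd (tvec (elt A))) = Im z"
      using tvec_in[of "elt A"] fst_tvec[of "elt A"] by (auto simp: unit_tangent_def z_def UH_iff field_simps)
    then have "Im z = fdet A / (norm j)\<^sup>2"
      using pos by (simp add: tvec_elt(1)[OF pos] j_def norm_divide norm_mult norm_power)
    then have "(norm j)\<^sup>2 * Im z = fdet A" using j0 by simp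
    moreover have "fdet A \<le> 2" "e \<le> Im z" using A assms(3) by (auto simp: shell_def z_def)
    moreover have "(norm j)\<^sup>2 * e \<le> (norm j)\<^sup>2 * Im z" using \<open>e \<le> Im z\<close> by (intro mult_left_mono) auto
    ultimately have "(norm j)\<^sup>2 \<le> 2 / e" using assms(2) by (simp add: pos_le_divide_eq)
    then have nj: "norm j \<le> R" unfolding R_def by (rule real_le_rsqrt)
    define w where "w = of_real (fst A $ 1) * \<i> + (of_real (snd A $ 1) :: complex)"
    have "w = z * j" using zj j0 by (simp add: w_def)
    then have "norm w = norm z * norm j" by (simp add: norm_mult)
    also have "\<dots> \<le> K * R" using nj K A by (intro mult_mono) (auto simp: z_def)
    finally have nw: "norm w \<le> K * R" .
    have b: "\<bar>fst A $ 1\<bar> \<le> K * R" "\<bar>snd A $ 1\<bar> \<le> K * R" "\<bar>fst A $ 2\<bar> \<le> R" "\<bar>snd A $ 2\<bar> \<le> R"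
      using abs_Im_le_cmod[of w] abs_Re_le_cmod[of w] abs_Im_le_cmod[of j] abs_Re_le_cmod[of j] nw nj
      by (auto simp: w_def j_def)
    have nv: "norm v \<le> \<bar>v $ 1\<bar> + \<bar>v $ 2\<bar>" for v :: "real^2"
      using norm_le_l1_cart[of v] by (simp add: sum_2)
    have "norm (fst A) \<le> R + K * R" "norm (snd A) \<le> R + K * R" using nv[of "fst A"] nv[of "snd A"] b by linarith+
    moreover have "norm A \<le> norm (fst A) + norm (snd A)"
      by (metis norm_Pair_le prod.collapse)
    ultimately show ?thesis by (meson add_mono order_trans)
  qed
  then show ?thesis unfolding bounded_iff by blast
qed

lemma linear_lin: "linear (lin p q r s)"
  by (rule linearI) (simp_all add: lin_def vec_eq_iff forall_2 algebra_simps)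

lemma lin_inverse:
  assumes "p * s - q * r = 1"
  shows "lin s (- q) (- r) p (lin p q r s v) = v" "lin p q r s (lin s (- q) (- r) p v) = v"
proof -
  have e: "s * (p * x + q * y) + - q * (r * x + s * y) = (p * s - q * r) * x"
    "- r * (p * x + q * y) + p * (r * x + s * y) = (p * s - q * r) * y"
    "p * (s * x + - q * y) + q * (- r * x + p * y) = (p * s - q * r) * x"
    "r * (s * x + - q * y) + s * (- r * x + p * y) = (p * s - q * r) * y" for x y
    by (simp_all add: algebra_simps)
  show "lin s (- q) (- r) p (lin p q r s v) = v"
    unfolding lin_def vector_2 e assms by (simp add: vec_eq_iff forall_2)
  show "lin p q r s (lin s (- q) (- r) p v) = v"
    unfolding lin_def vector_2 e assms by (simp add: vec_eq_iff forall_2)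
qed

lemma matrix_lin: "det (matrix (lin p q r s)) = p * s - q * r"
  by (simp add: det_2 matrix_def lin_def axis_def)

lemma lin_measurable [measurable]: "lin p q r s \<in> borel_measurable borel"
  using linear_continuous_on[OF linear_conv_bounded_linear[THEN iffD1, OF linear_lin]]
  by (rule borel_measurable_continuous_onI)

lemma lborel_lin:
  assumes "p * s - q * r = 1"
  shows "distr lborel borel (lin p q r s) = lborel"
proof (rule lborel_eqI[symmetric])
  fix l u :: "real^2" assume lu: "\<And>b. b \<in> Basis \<Longrightarrow> l \<bullet> b \<le> u \<bullet> b"
  let ?g = "lin s (- q) (- r) p"
  have pre: "lin p q r s -` box l u = ?g ` box l u"
    using lin_inverse[OF assms] by (auto intro!: image_eqI)
  have m: "?g ` box l u \<in> lmeasurable" "measure lebesgue (?g ` box l u) = measure lebesgue (box l u)"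
    using measurable_linear_image[OF linear_lin lmeasurable_box] measure_linear_image[OF linear_lin lmeasurable_box]
      assms by (auto simp: matrix_lin algebra_simps)
  have b: "lin p q r s -` box l u \<in> sets borel"
    using measurable_sets[OF lin_measurable, of "box l u"] by simp
  have "emeasure (distr lborel borel (lin p q r s)) (box l u) = emeasure lborel (lin p q r s -` box l u)"
    by (simp add: emeasure_distr)
  also have "\<dots> = emeasure lebesgue (?g ` box l u)" using b unfolding pre by simp
  also have "\<dots> = emeasure lebesgue (box l u)"
    using m by (simp add: emeasure_eq_measure2 fmeasurableD2)
  also have "\<dots> = (\<Prod>b\<in>Basis. (u - l) \<bullet> b)" using lu by (simp add: emeasure_lborel_box_eq inner_diff_left)
  finally show "emeasure (distr lborel borel (lin p q r s)) (box l u) = (\<Prod>b\<in>Basis. (u - l) \<bullet> b)" .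
qed simp

text \<open>Left multiplication acts on each column by the same linear map of determinant one.\<close>

lemma lborel_left:
  assumes "p * s - q * r = 1"
  shows "distr lborel borel (\<lambda>A. (lin p q r s (fst A), lin p q r s (snd A))) = (lborel :: frame measure)"
proof -
  have "distr lborel borel (lin p q r s) \<Otimes>\<^sub>M distr lborel borel (lin p q r s) =
    distr (lborel \<Otimes>\<^sub>M lborel) (borel \<Otimes>\<^sub>M borel) (\<lambda>(x, y). (lin p q r s x, lin p q r s y))"
    by (rule pair_measure_distr) (simp_all add: lborel_lin[OF assms] sigma_finite_lborel)
  then show ?thesis
    by (simp add: lborel_lin[OF assms] lborel_prod borel_prod case_prod_unfold)
qed

text \<open>The two columns are rescaled by \<open>l\<close> and \<open>1 / l\<close>, and each is two-dimensional.\<close>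

lemma lborel_diag:
  assumes "l > 0"
  shows "distr lborel borel (rmul l 0 0 (1 / l)) = (lborel :: frame measure)"
proof -
  define c where "c j = (if snd j = 0 then l else 1 / l)" for j :: frame
  have c: "c j \<noteq> 0" for j using assms by (simp add: c_def)
  have T: "(0 + (\<Sum>j\<in>Basis. (c j * (A \<bullet> j)) *\<^sub>R j)) = rmul l 0 0 (1 / l) A" for A
  proof (rule euclidean_eqI)
    fix b :: frame assume b: "b \<in> Basis"
    have "(0 + (\<Sum>j\<in>Basis. (c j * (A \<bullet> j)) *\<^sub>R j)) \<bullet> b = c b * (A \<bullet> b)"
      using b by (simp add: inner_sum_left inner_Basis if_distrib cong: if_cong)
    also have "\<dots> = rmul l 0 0 (1 / l) A \<bullet> b"
      using b by (cases A) (auto simp: Basis_prod_def c_def rmul_def)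
    finally show "(0 + (\<Sum>j\<in>Basis. (c j * (A \<bullet> j)) *\<^sub>R j)) \<bullet> b = rmul l 0 0 (1 / l) A \<bullet> b" .
  qed
  have "(\<Prod>j\<in>Basis. \<bar>c j\<bar>) = 1"
  proof -
    have p0: "(\<Prod>j\<in>Basis. \<bar>c j\<bar>) = (\<Prod>j\<in>(\<lambda>u. (u, 0)) ` (Basis :: (real^2) set). \<bar>c j\<bar>) * (\<Prod>j\<in>(\<lambda>u. (0, u)) ` (Basis :: (real^2) set). \<bar>c j\<bar>)"
      unfolding Basis_prod_def by (rule prod.union_disjoint) auto
    have p1: "(\<Prod>j\<in>(\<lambda>u. (u, 0)) ` (Basis :: (real^2) set). \<bar>c j\<bar>) = (\<Prod>u\<in>(Basis :: (real^2) set). l)"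
      using assms by (subst prod.reindex) (auto simp: inj_on_def c_def)
    have p2: "(\<Prod>j\<in>(\<lambda>u. (0, u)) ` (Basis :: (real^2) set). \<bar>c j\<bar>) = (\<Prod>u\<in>(Basis :: (real^2) set). 1 / l)"
    proof (subst prod.reindex)
      show "prod ((\<lambda>j. \<bar>c j\<bar>) \<circ> (\<lambda>u. (0, u))) (Basis :: (real^2) set) = (\<Prod>u\<in>(Basis :: (real^2) set). 1 / l)"
        using assms by (intro prod.cong refl) (auto simp: c_def nonzero_Basis)
    qed (auto simp: inj_on_def)
    show ?thesis unfolding p0 p1 p2 using assms by (simp add: power_divide)
  qed
  then have "lborel = density (distr lborel borel (rmul l 0 0 (1 / l))) (\<lambda>_. 1)"
    using lborel_affine_euclidean[of c 0, OF c] unfolding T by simp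
  then show ?thesis by (simp add: density_1)
qed

lemma emeasure_open_pos:
  fixes S :: "'a::euclidean_space set"
  assumes "open S" "S \<noteq> {}" shows "emeasure lborel S \<noteq> 0"
proof
  assume "emeasure lborel S = 0"
  then have "S \<in> null_sets lborel" using assms by (simp add: null_sets_def)
  then have "negligible S" using negligible_iff_null_sets null_sets_completionI by blast
  then show False using open_not_negligible assms by blast
qed

section \<open>Volume from the transverse measure\<close>

text \<open>A countable base of the first factor already yields countably many rectangles, for any space \<open>Y\<close>:
with each basic set, take the largest open set for which the rectangle stays inside.\<close>

lemma openin_prod_countable_rectangles:
  fixes S :: "'a::second_countable_topology set"
  assumes Q: "openin (prod_topology (top_of_set S) Y) Q"
  obtains \<B> T where "countable \<B>" "\<forall>B\<in>\<B>. open B \<and> openin Y (T B)" "Q = (\<Union>B\<in>\<B>. (B \<inter> S) \<times> T B)"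
proof -
  have "\<exists>\<B> :: 'a set set. countable \<B> \<and> topological_basis \<B>" by (rule ex_countable_basis)
  then obtain \<B> :: "'a set set" where \<B>: "countable \<B>" "topological_basis \<B>" by (elim exE conjE)
  define T where "T B = \<Union>{V. openin Y V \<and> (B \<inter> S) \<times> V \<subseteq> Q}" for B
  have "Q \<subseteq> (\<Union>B\<in>\<B>. (B \<inter> S) \<times> T B)"
  proof safe
    fix x t assume xt: "(x, t) \<in> Q"
    have "\<forall>x y. (x, y) \<in> Q \<longrightarrow> (\<exists>V W. openin (top_of_set S) V \<and> openin Y W \<and> x \<in> V \<and> y \<in> W \<and> V \<times> W \<subseteq> Q)"
      using Q by (simp only: openin_prod_topology_alt)
    then have "\<exists>V W. openin (top_of_set S) V \<and> openin Y W \<and> x \<in> V \<and> t \<in> W \<and> V \<times> W \<subseteq> Q"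
      using xt by (elim allE impE)
    then obtain V W where VW: "openin (top_of_set S) V" "openin Y W" "x \<in> V" "t \<in> W" "V \<times> W \<subseteq> Q"
      by (elim exE conjE)
    obtain V' where V': "open V'" "V = S \<inter> V'" using VW(1) by (auto simp: openin_open)
    obtain B where B: "B \<in> \<B>" "x \<in> B" "B \<subseteq> V'"
    proof (rule topological_basisE[OF \<B>(2) V'(1)])
      show "x \<in> V'" using VW(3) V'(2) by simp
    qed
    have "(B \<inter> S) \<times> W \<subseteq> V \<times> W" using B(3) V'(2) by auto
    then have "(B \<inter> S) \<times> W \<subseteq> Q" using VW(5) by (rule subset_trans)
    then have "t \<in> T B" unfolding T_def using VW(2,4) by (intro UnionI[of W]) auto
    then show "(x, t) \<in> (\<Union>B\<in>\<B>. (B \<inter> S) \<times> T B)"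
      using B(1,2) VW(3) V'(2) by (intro UN_I[of B]) auto
  qed
  moreover have "(B \<inter> S) \<times> T B \<subseteq> Q" for B unfolding T_def by auto
  then have "(\<Union>B\<in>\<B>. (B \<inter> S) \<times> T B) \<subseteq> Q" by (intro UN_least)
  moreover have "open B \<and> openin Y (T B)" if "B \<in> \<B>" for B
    using that topological_basis_open[OF \<B>(2)] unfolding T_def by auto
  ultimately show ?thesis by (intro that[OF \<B>(1)] ballI subset_antisym)
qed

context hyp_lam
begin

definition bundle_borel where "bundle_borel = sigma_sets Mhat {V. openin Mhat_top V}"

lemma bundle_borel_open: "openin Mhat_top V \<Longrightarrow> V \<in> bundle_borel" by (auto simp: bundle_borel_def)

lemma sigma_algebra_bundle_borel: "sigma_algebra Mhat bundle_borel"
  unfolding bundle_borel_def by (rule sigma_algebra_sigma_sets) (auto simp: openin_Mhat_top)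

lemma bundle_borel_sub: "E \<in> bundle_borel \<Longrightarrow> E \<subseteq> Mhat"
  unfolding bundle_borel_def by (rule sigma_sets_into_sp[rotated]) (auto simp: openin_Mhat_top)

lemma bundle_borel_ops: "E \<in> bundle_borel \<Longrightarrow> E' \<in> bundle_borel \<Longrightarrow> E \<inter> E' \<in> bundle_borel" "E \<in> bundle_borel \<Longrightarrow> E' \<in> bundle_borel \<Longrightarrow> E - E' \<in> bundle_borel"
  "Mhat \<in> bundle_borel" "(\<And>n. f n \<in> bundle_borel) \<Longrightarrow> (\<Union>n::nat. f n) \<in> bundle_borel"
proof -
  interpret sigma_algebra Mhat bundle_borel by (rule sigma_algebra_bundle_borel)
  show "E \<in> bundle_borel \<Longrightarrow> E' \<in> bundle_borel \<Longrightarrow> E \<inter> E' \<in> bundle_borel" "E \<in> bundle_borel \<Longrightarrow> E' \<in> bundle_borel \<Longrightarrow> E - E' \<in> bundle_borel" "Mhat \<in> bundle_borel"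
    "(\<And>n. f n \<in> bundle_borel) \<Longrightarrow> (\<Union>n::nat. f n) \<in> bundle_borel" by auto
qed

lemma bundle_borel_closed: assumes "closedin Mhat_top C" shows "C \<in> bundle_borel"
proof -
  have "Mhat - C \<in> bundle_borel" using assms by (auto simp: closedin_def topspace_Mhat_top intro: bundle_borel_open)
  then have 1: "Mhat - (Mhat - C) \<in> bundle_borel" by (rule bundle_borel_ops(2)[OF bundle_borel_ops(3)])
  have "C \<subseteq> Mhat" using assms closedin_Mhat_top by blast
  then have "Mhat - (Mhat - C) = C" by blast
  then show ?thesis using 1 by (simp only:)
qed

lemma bundle_borel_preimage:
  assumes "E \<in> bundle_borel" shows "{m \<in> Mhat. act m c \<in> E} \<in> bundle_borel"
  using assms unfolding bundle_borel_def
proof induction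
  case (Basic V)
  then have "openin Mhat_top {m \<in> topspace Mhat_top. act m c \<in> V}"
    by (intro openin_continuous_map_preimage[OF continuous_act]) simp
  then show ?case by (simp add: topspace_Mhat_top sigma_sets.Basic)
next
  case Empty then show ?case by (simp add: sigma_sets.Empty)
next
  case (Compl E)
  have "{m \<in> Mhat. act m c \<in> Mhat - E} = Mhat - {m \<in> Mhat. act m c \<in> E}" using act_in by blast
  then show ?case using Compl by (simp add: sigma_sets.Compl)
next
  case (Union f)
  have "{m \<in> Mhat. act m c \<in> (\<Union>i. f i)} = (\<Union>i. {m \<in> Mhat. act m c \<in> f i})" by blast
  then show ?case using Union by (simp add: sigma_sets.Union)
qed

lemma open_base_preimage: assumes "openin X V" shows "openin Mhat_top {m \<in> Mhat. base m \<in> V}"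
  unfolding openin_Mhat_top
proof (intro conjI allI)
  fix a
  have "{p \<in> topspace (coord_top a). psi a p \<in> {m \<in> Mhat. base m \<in> V}} = {p \<in> topspace (coord_top a). pt a (fst (fst p)) (snd p) \<in> V}"
  proof (rule Collect_cong, rule conj_cong[OF refl])
    fix p assume p: "p \<in> topspace (coord_top a)"
    then obtain g t where "valid a g t" "p = (tvec g, t)" "psi a p = P a g t" by (rule coord_top_cases)
    then show "psi a p \<in> {m \<in> Mhat. base m \<in> V} \<longleftrightarrow> pt a (fst (fst p)) (snd p) \<in> V"
      by (simp add: base_P fst_tvec P_in)
  qed
  then show "openin (coord_top a) {p \<in> topspace (coord_top a). psi a p \<in> {m \<in> Mhat. base m \<in> V}}"
    using openin_continuous_map_preimage[OF continuous_base_chart assms] by simp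
qed auto

definition over where "over a = {m \<in> Mhat. base m \<in> U a}"

lemma over_bundle_borel: "over a \<in> bundle_borel"
  unfolding over_def by (rule bundle_borel_open[OF open_base_preimage[OF open_U]])

definition slice where
  "slice a t E = {A \<in> shell. moebius (elt A) \<i> \<in> D a \<and> P a (elt A) t \<in> E}"

lemma holonomy_dom_iff: "t \<in> holonomy_dom L b a \<longleftrightarrow> t \<in> TT a \<and> (\<exists>z\<in>D a. pt a z t \<in> U b)"
proof
  assume "t \<in> holonomy_dom L b a"
  then obtain x where x: "x \<in> U b" "x \<in> U a" "t = ct a x" by (auto simp: holonomy_dom_def)
  then show "t \<in> TT a \<and> (\<exists>z\<in>D a. pt a z t \<in> U b)" using cz_in ct_in pt_chart by metis
next
  assume *: "t \<in> TT a \<and> (\<exists>z\<in>D a. pt a z t \<in> U b)"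
  then obtain z where z: "z \<in> D a" "pt a z t \<in> U b" by blast
  then have "pt a z t \<in> U b \<inter> U a" "t = ct a (pt a z t)" using * by (simp_all add: pt_in chart_pt)
  then show "t \<in> holonomy_dom L b a" unfolding holonomy_dom_def by (metis imageI)
qed

lemma holonomy_dom_inverse:
  assumes "t \<in> holonomy_dom L b a"
  shows "hol b a t \<in> holonomy_dom L a b" "hol a b (hol b a t) = t" "coc a b (hol b a t) * coc b a t = 1"
proof -
  obtain z where z: "t \<in> TT a" "z \<in> D a" "pt a z t \<in> U b" using assms holonomy_dom_iff by blast
  note o = pt_overlap[OF z(2,1,3)]
  have "pt b (moebius (coc b a t) z) (hol b a t) \<in> U a" using o(3) pt_in[OF z(2,1)] by simp
  then show "hol b a t \<in> holonomy_dom L a b" using o(1,2) holonomy_dom_iff by blast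
  show "hol a b (hol b a t) = t" "coc a b (hol b a t) * coc b a t = 1"
    using coc_comp[OF z(2,1,3) pt_in[OF z(2,1)]] coc_self[OF z(1)] by auto
qed

text \<open>A change of charts multiplies frames on the left by the cocycle.\<close>

lemma slice_transport:
  assumes t: "t \<in> holonomy_dom L b a" and E: "E \<subseteq> over a \<inter> over b"
    and g: "coc b a t = mk p q r s" "p * s - q * r = 1"
  shows "slice a t E = (\<lambda>A. (lin p q r s (fst A), lin p q r s (snd A))) -` slice b (hol b a t) E"
proof (intro equalityI subsetI)
  let ?l = "\<lambda>A. (lin p q r s (fst A), lin p q r s (snd A))"
  have tT: "t \<in> TT a" and hT: "hol b a t \<in> TT b"
    using t holonomy_dom_inverse(1)[OF t] holonomy_dom_iff by blast+
  fix A
  {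
    assume "A \<in> slice a t E"
    then have A: "A \<in> shell" "valid a (elt A) t" "P a (elt A) t \<in> E" using tT by (auto simp: slice_def valid_def)
    have l: "elt (?l A) = coc b a t * elt A" "?l A \<in> shell"
      using elt_left[OF g(2) shell_pos[OF A(1)]] A(1) g(1) by (auto simp: shell_def)
    have U: "pt a (moebius (elt A) \<i>) t \<in> U b" using A(3) E base_P[OF A(2)] by (auto simp: over_def)
    have "valid b (coc b a t * elt A) (hol b a t)" by (rule valid_transport[OF A(2) U])
    then show "A \<in> ?l -` slice b (hol b a t) E"
      using A(3) l P_transport[OF A(2) U] by (simp add: slice_def valid_def)
  next
    assume "A \<in> ?l -` slice b (hol b a t) E"
    then have A: "?l A \<in> shell" "valid b (elt (?l A)) (hol b a t)" "P b (elt (?l A)) (hol b a t) \<in> E"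
      using hT by (auto simp: slice_def valid_def)
    have sh: "A \<in> shell" using A(1) fdet_lin[OF g(2)] by (simp add: shell_def)
    have l: "elt (?l A) = coc b a t * elt A" using elt_left(2)[OF g(2) shell_pos[OF sh]] g(1) by simp
    have U: "pt b (moebius (elt (?l A)) \<i>) (hol b a t) \<in> U a" using A(3) E base_P[OF A(2)] by (auto simp: over_def)
    have e: "coc a b (hol b a t) * elt (?l A) = elt A" unfolding l
      by (simp add: mult.assoc[symmetric] holonomy_dom_inverse(3)[OF t])
    show "A \<in> slice a t E"
      using valid_transport[OF A(2) U] P_transport[OF A(2) U] A(3) sh
      unfolding e holonomy_dom_inverse(2)[OF t] by (simp add: slice_def valid_def)
  }
qed

lemma slice_right:
  assumes c: "c = mk l 0 0 (1 / l)" "l > 0" and t: "t \<in> TT a"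
    and E: "\<And>m. m \<in> E \<Longrightarrow> \<exists>g t. m = P a g t \<and> valid a g t \<and> valid a (g * c) t"
  shows "slice a t E = rmul l 0 0 (1 / l) -` slice a t ((\<lambda>m. act m c) ` E)"
proof (intro equalityI subsetI)
  have det: "l * (1 / l) - 0 * 0 = 1" using c by simp
  fix A
  {
    assume "A \<in> slice a t E"
    then have A: "A \<in> shell" "valid a (elt A) t" "P a (elt A) t \<in> E" using t by (auto simp: slice_def valid_def)
    have r: "elt (rmul l 0 0 (1 / l) A) = elt A * c" "rmul l 0 0 (1 / l) A \<in> shell"
      using elt_right[OF det shell_pos[OF A(1)]] A(1) c by (auto simp: shell_def)
    obtain g t' where "P a (elt A) t = P a g t'" "valid a g t'" "valid a (g * c) t'" using E[OF A(3)] by blast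
    then have v: "valid a (elt A * c) t" using P_inj[OF A(2)] by blast
    have "P a (elt A * c) t \<in> (\<lambda>m. act m c) ` E" using act_P[OF A(2) v] A(3) by (metis imageI)
    then show "A \<in> rmul l 0 0 (1 / l) -` slice a t ((\<lambda>m. act m c) ` E)"
      using v r by (simp add: slice_def valid_def)
  next
    assume "A \<in> rmul l 0 0 (1 / l) -` slice a t ((\<lambda>m. act m c) ` E)"
    then have A: "rmul l 0 0 (1 / l) A \<in> shell" "valid a (elt (rmul l 0 0 (1 / l) A)) t"
      "P a (elt (rmul l 0 0 (1 / l) A)) t \<in> (\<lambda>m. act m c) ` E" using t by (auto simp: slice_def valid_def)
    have sh: "A \<in> shell" using A(1) fdet_rmul[OF det] by (simp add: shell_def)
    have r: "elt (rmul l 0 0 (1 / l) A) = elt A * c" using elt_right(2)[OF det shell_pos[OF sh]] c by simp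
    obtain m where m: "m \<in> E" "P a (elt A * c) t = act m c" using A(3) r by auto
    obtain g t' where g: "m = P a g t'" "valid a g t'" "valid a (g * c) t'" using E[OF m(1)] by blast
    have "P a (elt A * c) t = P a (g * c) t'" using m(2) act_P[OF g(2,3)] g(1) by simp
    then have "elt A * c = g * c" "t = t'" using P_inj[OF _ g(3)] A(2) r by auto
    then have "elt A = g" by (blast intro: psl2_right_cancel)
    then show "A \<in> slice a t E" using sh g m(1) \<open>t = t'\<close> by (simp add: slice_def valid_def)
  }
qed

end

locale hyp_lam_measure = hyp_lam L for L :: "('m, 'i, 't) lamination" +
  fixes \<nu> :: "'m set \<Rightarrow> 'm measure" and y :: "'i \<Rightarrow> complex"
  assumes y: "\<And>a. y a \<in> D a" and inv: "holonomy_invariant_measure L \<nu>"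
begin

abbreviation "Tr a \<equiv> transversal L a (y a)"
abbreviation "N a \<equiv> \<nu> (Tr a)"

lemma radon: "radon_measure_on (subtopology X (Tr a)) (N a)"
  using inv y unfolding holonomy_invariant_measure_def by blast

lemma Tr_sub: "Tr a \<subseteq> U a" by (auto simp: transversal_def)

lemma topspace_Tr: "topspace (subtopology X (Tr a)) = Tr a"
  using Tr_sub U_sub by fastforce

lemma space_N: "space (N a) = Tr a"
  and sets_N: "sets (N a) = sigma_sets (Tr a) {S. openin (subtopology X (Tr a)) S}"
  using radon[of a] unfolding radon_measure_on_def topspace_Tr by auto

lemma open_N: "openin (subtopology X (Tr a)) S \<Longrightarrow> S \<in> sets (N a)" by (auto simp: sets_N)

lemma pt_Tr: "t \<in> TT a \<Longrightarrow> pt a (y a) t \<in> Tr a"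
  by (simp add: transversal_def pt_in y chart_pt)

lemma Tr_pt: "x \<in> Tr a \<Longrightarrow> pt a (y a) (ct a x) = x"
  using pt_chart[of x a] by (auto simp: transversal_def)

lemma ct_Tr: "x \<in> Tr a \<Longrightarrow> ct a x \<in> TT a" using Tr_sub ct_in by blast

lemma continuous_ct: "continuous_map (subtopology X (Tr a)) (trans_space L a) (ct a)"
  by (rule continuous_chart_of(2)[of _ id, simplified]) (use Tr_sub topspace_Tr in auto)

lemma open_ct: "openin (trans_space L a) S \<Longrightarrow> openin (subtopology X (Tr a)) {x \<in> Tr a. ct a x \<in> S}"
  using openin_continuous_map_preimage[OF continuous_ct] topspace_Tr by metis

definition region where "region a E = {p \<in> Tr a \<times> UNIV. snd p \<in> slice a (ct a (fst p)) E}"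

lemma region_sets: assumes "E \<in> bundle_borel" shows "region a E \<in> sets (N a \<Otimes>\<^sub>M lborel)"
  using assms unfolding bundle_borel_def
proof induction
  have *: "region a V \<in> sets (N a \<Otimes>\<^sub>M lborel)" if V: "openin Mhat_top V" for V
  proof -
    let ?ut = "unit_tangent (D a)"
    have "openin (coord_top a) {p \<in> topspace (coord_top a). psi a p \<in> V}" using V by (simp add: openin_Mhat_top)
    then have "openin (prod_topology (top_of_set ?ut) (trans_space L a)) {p \<in> topspace (coord_top a). psi a p \<in> V}"
      by (simp add: bundle_chart_space_def)
    then obtain \<B> T where B: "countable \<B>" "\<forall>B\<in>\<B>. open B \<and> openin (trans_space L a) (T B)"
       "{p \<in> topspace (coord_top a). psi a p \<in> V} = (\<Union>B\<in>\<B>. (B \<inter> ?ut) \<times> T B)"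
      by (rule openin_prod_countable_rectangles)
    have "region a V = (\<Union>B\<in>\<B>. {x \<in> Tr a. ct a x \<in> T B} \<times> {A \<in> shell. tvec (elt A) \<in> B \<inter> ?ut})"
    proof (rule set_eqI)
      fix p :: "'m \<times> frame"
      obtain x A where p: "p = (x, A)" by (rule prod.exhaust)
      have "p \<in> region a V \<longleftrightarrow> x \<in> Tr a \<and> A \<in> shell \<and> (tvec (elt A), ct a x) \<in> {p \<in> topspace (coord_top a). psi a p \<in> V}"
        using ct_Tr by (auto simp: region_def slice_def p tvec_in_coord_top valid_def psi_tvec)
      also have "\<dots> \<longleftrightarrow> p \<in> (\<Union>B\<in>\<B>. {x \<in> Tr a. ct a x \<in> T B} \<times> {A \<in> shell. tvec (elt A) \<in> B \<inter> ?ut})"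
        unfolding B(3) by (auto simp: p)
      finally show "p \<in> region a V \<longleftrightarrow> p \<in> (\<Union>B\<in>\<B>. {x \<in> Tr a. ct a x \<in> T B} \<times> {A \<in> shell. tvec (elt A) \<in> B \<inter> ?ut})" .
    qed
    also have "\<dots> \<in> sets (N a \<Otimes>\<^sub>M lborel)"
    proof (rule sets.countable_UN'[OF B(1)], safe)
      fix B assume b: "B \<in> \<B>"
      have cs: "continuous_on shell (\<lambda>A. tvec (elt A))"
        by (rule continuous_on_subset[OF continuous_tvec_elt]) (auto simp: shell_def)
      have "open (B \<inter> D a \<times> UNIV)" using b B(2) D_open by (simp add: open_Int open_Times)
      then have "open (shell \<inter> (\<lambda>A. tvec (elt A)) -` (B \<inter> D a \<times> UNIV))"
        by (rule continuous_open_preimage[OF cs open_shell])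
      moreover have "shell \<inter> (\<lambda>A. tvec (elt A)) -` (B \<inter> D a \<times> UNIV) = {A \<in> shell. tvec (elt A) \<in> B \<inter> ?ut}"
      proof -
        have "tvec h \<in> D a \<times> UNIV \<longleftrightarrow> tvec h \<in> ?ut" for h
          unfolding tvec_in_unit_tangent mem_Times_iff fst_tvec by simp
        then have "h \<in> shell \<inter> (\<lambda>A. tvec (elt A)) -` (B \<inter> D a \<times> UNIV) \<longleftrightarrow> h \<in> {A \<in> shell. tvec (elt A) \<in> B \<inter> ?ut}" for h
          unfolding Int_iff vimage_eq mem_Collect_eq by simp
        then show ?thesis by (rule set_eqI)
      qed
      ultimately have "{A \<in> shell. tvec (elt A) \<in> B \<inter> ?ut} \<in> sets lborel" by simp
      moreover have "{x \<in> Tr a. ct a x \<in> T B} \<in> sets (N a)" using b B(2) by (intro open_N open_ct) blast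
      ultimately show "{x \<in> Tr a. ct a x \<in> T B} \<times> {A \<in> shell. tvec (elt A) \<in> B \<inter> ?ut} \<in> sets (N a \<Otimes>\<^sub>M lborel)"
        by (intro pair_measureI)
    qed
    finally show ?thesis .
  qed
  {
    case (Basic V) then show ?case using * by blast
  next
    case Empty
    have "region a {} = {}" by (auto simp: region_def slice_def)
    then show ?case by simp
  next
    case (Compl E)
    have "region a (Mhat - E) = region a Mhat - region a E"
      by (auto simp: region_def slice_def)
    moreover have "region a Mhat \<in> sets (N a \<Otimes>\<^sub>M lborel)" using *[of Mhat] topspace_Mhat_top openin_topspace[of Mhat_top] by simp
    ultimately show ?case using Compl by auto
  next
    case (Union f)
    have "region a (\<Union>i. f i) = (\<Union>i. region a (f i))" by (auto simp: region_def slice_def)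
    then show ?case using Union by auto
  }
qed

text \<open>The volume of the part of \<open>E\<close> in the chart \<open>a\<close>: transverse measure times Haar measure. The
transverse measure comes first, so that slices are measured by Lebesgue measure, which is
sigma-finite; a transversal can have infinite measure.\<close>

definition vol where "vol a E = emeasure (N a \<Otimes>\<^sub>M lborel) (region a E)"

lemma slice_sets: assumes "E \<in> bundle_borel" "x \<in> Tr a" shows "slice a (ct a x) E \<in> sets lborel"
proof -
  have "Pair x -` region a E \<in> sets lborel" by (rule sets_Pair1[OF region_sets[OF assms(1)]])
  moreover have "Pair x -` region a E = slice a (ct a x) E" using assms(2) by (auto simp: region_def)
  ultimately show ?thesis by simp
qed

lemma slice_measurable:
  assumes "E \<in> bundle_borel"
  shows "(\<lambda>x. emeasure lborel (slice a (ct a x) E)) \<in> borel_measurable (N a)"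
proof -
  have "(\<lambda>x. emeasure lborel (Pair x -` region a E)) \<in> borel_measurable (N a)"
    using sigma_finite_measure.measurable_emeasure_Pair[OF sigma_finite_lborel region_sets[OF assms]] .
  then show ?thesis
    by (rule measurable_cong[THEN iffD1, rotated]) (auto simp: space_N region_def intro!: arg_cong[of _ _ "emeasure lborel"])
qed

lemma vol_eq: assumes "E \<in> bundle_borel"
  shows "vol a E = (\<integral>\<^sup>+x. emeasure lborel (slice a (ct a x) E) \<partial>N a)"
  unfolding vol_def sigma_finite_measure.emeasure_pair_measure_alt[OF sigma_finite_lborel region_sets[OF assms]]
  by (rule nn_integral_cong) (auto simp: space_N region_def intro!: arg_cong[of _ _ "emeasure lborel"])

lemma vol_mono: "E \<subseteq> E' \<Longrightarrow> E' \<in> bundle_borel \<Longrightarrow> vol a E \<le> vol a E'"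
  unfolding vol_def by (rule emeasure_mono[OF _ region_sets]) (auto simp: region_def slice_def)

lemma vol_partition:
  assumes "E \<in> bundle_borel" "finite I" "\<And>i. i \<in> I \<Longrightarrow> B i \<in> bundle_borel" "disjoint_family_on B I" "E \<subseteq> (\<Union>i\<in>I. B i)"
  shows "vol a E = (\<Sum>i\<in>I. vol a (E \<inter> B i))"
proof -
  have "(\<Sum>i\<in>I. emeasure (N a \<Otimes>\<^sub>M lborel) (region a (E \<inter> B i))) = emeasure (N a \<Otimes>\<^sub>M lborel) (\<Union>i\<in>I. region a (E \<inter> B i))"
  proof (rule sum_emeasure)
    show "(\<lambda>i. region a (E \<inter> B i)) ` I \<subseteq> sets (N a \<Otimes>\<^sub>M lborel)"
      by (intro image_subsetI region_sets bundle_borel_ops assms)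
    show "disjoint_family_on (\<lambda>i. region a (E \<inter> B i)) I"
      using assms(4) unfolding disjoint_family_on_def region_def slice_def by blast
  qed (rule assms)
  moreover have "(\<Union>i\<in>I. region a (E \<inter> B i)) = region a E"
    using assms(5) by (auto simp: region_def slice_def)
  ultimately show ?thesis by (simp add: vol_def)
qed

lemma vol_over: assumes "E \<in> bundle_borel" shows "vol a E = vol a (E \<inter> over a)"
proof -
  have "region a E = region a (E \<inter> over a)"
    using ct_Tr base_in_U P_in by (auto simp: region_def slice_def over_def valid_def)
  then show ?thesis by (simp add: vol_def)
qed

definition slide where "slide b a x = pt b (y b) (hol b a (ct a x))"
definition Dom where "Dom b a = {x \<in> Tr a. ct a x \<in> holonomy_dom L b a}"

lemma slide_holonomy_map: "holonomy_map L b (y b) a x = slide b a x"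
  by (simp add: holonomy_map_def slide_def)

lemma slide_in:
  assumes "x \<in> Dom b a"
  shows "slide b a x \<in> Dom a b" "ct b (slide b a x) = hol b a (ct a x)" "slide a b (slide b a x) = x"
proof -
  have t: "ct a x \<in> holonomy_dom L b a" "x \<in> Tr a" using assms by (auto simp: Dom_def)
  note i = holonomy_dom_inverse[OF t(1)]
  have h: "hol b a (ct a x) \<in> TT b" using i(1) holonomy_dom_iff by blast
  show 2: "ct b (slide b a x) = hol b a (ct a x)" by (simp add: slide_def chart_pt[OF y h])
  show "slide b a x \<in> Dom a b" using pt_Tr[OF h] i(1) 2 by (simp add: Dom_def) (simp add: slide_def)
  show "slide a b (slide b a x) = x" unfolding slide_def[of a b] 2 i(2) by (rule Tr_pt[OF t(2)])
qed

lemma open_holonomy: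
  assumes T: "openin (trans_space L b) T"
  shows "openin (subtopology X (Tr a)) {x \<in> Dom b a. hol b a (ct a x) \<in> T}"
proof (subst openin_subopen, intro ballI)
  fix x0 assume x0: "x0 \<in> {x \<in> Dom b a. hol b a (ct a x) \<in> T}"
  then have x0': "x0 \<in> Tr a" "ct a x0 \<in> holonomy_dom L b a" "hol b a (ct a x0) \<in> T" by (auto simp: Dom_def)
  then obtain z where z: "z \<in> D a" "pt a z (ct a x0) \<in> U b" using holonomy_dom_iff by blast
  have B: "openin X (flow_box b UNIV T)" by (rule open_box[OF open_UNIV T])
  have hz: "ct b (pt a z (ct a x)) = hol b a (ct a x)" if "x \<in> Tr a" "pt a z (ct a x) \<in> U b" for x
    using chart_overlap[OF pt_in[OF z(1) ct_Tr[OF that(1)]] that(2)] chart_pt[OF z(1) ct_Tr[OF that(1)]] by simp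
  have cm: "continuous_map (subtopology X (Tr a)) X (\<lambda>x. pt a z (ct a x))"
    using continuous_map_compose[OF continuous_ct continuous_pt2[OF z(1)]] by (simp add: o_def)
  let ?S = "{x \<in> Tr a. pt a z (ct a x) \<in> flow_box b UNIV T}"
  have "openin (subtopology X (Tr a)) ?S"
    using openin_continuous_map_preimage[OF cm B] unfolding topspace_Tr .
  moreover have "x0 \<in> ?S" using x0' z hz by (auto simp: flow_box_def)
  moreover have "?S \<subseteq> {x \<in> Dom b a. hol b a (ct a x) \<in> T}"
  proof
    fix x assume "x \<in> ?S"
    then have x: "x \<in> Tr a" "pt a z (ct a x) \<in> U b" "ct b (pt a z (ct a x)) \<in> T" by (auto simp: flow_box_def)
    then have "ct a x \<in> holonomy_dom L b a" using z(1) ct_Tr holonomy_dom_iff by blast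
    then show "x \<in> {x \<in> Dom b a. hol b a (ct a x) \<in> T}" using x hz by (simp add: Dom_def)
  qed
  ultimately show "\<exists>S. openin (subtopology X (Tr a)) S \<and> x0 \<in> S \<and> S \<subseteq> {x \<in> Dom b a. hol b a (ct a x) \<in> T}"
    by blast
qed

lemma hol_in: "x \<in> Dom b a \<Longrightarrow> hol b a (ct a x) \<in> TT b"
  using holonomy_dom_inverse(1) holonomy_dom_iff by (auto simp: Dom_def)

lemma Dom_sets: "Dom b a \<in> sets (N a)"
proof -
  have "Dom b a = {x \<in> Dom b a. hol b a (ct a x) \<in> TT b}" using hol_in by blast
  then show ?thesis using open_N[OF open_holonomy[OF openin_topspace]] by metis
qed

lemma slide_preimage: assumes "F \<in> sets (N b)" shows "{x \<in> Dom b a. slide b a x \<in> F} \<in> sets (N a)"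
  using assms unfolding sets_N[of b]
proof induction
  case (Basic S)
  then obtain S' where S': "openin X S'" "S = S' \<inter> Tr b" by (auto simp: openin_subtopology)
  have "openin (trans_space L b) {t \<in> TT b. pt b (y b) t \<in> S'}"
    using openin_continuous_map_preimage[OF continuous_pt2[OF y] S'(1)] .
  from open_N[OF open_holonomy[OF this]]
  have "{x \<in> Dom b a. hol b a (ct a x) \<in> {t \<in> TT b. pt b (y b) t \<in> S'}} \<in> sets (N a)" .
  moreover have "{x \<in> Dom b a. hol b a (ct a x) \<in> {t \<in> TT b. pt b (y b) t \<in> S'}} = {x \<in> Dom b a. slide b a x \<in> S}"
    using hol_in pt_Tr by (auto simp: slide_def S')
  ultimately show ?case by simp
next
  case Empty then show ?case by simp
next
  case (Compl F)
  have "{x \<in> Dom b a. slide b a x \<in> Tr b - F} = Dom b a - {x \<in> Dom b a. slide b a x \<in> F}"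
    using slide_in(1) by (auto simp: Dom_def)
  then show ?case using Compl Dom_sets by auto
next
  case (Union f)
  have "{x \<in> Dom b a. slide b a x \<in> (\<Union>i. f i)} = (\<Union>i. {x \<in> Dom b a. slide b a x \<in> f i})" by blast
  then show ?case using Union by auto
qed

lemma slide_emeasure:
  assumes "F \<in> sets (N b)"
  shows "emeasure (N a) {x \<in> Dom b a. slide b a x \<in> F} = emeasure (N b) (F \<inter> Dom a b)"
proof -
  let ?E = "{x \<in> Dom b a. slide b a x \<in> F}"
  have "\<forall>x\<in>?E. ct a x \<in> holonomy_dom L b a" by (auto simp: Dom_def)
  then have "emeasure (N b) (holonomy_map L b (y b) a ` ?E) = emeasure (N a) ?E"
    using inv y slide_preimage[OF assms, of a] unfolding holonomy_invariant_measure_def by blast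
  moreover have "holonomy_map L b (y b) a ` ?E = F \<inter> Dom a b"
  proof (intro equalityI subsetI)
    fix x assume "x \<in> F \<inter> Dom a b"
    then have "slide a b x \<in> ?E" "x = slide b a (slide a b x)" using slide_in[of x a b] by auto
    then show "x \<in> holonomy_map L b (y b) a ` ?E" by (auto simp: slide_holonomy_map)
  qed (auto simp: slide_holonomy_map slide_in)
  ultimately show ?thesis by simp
qed

text \<open>Invariance of the transverse measure, restated for integrals.\<close>

lemma slide_integral:
  assumes f: "f \<in> borel_measurable (N b)" and f0: "\<And>x. x \<in> Tr b \<Longrightarrow> x \<notin> Dom a b \<Longrightarrow> f x = 0"
  shows "(\<integral>\<^sup>+x. f (slide b a x) * indicator (Dom b a) x \<partial>N a) = (\<integral>\<^sup>+x. f x \<partial>N b)"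
proof -
  have D: "Dom b a \<inter> space (N a) \<in> sets (N a)" using Dom_sets by auto
  have sp: "Dom b a \<inter> space (N a) = Dom b a" by (auto simp: space_N Dom_def)
  have HM: "slide b a \<in> measurable (restrict_space (N a) (Dom b a)) (N b)"
  proof (rule measurableI)
    fix x assume "x \<in> space (restrict_space (N a) (Dom b a))"
    then have "x \<in> Dom b a" by (simp add: space_restrict_space)
    then show "slide b a x \<in> space (N b)" using slide_in(1) by (auto simp: space_N Dom_def)
  next
    fix F assume F: "F \<in> sets (N b)"
    have "slide b a -` F \<inter> space (restrict_space (N a) (Dom b a)) = {x \<in> Dom b a. slide b a x \<in> F}"
      using sp by (auto simp: space_restrict_space)
    moreover have "{x \<in> Dom b a. slide b a x \<in> F} \<in> sets (restrict_space (N a) (Dom b a))"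
      using slide_preimage[OF F] D by (simp add: sets_restrict_space_iff)
    ultimately show "slide b a -` F \<inter> space (restrict_space (N a) (Dom b a)) \<in> sets (restrict_space (N a) (Dom b a))" by simp
  qed
  have eq: "distr (restrict_space (N a) (Dom b a)) (N b) (slide b a) = density (N b) (indicator (Dom a b))"
  proof (rule measure_eqI)
    fix F assume "F \<in> sets (distr (restrict_space (N a) (Dom b a)) (N b) (slide b a))"
    then have F: "F \<in> sets (N b)" by simp
    have v: "slide b a -` F \<inter> space (restrict_space (N a) (Dom b a)) = {x \<in> Dom b a. slide b a x \<in> F}"
      using sp by (auto simp: space_restrict_space)
    have "emeasure (distr (restrict_space (N a) (Dom b a)) (N b) (slide b a)) F = emeasure (N a) {x \<in> Dom b a. slide b a x \<in> F}"
      unfolding emeasure_distr[OF HM F] v by (rule emeasure_restrict_space[OF D]) auto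
    also have "\<dots> = emeasure (N b) (F \<inter> Dom a b)" by (rule slide_emeasure[OF F])
    also have "\<dots> = (\<integral>\<^sup>+x. indicator (F \<inter> Dom a b) x \<partial>N b)"
      using F Dom_sets[of a b] by (intro nn_integral_indicator[symmetric]) auto
    also have "\<dots> = (\<integral>\<^sup>+x. indicator (Dom a b) x * indicator F x \<partial>N b)"
      by (intro nn_integral_cong) (auto simp: indicator_def)
    also have "\<dots> = emeasure (density (N b) (indicator (Dom a b))) F"
      using F Dom_sets[of a b] by (intro emeasure_density[symmetric]) auto
    finally show "emeasure (distr (restrict_space (N a) (Dom b a)) (N b) (slide b a)) F = emeasure (density (N b) (indicator (Dom a b))) F" .
  qed simp
  have "(\<integral>\<^sup>+x. f (slide b a x) * indicator (Dom b a) x \<partial>N a) = (\<integral>\<^sup>+x. f (slide b a x) \<partial>restrict_space (N a) (Dom b a))"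
    by (rule nn_integral_restrict_space[OF D, symmetric])
  also have "\<dots> = (\<integral>\<^sup>+x. f x \<partial>density (N b) (indicator (Dom a b)))"
    unfolding eq[symmetric] by (subst nn_integral_distr[OF HM]) (use f in simp_all)
  also have "\<dots> = (\<integral>\<^sup>+x. indicator (Dom a b) x * f x \<partial>N b)"
    using Dom_sets[of a b] f by (intro nn_integral_density) auto
  also have "\<dots> = (\<integral>\<^sup>+x. f x \<partial>N b)"
    using f0 by (intro nn_integral_cong) (auto simp: indicator_def space_N)
  finally show ?thesis .
qed

lemma emeasure_vimage_lborel:
  fixes f :: "frame \<Rightarrow> frame"
  assumes "distr lborel borel f = lborel" "f \<in> borel_measurable borel" "S \<in> sets lborel"
  shows "emeasure lborel (f -` S) = emeasure lborel S"
proof -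
  have "emeasure lborel S = emeasure (distr lborel borel f) S" by (simp add: assms(1))
  also have "\<dots> = emeasure lborel (f -` S)" using assms(2,3) by (subst emeasure_distr) auto
  finally show ?thesis by simp
qed

text \<open>The charts agree on the volume of sets that lie in both: the slices correspond under left
multiplication by the cocycle, and the transversals under holonomy.\<close>

lemma vol_transport:
  assumes E: "E \<in> bundle_borel" "E \<subseteq> over a \<inter> over b"
  shows "vol a E = vol b E"
proof -
  have eq: "emeasure lborel (slice a (ct a x) E) = emeasure lborel (slice b (ct b (slide b a x)) E)" if x: "x \<in> Dom b a" for x
  proof -
    obtain p s q r where g: "p * s - q * r = 1" "coc b a (ct a x) = mk p q r s" by (rule psl2_eq_mk)
    have t: "ct a x \<in> holonomy_dom L b a" using x by (simp add: Dom_def)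
    have "slide b a x \<in> Tr b" using slide_in(1)[OF x] by (simp add: Dom_def)
    then have "emeasure lborel ((\<lambda>A. (lin p q r s (fst A), lin p q r s (snd A))) -` slice b (ct b (slide b a x)) E)
       = emeasure lborel (slice b (ct b (slide b a x)) E)"
      by (intro emeasure_vimage_lborel lborel_left[OF g(1)] slice_sets[OF E(1)]) (auto simp: borel_prod[symmetric])
    then show ?thesis using slice_transport[OF t E(2) g(2,1)] slide_in(2)[OF x] by simp
  qed
  have zero: "slice a (ct a x) E = {}" if "x \<in> Tr a" "x \<notin> Dom b a" "E \<subseteq> over b" for a b x
  proof -
    have False if "A \<in> slice a (ct a x) E" for A
    proof -
      have v: "valid a (elt A) (ct a x)" "P a (elt A) (ct a x) \<in> over b"
        using that \<open>x \<in> Tr a\<close> \<open>E \<subseteq> over b\<close> ct_Tr by (auto simp: slice_def valid_def)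
      then have "pt a (moebius (elt A) \<i>) (ct a x) \<in> U b" by (simp add: over_def base_P)
      then have "ct a x \<in> holonomy_dom L b a" using v(1) holonomy_dom_iff by (auto simp: valid_def)
      then show False using \<open>x \<notin> Dom b a\<close> \<open>x \<in> Tr a\<close> by (simp add: Dom_def)
    qed
    then show ?thesis by blast
  qed
  have "vol a E = (\<integral>\<^sup>+x. emeasure lborel (slice b (ct b (slide b a x)) E) * indicator (Dom b a) x \<partial>N a)"
    unfolding vol_eq[OF E(1)]
  proof (rule nn_integral_cong)
    fix x assume "x \<in> space (N a)"
    then show "emeasure lborel (slice a (ct a x) E) = emeasure lborel (slice b (ct b (slide b a x)) E) * indicator (Dom b a) x"
      using eq[of x] zero[of x a b] E(2) by (cases "x \<in> Dom b a") (auto simp: space_N)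
  qed
  also have "\<dots> = (\<integral>\<^sup>+x. emeasure lborel (slice b (ct b x) E) \<partial>N b)"
    using zero[of _ b a] E(2) by (intro slide_integral slice_measurable[OF E(1)]) auto
  finally show ?thesis by (simp add: vol_eq[OF E(1)])
qed

lemma rmul_measurable: "rmul p q r s \<in> borel_measurable borel"
  unfolding rmul_def by (intro borel_measurable_continuous_onI continuous_intros)

lemma vol_right:
  assumes c: "c = mk l 0 0 (1 / l)" "l > 0" and E: "E \<in> bundle_borel" "(\<lambda>m. act m c) ` E \<in> bundle_borel"
    and E': "\<And>m. m \<in> E \<Longrightarrow> \<exists>g t. m = P a g t \<and> valid a g t \<and> valid a (g * c) t"
  shows "vol a ((\<lambda>m. act m c) ` E) = vol a E"
  unfolding vol_eq[OF E(1)] vol_eq[OF E(2)]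
proof (rule nn_integral_cong)
  fix x assume "x \<in> space (N a)"
  then have x: "x \<in> Tr a" by (simp add: space_N)
  have "emeasure lborel (rmul l 0 0 (1 / l) -` slice a (ct a x) ((\<lambda>m. act m c) ` E)) = emeasure lborel (slice a (ct a x) ((\<lambda>m. act m c) ` E))"
    by (intro emeasure_vimage_lborel lborel_diag c rmul_measurable slice_sets E x)
  then show "emeasure lborel (slice a (ct a x) ((\<lambda>m. act m c) ` E)) = emeasure lborel (slice a (ct a x) E)"
    using slice_right[OF c ct_Tr[OF x] E'] by simp
qed

end

section \<open>Invariance under the geodesic flow\<close>

text \<open>Two matrices of determinant one whose first columns are positive multiples of each other differ by
an upper triangular factor on the right. Geometrically, the two vectors point to the same boundary
point.\<close>

lemma mk_same_column:
  assumes "a * d - b * c = 1" "l * a * d' - b' * (l * c) = 1" "l > 0"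
  shows "\<exists>h\<in>affine_group. mk (l * a) b' (l * c) d' = mk a b c d * h"
proof -
  define e where "e = b' * d - d' * b"
  have il: "inverse l = a * d' - c * b'"
  proof -
    have "l * (a * d' - c * b') = 1" using assms(2) by (simp add: algebra_simps)
    then show ?thesis using inverse_unique by blast
  qed
  have det: "l * inverse l - e * 0 = 1" using assms(3) by simp
  have e1: "a * e + b * inverse l = (a * d - b * c) * b'" and e2: "c * e + d * inverse l = (a * d - b * c) * d'"
    unfolding il by (simp_all add: e_def algebra_simps)
  have "mk a b c d * mk l e 0 (inverse l) = mk (l * a) b' (l * c) d'"
    unfolding mk_mult[OF assms(1) det] e1 e2 assms(1) by (simp add: mult.commute)
  moreover have "mk l e 0 (inverse l) \<in> affine_group" using assms(3) unfolding affine_group_mk by blast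
  ultimately show ?thesis by (metis (no_types))
qed

lemma affine_of_frames:
  assumes "fdet A > 0" "fdet A' > 0" "fst A' = k *\<^sub>R fst A" "k > 0"
  shows "\<exists>h\<in>affine_group. elt A' = elt A * h"
proof -
  define l where "l = k * sqrt (fdet A) / sqrt (fdet A')"
  have l: "l > 0" using assms by (simp add: l_def)
  have e: "fst A' $ i / sqrt (fdet A') = l * (fst A $ i / sqrt (fdet A))" for i
    using assms by (simp add: l_def)
  have "l * (fst A $ 1 / sqrt (fdet A)) * (snd A' $ 2 / sqrt (fdet A')) - (snd A' $ 1 / sqrt (fdet A')) * (l * (fst A $ 2 / sqrt (fdet A))) = 1"
    using elt_det[OF assms(2)] unfolding e by simp
  from mk_same_column[OF elt_det[OF assms(1)] this l]
  show ?thesis unfolding elt_def[of A'] e unfolding elt_def[of A] .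
qed

lemma affine_groupI: "a > 0 \<Longrightarrow> mk a b 0 (inverse a) \<in> affine_group"
  by (auto simp: affine_group_mk)

lemma affine_mult: assumes "g \<in> affine_group" "h \<in> affine_group" shows "g * h \<in> affine_group"
proof -
  obtain a b where g: "g = mk a b 0 (inverse a)" "a > 0" using assms by (auto simp: affine_group_mk)
  obtain c d where h: "h = mk c d 0 (inverse c)" "c > 0" using assms by (auto simp: affine_group_mk)
  have 1: "a * inverse a - b * 0 = 1" "c * inverse c - d * 0 = 1" using g h by auto
  have "g * h = mk (a * c) (a * d + b * inverse c) 0 (inverse (a * c))"
    unfolding g h mk_mult[OF 1] by simp
  then show ?thesis using affine_groupI[of "a * c"] g(2) h(2) by simp
qed

lemma horo_geod_affine: "horo x * geod s \<in> affine_group"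
proof -
  have "horo x \<in> affine_group" using affine_groupI[of 1 x] by (simp add: horo_def)
  moreover have "geod s \<in> affine_group" using affine_groupI[of "exp (s/2)" 0] by (simp add: geod_def exp_minus)
  ultimately show ?thesis by (rule affine_mult)
qed

lemma affine_inverse: assumes "g \<in> affine_group" obtains h where "h \<in> affine_group" "g * h = 1" "h * g = 1"
proof -
  obtain a b where g: "g = mk a b 0 (inverse a)" "a > 0" using assms by (auto simp: affine_group_mk)
  have 1: "a * inverse a - b * 0 = 1" "inverse a * a - (- b) * 0 = 1" using g by auto
  have "mk (inverse a) (- b) 0 a \<in> affine_group" using affine_groupI[of "inverse a" "- b"] g(2) by simp
  moreover have "g * mk (inverse a) (- b) 0 a = 1" "mk (inverse a) (- b) 0 a * g = 1"
    unfolding g mk_mult[OF 1] mk_mult[OF 1(2,1)] using g(2) by (simp_all add: mk_one)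
  ultimately show ?thesis by (rule that)
qed

lemma one_affine: "1 \<in> affine_group"
  using horo_geod_affine[of 0 0] by (simp add: horo_0 geod_0)

lemma affine_moves: assumes "z \<in> UH" obtains b where "b \<in> affine_group" "moebius (g * b) \<i> = z"
proof -
  obtain f where f: "moebius f \<i> = z" by (rule moebius_transitive[OF assms])
  obtain h where h: "g * h = f" by (rule psl2_solve)
  obtain x s k where k: "h = horo x * geod s * k" "moebius k \<i> = \<i>" by (rule iwasawa)
  have "moebius (g * (horo x * geod s)) \<i> = moebius (g * (horo x * geod s) * k) \<i>"
    by (simp only: moebius_mult[of _ "g * (horo x * geod s)" k] ii_UH k(2))
  also have "\<dots> = z" using f h k(1) by (simp add: mult.assoc)
  finally show ?thesis using that horo_geod_affine by blast
qed

lemma fixes_i_rot: assumes "moebius k \<i> = \<i>" obtains p q where "p\<^sup>2 + q\<^sup>2 = 1" "k = rot p q"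
proof -
  obtain a b c d where g: "a * d - b * c = 1" "k = mk a b c d" by (rule psl2_eq_mk)
  have nz: "of_real c * \<i> + of_real d \<noteq> (0::complex)" using denom_nz[OF g(1), of \<i>] by simp
  have "of_real a * \<i> + of_real b = \<i> * (of_real c * \<i> + of_real d)"
    using assms nz unfolding g(2) moebius_mk[OF g(1)] by (simp add: divide_eq_eq)
  then have "a = d" "b = - c" by (auto simp: complex_eq_iff)
  then show ?thesis using that[of a c] g by (simp add: rot_def power2_eq_square)
qed

text \<open>The rotations whose half angle has tangent at most \<open>k\<close> in absolute value.\<close>

definition sector :: "real \<Rightarrow> (real \<times> real) set" where
  "sector k = {x. (fst x)\<^sup>2 + (snd x)\<^sup>2 = 1 \<and> \<bar>snd x\<bar> \<le> k * \<bar>fst x\<bar>}"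

definition circle :: "(real \<times> real) set" where "circle = {x. (fst x)\<^sup>2 + (snd x)\<^sup>2 = 1}"

lemma compact_circle: "compact circle"
proof -
  have "closed circle" unfolding circle_def by (intro closed_Collect_eq continuous_intros)
  moreover have "circle \<subseteq> cball 0 1" by (auto simp: circle_def norm_Pair)
  ultimately show ?thesis using bounded_subset[OF bounded_cball] compact_eq_bounded_closed by blast
qed

lemma compact_sector: "compact (sector k)"
proof -
  have "closed {x::real\<times>real. \<bar>snd x\<bar> \<le> k * \<bar>fst x\<bar>}" by (intro closed_Collect_le continuous_intros)
  then have "compact (circle \<inter> {x. \<bar>snd x\<bar> \<le> k * \<bar>fst x\<bar>})" using compact_circle by blast
  moreover have "circle \<inter> {x. \<bar>snd x\<bar> \<le> k * \<bar>fst x\<bar>} = sector k" by (auto simp: sector_def circle_def)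
  ultimately show ?thesis by simp
qed

text \<open>The first column of \<open>geod s * rot p' q'\<close> is \<open>(l * p', q' / l)\<close> with \<open>l = exp (s / 2)\<close>. Choosing \<open>p'\<close>
and \<open>q'\<close> so that this is a positive multiple of \<open>(p, q)\<close> makes the slope grow by the factor
\<open>l\<^sup>2 = exp s\<close>.\<close>

lemma flow_rot:
  assumes "(p, q) \<in> sector k"
  obtains p' q' h where "(p', q') \<in> sector (exp s * k)" "h \<in> affine_group" "geod s * rot p' q' = rot p q * h"
proof -
  have u: "p\<^sup>2 + q\<^sup>2 = 1" and k: "\<bar>q\<bar> \<le> k * \<bar>p\<bar>" using assms by (auto simp: sector_def)
  define l where "l = exp (s/2)"
  have l: "l > 0" "exp (- s/2) = 1 / l" "exp s = l\<^sup>2"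
    by (simp_all add: l_def exp_minus inverse_eq_divide power2_eq_square exp_add[symmetric])
  define n where "n = sqrt ((p / l)\<^sup>2 + (q * l)\<^sup>2)"
  have "(p / l)\<^sup>2 + (q * l)\<^sup>2 > 0"
  proof (cases "p = 0")
    case True then have "q \<noteq> 0" using u by auto
    then show ?thesis using l by (simp add: add_nonneg_pos)
  next
    case False then show ?thesis using l by (simp add: add_pos_nonneg)
  qed
  then have n: "n > 0" "n\<^sup>2 = (p / l)\<^sup>2 + (q * l)\<^sup>2" by (simp_all add: n_def)
  define p' where "p' = p / (l * n)"
  define q' where "q' = q * l / n"
  have u': "p'\<^sup>2 + q'\<^sup>2 = 1"
  proof -
    have "p'\<^sup>2 + q'\<^sup>2 = ((p / l)\<^sup>2 + (q * l)\<^sup>2) / n\<^sup>2"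
      by (simp add: p'_def q'_def power_divide power_mult_distrib add_divide_distrib)
    then show ?thesis unfolding n(2)[symmetric] using n(1) by simp
  qed
  have "\<bar>q'\<bar> = (l / n) * \<bar>q\<bar>" "\<bar>p'\<bar> = \<bar>p\<bar> / (l * n)" using l n by (simp_all add: p'_def q'_def abs_mult)
  moreover have "(l / n) * \<bar>q\<bar> \<le> (l / n) * (k * \<bar>p\<bar>)" using k l n by (intro mult_left_mono) auto
  moreover have "(l / n) * (k * \<bar>p\<bar>) = exp s * k * (\<bar>p\<bar> / (l * n))"
    using l n by (simp add: l(3) power2_eq_square)
  ultimately have c: "(p', q') \<in> sector (exp s * k)" using u' by (simp add: sector_def)
  have d1: "l * (1 / l) - 0 * 0 = 1" using l by simp
  have d2: "p' * p' - (- q') * q' = 1" using u' by (simp add: power2_eq_square)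
  have d3: "p * p - (- q) * q = 1" using u by (simp add: power2_eq_square)
  have "geod s * rot p' q' = mk (l * p') (- (l * q')) (q' / l) (p' / l)"
    unfolding geod_def rot_def l(2) l_def[symmetric] mk_mult[OF d1 d2] by simp
  also have "l * p' = 1 / n * p" using l n by (simp add: p'_def)
  also have "q' / l = 1 / n * q" using l n by (simp add: q'_def)
  finally have eq: "geod s * rot p' q' = mk (1 / n * p) (- (l * q')) (1 / n * q) (p' / l)" .
  have e1: "1 / n * p = l * p'" "1 / n * q = q' / l" using l n by (simp_all add: p'_def q'_def)
  have d4: "1 / n * p * (p' / l) - (- (l * q')) * (1 / n * q) = 1"
    unfolding e1 using u' l by (simp add: power2_eq_square)
  have "1 / n > 0" using n by simp
  then obtain h where h: "h \<in> affine_group"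
    "mk (1 / n * p) (- (l * q')) (1 / n * q) (p' / l) = mk p (- q) q p * h"
    using mk_same_column[OF d3 d4] by blast
  have "geod s * rot p' q' = rot p q * h" unfolding eq unfolding rot_def by (rule h(2))
  then show ?thesis using that c h(1) by blast
qed

context hyp_lam_measure
begin

lemma finite_transversal_nbhd:
  assumes "t \<in> TT a"
  shows "\<exists>S. openin (trans_space L a) S \<and> t \<in> S \<and> emeasure (N a) {x \<in> Tr a. ct a x \<in> S} < \<infinity>"
proof -
  have "pt a (y a) t \<in> topspace (subtopology X (Tr a))" using pt_Tr[OF assms] topspace_Tr by simp
  moreover have "\<forall>x\<in>topspace (subtopology X (Tr a)). \<exists>S. openin (subtopology X (Tr a)) S \<and> x \<in> S \<and> emeasure (N a) S < \<infinity>"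
    using radon[of a] unfolding radon_measure_on_def by (elim conjE)
  ultimately have "\<exists>S. openin (subtopology X (Tr a)) S \<and> pt a (y a) t \<in> S \<and> emeasure (N a) S < \<infinity>" by (rule bspec[rotated])
  then obtain S0 where S0: "openin (subtopology X (Tr a)) S0" "pt a (y a) t \<in> S0" "emeasure (N a) S0 < \<infinity>"
    by (elim exE conjE)
  obtain S' where S': "openin X S'" "S0 = S' \<inter> Tr a" using S0(1) by (auto simp: openin_subtopology)
  let ?S = "{t \<in> TT a. pt a (y a) t \<in> S'}"
  have "openin (trans_space L a) ?S"
    using openin_continuous_map_preimage[OF continuous_pt2[OF y] S'(1)] .
  moreover have "t \<in> ?S" using assms S0(2) S' by simp
  moreover have "{x \<in> Tr a. ct a x \<in> ?S} = S0"
  proof -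
    have "x \<in> Tr a \<and> ct a x \<in> ?S \<longleftrightarrow> x \<in> S' \<inter> Tr a" for x
      using Tr_pt[of x a] ct_Tr[of x a] by (cases "x \<in> Tr a") simp_all
    then show ?thesis unfolding S'(2) by blast
  qed
  ultimately show ?thesis using S0(3) by (intro exI[of _ ?S]) simp
qed

lemma vol_box_finite:
  assumes W: "roomy a d W" and S: "openin (trans_space L a) S" "emeasure (N a) {x \<in> Tr a. ct a x \<in> S} < \<infinity>"
  shows "vol a {m \<in> Mhat. base m \<in> flow_box a W S} < \<infinity>"
proof -
  let ?A = "{A \<in> shell. moebius (elt A) \<i> \<in> W}" and ?S = "{x \<in> Tr a. ct a x \<in> S}"
  have w: "open W" "bounded W" using W by (auto simp: roomy_def)
  obtain e where e: "e > 0" "\<forall>z\<in>W. e \<le> Im z" using W unfolding roomy_def by blast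
  have sA: "?A \<in> sets lborel" using open_shell_over[OF w(1)] by simp
  have sS: "?S \<in> sets (N a)" by (intro open_N open_ct S)
  have "region a {m \<in> Mhat. base m \<in> flow_box a W S} \<subseteq> ?S \<times> ?A"
    using ct_Tr by (auto simp: region_def slice_def base_P valid_def flow_box_def chart_pt)
  then have "vol a {m \<in> Mhat. base m \<in> flow_box a W S} \<le> emeasure (N a \<Otimes>\<^sub>M lborel) (?S \<times> ?A)"
    unfolding vol_def by (rule emeasure_mono) (rule pair_measureI[OF sS sA])
  also have "\<dots> = emeasure (N a) ?S * emeasure lborel ?A"
    by (rule sigma_finite_measure.emeasure_pair_measure_Times[OF sigma_finite_lborel sS sA])
  also have "\<dots> < \<infinity>"
    using S(2) emeasure_bounded_finite[OF bounded_shell_over[OF w(2) e]] by (simp add: ennreal_mult_less_top)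
  finally show ?thesis .
qed

text \<open>The boxes of a finite cover, made disjoint. Their volume is finite because the frames over a box form
a bounded set and the transverse factor of the box is chosen with finite measure.\<close>

lemma cells:
  obtains d a E and n :: nat where "d > 0" "\<forall>i<n. E i \<in> bundle_borel" "disjoint_family_on E {..<n}" "Mhat = (\<Union>i<n. E i)"
    "\<forall>i<n. vol (a i) (E i) < \<infinity>"
    "\<forall>i<n. \<forall>m\<in>E i. \<exists>g t. m = P (a i) g t \<and> valid (a i) g t \<and> (\<forall>c. size_of c < d \<longrightarrow> valid (a i) (g * c) t)"
proof (rule finite_box_cover[of "\<lambda>a S. emeasure (N a) {x \<in> Tr a. ct a x \<in> S} < \<infinity>"])
  show "\<exists>S. openin (trans_space L a) S \<and> t \<in> S \<and> emeasure (N a) {x \<in> Tr a. ct a x \<in> S} < \<infinity>" if "t \<in> TT a" for a t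
    using finite_transversal_nbhd[OF that] .
  fix F d
  assume F: "finite F" "d > 0"
    "\<And>a W S. (a, W, S) \<in> F \<Longrightarrow> roomy a d W \<and> openin (trans_space L a) S \<and> emeasure (N a) {x \<in> Tr a. ct a x \<in> S} < \<infinity>"
    "\<And>x. x \<in> topspace X \<Longrightarrow> \<exists>(a, W, S)\<in>F. x \<in> flow_box a W S"
  obtain e n where e: "bij_betw e {0..<n::nat} F" using ex_bij_betw_nat_finite[OF F(1)] by auto
  define a where "a i = fst (e i)" for i
  define W where "W i = fst (snd (e i))" for i
  define S where "S i = snd (snd (e i))" for i
  have eF: "roomy (a i) d (W i)" "openin (trans_space L (a i)) (S i)" "emeasure (N (a i)) {x \<in> Tr (a i). ct (a i) x \<in> S i} < \<infinity>"
    if "i < n" for i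
    using bij_betw_apply[OF e, of i] that F(3)[of "a i" "W i" "S i"] by (auto simp: a_def W_def S_def)
  define B where "B i = {m \<in> Mhat. base m \<in> flow_box (a i) (W i) (S i)}" for i
  have openB: "B i \<in> bundle_borel" if "i < n" for i
    unfolding B_def using eF[OF that] by (intro bundle_borel_open open_base_preimage open_box) (auto simp: roomy_def)
  define E where "E i = B i - (\<Union>j\<in>{..<i}. B j)" for i
  have unB: "k \<le> n \<Longrightarrow> (\<Union>j\<in>{..<k}. B j) \<in> bundle_borel" for k
  proof (induction k)
    case 0
    have "{} \<in> bundle_borel" unfolding bundle_borel_def by (rule sigma_sets.Empty)
    then show ?case by simp
  next
    case (Suc k)
    interpret sigma_algebra Mhat bundle_borel by (rule sigma_algebra_bundle_borel)
    have "B k \<union> (\<Union>j\<in>{..<k}. B j) \<in> bundle_borel" using Suc openB[of k] by (intro Un) auto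
    then show ?case by (simp add: lessThan_Suc)
  qed
  have EB: "E i \<in> bundle_borel" if "i < n" for i
    unfolding E_def using openB[OF that] unB[of i] that by (intro bundle_borel_ops) auto
  have dis: "disjoint_family_on E {..<n}"
    unfolding disjoint_family_on_def
  proof (intro ballI impI)
    fix i j :: nat assume "i \<noteq> j"
    then consider "i < j" | "j < i" by linarith
    then show "E i \<inter> E j = {}" by cases (auto simp: E_def)
  qed
  have cov: "Mhat = (\<Union>i<n. E i)"
  proof (intro equalityI subsetI)
    fix m assume m: "m \<in> Mhat"
    obtain f where f: "f \<in> F" "base m \<in> flow_box (fst f) (fst (snd f)) (snd (snd f))" using F(4)[OF base_in[OF m]] by auto
    obtain i where i: "i < n" "e i = f" using e f(1) unfolding bij_betw_def by auto
    have "m \<in> B i" using f i m by (simp add: B_def a_def W_def S_def)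
    define k where "k = (LEAST k. m \<in> B k)"
    have "m \<in> B k" unfolding k_def using \<open>m \<in> B i\<close> by (rule LeastI)
    moreover have "k \<le> i" unfolding k_def using \<open>m \<in> B i\<close> by (rule Least_le)
    moreover have "m \<notin> B j" if "j < k" for j using not_less_Least that unfolding k_def by blast
    ultimately show "m \<in> (\<Union>i<n. E i)" using i(1) unfolding E_def by (intro UN_I[of k]) auto
  qed (auto simp: E_def B_def)
  have fin: "vol (a i) (E i) < \<infinity>" if "i < n" for i
  proof -
    have "vol (a i) (E i) \<le> vol (a i) (B i)" using openB[OF that] by (intro vol_mono) (auto simp: E_def)
    also have "\<dots> < \<infinity>" unfolding B_def using eF[OF that] by (intro vol_box_finite) auto
    finally show ?thesis .
  qed
  have room: "\<exists>g t. m = P (a i) g t \<and> valid (a i) g t \<and> (\<forall>c. size_of c < d \<longrightarrow> valid (a i) (g * c) t)"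
    if i: "i < n" and m: "m \<in> E i" for i m
  proof -
    have mB: "m \<in> Mhat" "base m \<in> U (a i)" "cz (a i) (base m) \<in> W i" using m by (auto simp: E_def B_def flow_box_def)
    obtain g t where g: "valid (a i) g t" "m = P (a i) g t" by (rule in_chart[OF mB(1,2)])
    have w: "moebius g \<i> \<in> W i" using mB(3) g by (simp add: base_P chart_valid)
    have "valid (a i) (g * c) t" if c: "size_of c < d" for c
    proof -
      have "moebius (g * c) \<i> \<in> UH" by (rule moebius_UH[OF ii_UH])
      moreover have "sep (moebius g \<i>) (moebius (g * c) \<i>) < d" using c by (simp add: sep_moebius_i)
      ultimately have "moebius (g * c) \<i> \<in> D (a i)" using eF(1)[OF i] w unfolding roomy_def by blast
      then show ?thesis using g(1) by (simp add: valid_def)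
    qed
    then show ?thesis using g by blast
  qed
  show thesis using that[of d n E a] F(2) EB dis cov fin room by blast
qed

lemma act_image:
  assumes "c * c' = 1" "c' * c = 1" "E \<subseteq> Mhat"
  shows "(\<lambda>m. act m c) ` E = {m \<in> Mhat. act m c' \<in> E}"
proof (intro equalityI subsetI)
  fix m assume "m \<in> (\<lambda>m. act m c) ` E"
  then obtain m' where "m' \<in> E" "m = act m' c" by blast
  then show "m \<in> {m \<in> Mhat. act m c' \<in> E}" using assms act_in by (auto simp: act_act act_1)
next
  fix m assume "m \<in> {m \<in> Mhat. act m c' \<in> E}"
  then have "act m c' \<in> E" "m = act (act m c') c" using assms by (auto simp: act_act act_1)
  then show "m \<in> (\<lambda>m. act m c) ` E" by blast
qed

text \<open>The partition into cells defines a finite measure \<open>mm\<close> on the bundle. For a small time the geodesic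
flow preserves it: cut a set by the cells and the moved cells; on each piece the two charts
involved give the same volume, and inside one chart the flow is right multiplication. If the flow
permutes an increasing family of sets, all members have the same finite measure.\<close>

lemma null_between:
  obtains s where "s > 0" "\<forall>S. (\<forall>k::int. S k \<in> bundle_borel) \<and> (\<forall>k. (\<lambda>m. act m (geod s)) ` S k = S (k + 1)) \<and>
     (\<forall>k. S k \<subseteq> S (k + 1)) \<longrightarrow> (\<forall>a k. vol a (S (k + 1) - S k) = 0)"
proof (rule cells)
  fix d a E and n :: nat
  assume d: "d > 0" and EB: "\<forall>i<n. E i \<in> bundle_borel" and dis: "disjoint_family_on E {..<n}" and cov: "Mhat = (\<Union>i<n. E i)"
    and fin: "\<forall>i<n. vol (a i) (E i) < \<infinity>"
    and room: "\<forall>i<n. \<forall>m\<in>E i. \<exists>g t. m = P (a i) g t \<and> valid (a i) g t \<and> (\<forall>c. size_of c < d \<longrightarrow> valid (a i) (g * c) t)"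
  obtain e where e: "e > 0" "\<And>x s. \<bar>x\<bar> < e \<Longrightarrow> \<bar>s\<bar> < e \<Longrightarrow> size_of (horo x * geod s) < d"
    using size_horo_geod_small[OF d] by blast
  define s where "s = e / 2"
  have s: "s > 0" using e(1) by (simp add: s_def)
  have sz: "size_of (geod s) < d" using e(2)[of 0 s] e(1) by (simp add: horo_0 s_def)
  let ?c = "geod s" and ?l = "exp (s / 2)"
  let ?R = "\<lambda>E. (\<lambda>m. act m ?c) ` E"
  have c: "?c = mk ?l 0 0 (1 / ?l)" "?l > 0" by (simp_all add: geod_def exp_minus inverse_eq_divide)
  have cc: "?c * geod (- s) = 1" "geod (- s) * ?c = 1" by (simp_all add: geod_add geod_0)
  have RB: "?R F \<in> bundle_borel" if "F \<in> bundle_borel" for F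
    unfolding act_image[OF cc bundle_borel_sub[OF that]] by (rule bundle_borel_preimage[OF that])
  define mm where "mm F = (\<Sum>i<n. vol (a i) (F \<inter> E i))" for F
  have Eover: "E i \<subseteq> over (a i)" "?R (E i) \<subseteq> over (a i)" if i: "i < n" for i
  proof -
    show "E i \<subseteq> over (a i)" using room i base_in_U P_in by (fastforce simp: over_def)
    show "?R (E i) \<subseteq> over (a i)"
    proof
      fix m assume "m \<in> ?R (E i)"
      then obtain m' where m': "m' \<in> E i" "m = act m' ?c" by blast
      then obtain g t where g: "m' = P (a i) g t" "valid (a i) g t" "valid (a i) (g * ?c) t" using room i sz by blast
      have "m = P (a i) (g * ?c) t" using act_P[OF g(2,3)] m' g(1) by simp
      then show "m \<in> over (a i)" using base_in_U[OF g(3)] P_in[OF g(3)] by (simp add: over_def)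
    qed
  qed
  have RE_dis: "disjoint_family_on (\<lambda>i. ?R (E i)) {..<n}"
    unfolding disjoint_family_on_def
  proof (intro ballI impI)
    fix i j assume ij: "i \<in> {..<n}" "j \<in> {..<n}" "i \<noteq> j"
    have "E i \<inter> E j = {}" using dis ij unfolding disjoint_family_on_def by blast
    moreover have "inj (\<lambda>m. act m ?c)"
      by (rule inj_on_inverseI[of _ "\<lambda>m. act m (geod (- s))"]) (simp add: act_act cc act_1)
    ultimately show "?R (E i) \<inter> ?R (E j) = {}" by (metis image_Int image_empty)
  qed
  have RE_cov: "Mhat \<subseteq> (\<Union>i<n. ?R (E i))"
  proof
    fix m assume m: "m \<in> Mhat"
    then have "act m (geod (- s)) \<in> Mhat" by (rule act_in)
    then obtain i where i: "i < n" "act m (geod (- s)) \<in> E i" using cov by auto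
    have "m = act (act m (geod (- s))) ?c" by (simp add: act_act cc act_1)
    then show "m \<in> (\<Union>i<n. ?R (E i))" using i by blast
  qed
  have inv_mm: "mm (?R F) = mm F" if F: "F \<in> bundle_borel" for F
  proof -
    \<comment> \<open>On the piece indexed by j and i, the volume is moved from the chart of the cell j to that of the cell i.\<close>
    have "mm (?R F) = (\<Sum>j<n. \<Sum>i<n. vol (a j) (?R F \<inter> E j \<inter> ?R (E i)))"
      unfolding mm_def
    proof (rule sum.cong[OF refl])
      fix j assume j: "j \<in> {..<n}"
      have 1: "?R F \<inter> E j \<in> bundle_borel" using RB[OF F] EB j by (intro bundle_borel_ops) auto
      show "vol (a j) (?R F \<inter> E j) = (\<Sum>i<n. vol (a j) (?R F \<inter> E j \<inter> ?R (E i)))"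
        using 1 RE_dis bundle_borel_sub[OF 1] RE_cov by (intro vol_partition) (auto intro!: RB simp: EB)
    qed
    also have "\<dots> = (\<Sum>j<n. \<Sum>i<n. vol (a i) (?R F \<inter> ?R (E i) \<inter> E j))"
    proof (intro sum.cong refl)
      fix i j assume ij: "j \<in> {..<n}" "i \<in> {..<n}"
      have "vol (a j) (?R F \<inter> E j \<inter> ?R (E i)) = vol (a i) (?R F \<inter> E j \<inter> ?R (E i))"
        using ij EB F Eover(1)[of j] Eover(2)[of i] by (intro vol_transport bundle_borel_ops RB) auto
      then show "vol (a j) (?R F \<inter> E j \<inter> ?R (E i)) = vol (a i) (?R F \<inter> ?R (E i) \<inter> E j)"
        by (simp only: Int_assoc Int_commute[of "E j"])
    qed
    also have "\<dots> = (\<Sum>i<n. \<Sum>j<n. vol (a i) (?R F \<inter> ?R (E i) \<inter> E j))" by (rule sum.swap)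
    also have "\<dots> = (\<Sum>i<n. vol (a i) (?R F \<inter> ?R (E i)))"
    proof (rule sum.cong[OF refl])
      fix i assume i: "i \<in> {..<n}"
      have 1: "?R F \<inter> ?R (E i) \<in> bundle_borel" using F EB i by (intro bundle_borel_ops RB) auto
      show "(\<Sum>j<n. vol (a i) (?R F \<inter> ?R (E i) \<inter> E j)) = vol (a i) (?R F \<inter> ?R (E i))"
        using 1 dis EB bundle_borel_sub[OF 1] cov by (intro vol_partition[symmetric]) auto
    qed
    also have "\<dots> = mm F" unfolding mm_def
    proof (rule sum.cong[OF refl])
      fix i assume i: "i \<in> {..<n}"
      have inj: "inj (\<lambda>m. act m ?c)"
        by (rule inj_on_inverseI[of _ "\<lambda>m. act m (geod (- s))"]) (simp add: act_act cc act_1)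
      have 1: "F \<inter> E i \<in> bundle_borel" using F EB i by (intro bundle_borel_ops) auto
      have "vol (a i) (?R (F \<inter> E i)) = vol (a i) (F \<inter> E i)"
        using room i sz by (intro vol_right[OF c 1 RB[OF 1]]) blast
      then show "vol (a i) (?R F \<inter> ?R (E i)) = vol (a i) (F \<inter> E i)" by (simp only: image_Int[OF inj])
    qed
    finally show ?thesis .
  qed
  have main: "\<forall>b k. vol b (S (k + 1) - S k) = 0"
    if SB: "\<forall>k::int. S k \<in> bundle_borel" and SR: "\<forall>k. ?R (S k) = S (k + 1)" and Sm: "\<forall>k. S k \<subseteq> S (k + 1)" for S
  proof (intro allI)
    fix b k
    let ?Z = "S (k + 1) - S k"
    have ZB: "?Z \<in> bundle_borel" using SB by (intro bundle_borel_ops) auto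
    have add: "vol (a i) (S (k + 1) \<inter> E i) = vol (a i) (S k \<inter> E i) + vol (a i) (?Z \<inter> E i)" if i: "i < n" for i
    proof -
      have "region (a i) (S (k + 1) \<inter> E i) = region (a i) (S k \<inter> E i) \<union> region (a i) (?Z \<inter> E i)"
        using Sm by (auto simp: region_def slice_def)
      moreover have "region (a i) (S k \<inter> E i) \<inter> region (a i) (?Z \<inter> E i) = {}" by (auto simp: region_def slice_def)
      moreover have "region (a i) (S k \<inter> E i) \<in> sets (N (a i) \<Otimes>\<^sub>M lborel)" "region (a i) (?Z \<inter> E i) \<in> sets (N (a i) \<Otimes>\<^sub>M lborel)"
        using SB ZB EB i by (auto intro!: region_sets bundle_borel_ops simp del: sets_lborel)
      ultimately show ?thesis unfolding vol_def by (simp only: plus_emeasure)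
    qed
    have "mm (S (k + 1)) = mm (S k) + mm ?Z"
      unfolding mm_def sum.distrib[symmetric] using add by (intro sum.cong) auto
    moreover have "mm (S (k + 1)) = mm (S k)" using inv_mm[of "S k"] SR SB by simp
    moreover have "mm (S k) < \<infinity>"
    proof -
      have "vol (a i) (S k \<inter> E i) < \<infinity>" if "i < n" for i
        using vol_mono[of "S k \<inter> E i" "E i" "a i"] EB fin that by (meson Int_lower2 le_less_trans)
      then show ?thesis unfolding mm_def by simp
    qed
    ultimately have "mm ?Z = 0" by (metis add.right_neutral ennreal_add_left_cancel infinity_ennreal_def less_irrefl)
    then have z: "vol (a i) (?Z \<inter> E i) = 0" if "i < n" for i using that by (simp add: mm_def)
    have 1: "?Z \<inter> over b \<in> bundle_borel" using ZB over_bundle_borel by (rule bundle_borel_ops)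
    have "vol b ?Z = vol b (?Z \<inter> over b)" by (rule vol_over[OF ZB])
    also have "\<dots> = (\<Sum>i<n. vol b (?Z \<inter> over b \<inter> E i))"
      using 1 dis EB bundle_borel_sub[OF 1] cov by (intro vol_partition) auto
    also have "\<dots> = 0"
    proof (rule sum.neutral, rule ballI)
      fix i assume i: "i \<in> {..<n}"
      have "vol b (?Z \<inter> over b \<inter> E i) = vol (a i) (?Z \<inter> over b \<inter> E i)"
        using i EB SB over_bundle_borel[of b] Eover(1)[of i] by (intro vol_transport bundle_borel_ops) auto
      also have "\<dots> \<le> vol (a i) (?Z \<inter> E i)" using i EB SB by (intro vol_mono bundle_borel_ops) auto
      finally show "vol b (?Z \<inter> over b \<inter> E i) = 0" using z i by simp
    qed
    finally show "vol b ?Z = 0" .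
  qed
  show thesis
  proof (rule that[OF s], rule allI, rule impI, elim conjE)
    fix S
    assume "\<forall>k::int. S k \<in> bundle_borel" "\<forall>k. ?R (S k) = S (k + 1)" "\<forall>k. S k \<subseteq> S (k + 1)"
    then show "\<forall>a k. vol a (S (k + 1) - S k) = 0" by (rule main)
  qed
qed

end

section \<open>Closed sets invariant under the affine group\<close>

lemma rot_uminus: "p\<^sup>2 + q\<^sup>2 = 1 \<Longrightarrow> rot (- p) (- q) = rot p q"
  unfolding rot_def using mk_uminus[of p p "- q" q] by (simp add: power2_eq_square)

text \<open>The elements \<open>rot p q\<close> and \<open>rot (- p) (- q)\<close> of the group coincide.\<close>

lemma sector_pos:
  assumes "(p, q) \<in> sector k"
  obtains p' q' where "(p', q') \<in> sector k" "p' > 0" "rot p' q' = rot p q"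
proof -
  have pq: "p\<^sup>2 + q\<^sup>2 = 1" "\<bar>q\<bar> \<le> k * \<bar>p\<bar>" using assms by (auto simp: sector_def)
  have "p \<noteq> 0" using pq by auto
  then consider "p > 0" | "- p > 0" by linarith
  then show ?thesis
  proof cases
    case 1 then show ?thesis using that assms by blast
  next
    case 2 then show ?thesis using that[of "- p" "- q"] pq rot_uminus[OF pq(1)] by (simp add: sector_def)
  qed
qed

context hyp_lam
begin

lemma same_base_rot:
  assumes "m \<in> Mhat" "m' \<in> Mhat" "base m = base m'"
  obtains p q where "p\<^sup>2 + q\<^sup>2 = 1" "m' = act m (rot p q)"
proof -
  obtain a g t where g: "valid a g t" "m = P a g t" using assms(1) unit_bundle_iff by blast
  have "base m' \<in> U a" using base_in_U[OF g(1)] assms(3) g(2) by simp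
  then obtain h s where h: "valid a h s" "m' = P a h s" using in_chart assms(2) by blast
  have "chart L a (base m) = (moebius g \<i>, t)" "chart L a (base m') = (moebius h \<i>, s)"
    by (simp_all add: g h base_P chart_valid)
  then have e: "moebius g \<i> = moebius h \<i>" "s = t" using assms(3) by auto
  obtain k where k: "g * k = h" by (rule psl2_solve)
  obtain g' where g': "g' * g = 1" by (rule psl2_inverse)
  have "k = g' * h" unfolding k[symmetric] by (simp add: mult.assoc[symmetric] g')
  then have "moebius k \<i> = moebius g' (moebius g \<i>)" by (simp add: moebius_mult ii_UH e(1))
  also have "\<dots> = \<i>" using moebius_mult[OF ii_UH, of g' g] by (simp add: g' moebius_1)
  finally obtain p q where pq: "p\<^sup>2 + q\<^sup>2 = 1" "k = rot p q" by (rule fixes_i_rot)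
  have "act m (rot p q) = P a (g * rot p q) t"
    unfolding g(2) by (rule act_P[OF g(1)]) (use h(1) k pq(2) e(2) in simp)
  then show ?thesis using that pq h(2) k e(2) by simp
qed

lemma base_act_rot:
  assumes "m \<in> Mhat" "p\<^sup>2 + q\<^sup>2 = 1" shows "base (act m (rot p q)) = base m"
proof -
  obtain a g t where g: "valid a g t" "m = P a g t" using assms(1) unit_bundle_iff by blast
  have e: "moebius (g * rot p q) \<i> = moebius g \<i>" by (simp add: moebius_mult ii_UH rot_fixes[OF assms(2)])
  then have v: "valid a (g * rot p q) t" using g(1) by (simp add: valid_def)
  show ?thesis unfolding g(2) act_P[OF g(1) v] base_P[OF v] base_P[OF g(1)] e ..
qed

text \<open>The affine group is transitive on the base points of a plaque.\<close>

lemma plaque_affine: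
  assumes "m \<in> Mhat" "base m \<in> plaque L a t" "x' \<in> plaque L a t"
  obtains b where "b \<in> affine_group" "base (act m b) = x'"
proof -
  have x: "base m \<in> U a" "ct a (base m) = t" "x' \<in> U a" "ct a x' = t" using assms by (auto simp: plaque_def)
  obtain g s where g: "valid a g s" "m = P a g s" by (rule in_chart[OF assms(1) x(1)])
  have s: "s = t" using x(2) g by (simp add: base_P chart_valid)
  have "cz a x' \<in> UH" using cz_in[OF x(3)] D_UH[of a] by blast
  then obtain b where b: "b \<in> affine_group" "moebius (g * b) \<i> = cz a x'" by (rule affine_moves)
  have v: "valid a (g * b) s" using b(2) cz_in[OF x(3)] g(1) by (simp add: valid_def)
  have "base (act m b) = x'"
    unfolding g(2) act_P[OF g(1) v] base_P[OF v] b(2) using pt_chart[OF x(3)] x(4) s by simp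
  then show ?thesis using that b(1) by blast
qed

lemma leaf_subset:
  assumes "\<And>a t x x'. x \<in> Q \<Longrightarrow> x \<in> plaque L a t \<Longrightarrow> x' \<in> plaque L a t \<Longrightarrow> x' \<in> Q" "x \<in> Q"
  shows "leaf L x \<subseteq> Q"
proof
  fix z assume "z \<in> leaf L x"
  then have "(x, z) \<in> (\<Union>\<alpha> t. plaque L \<alpha> t \<times> plaque L \<alpha> t)\<^sup>*" by (simp add: leaf_def)
  then show "z \<in> Q"
  proof induction
    case base show ?case by (rule assms(2))
  next
    case (step u w)
    then show ?case using assms(1) by blast
  qed
qed

text \<open>A closed set that contains with each point the plaques through it is a union of leaf closures.\<close>

lemma saturated_closed_full:
  assumes "minimal_lamination L" "closedin X Q" "x \<in> Q"
    "\<And>a t x x'. x \<in> Q \<Longrightarrow> x \<in> plaque L a t \<Longrightarrow> x' \<in> plaque L a t \<Longrightarrow> x' \<in> Q"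
  shows "Q = topspace X"
proof -
  have "leaf L x \<subseteq> Q" by (rule leaf_subset[OF assms(4) assms(3)])
  then have "X closure_of leaf L x \<subseteq> Q" using assms(2) by (rule closure_of_minimal)
  moreover have "X closure_of leaf L x = topspace X"
    using assms(1,2,3) closedin_subset unfolding minimal_lamination_def by blast
  ultimately show ?thesis using closedin_subset[OF assms(2)] by blast
qed

lemma closed_meeting:
  assumes C: "closedin Mhat_top C" shows "closedin X {x \<in> topspace X. \<exists>m\<in>C. base m = x}"
proof (rule closed_by_charts)
  fix a
  have CM: "C \<subseteq> Mhat" using C closedin_Mhat_top by blast
  have "closedin (subtopology X (U a)) {x \<in> topspace (subtopology X (U a)). sect a x \<in> rotated circle C}"
    by (rule closedin_continuous_map_preimage[OF continuous_sect])
       (rule closed_rotated[OF compact_circle _ C], simp add: circle_def)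
  moreover have "{x \<in> topspace (subtopology X (U a)). sect a x \<in> rotated circle C}
     = {x \<in> topspace X. \<exists>m\<in>C. base m = x} \<inter> U a"
  proof (intro equalityI subsetI)
    fix x assume x: "x \<in> {x \<in> topspace (subtopology X (U a)). sect a x \<in> rotated circle C}"
    then have xU: "x \<in> U a" "x \<in> topspace X" by auto
    obtain k where k: "k \<in> circle" "act (sect a x) (rot (fst k) (snd k)) \<in> C" using x unfolding rotated_def by blast
    have "base (act (sect a x) (rot (fst k) (snd k))) = x"
      using base_act_rot[OF sect_in[OF xU(1)]] base_sect[OF xU(1)] k(1) by (simp add: circle_def)
    then show "x \<in> {x \<in> topspace X. \<exists>m\<in>C. base m = x} \<inter> U a" using xU k(2) by blast
  next
    fix x assume "x \<in> {x \<in> topspace X. \<exists>m\<in>C. base m = x} \<inter> U a"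
    then obtain m where m: "m \<in> C" "base m = x" "x \<in> U a" "x \<in> topspace X" by blast
    have "base (sect a x) = base m" using base_sect[OF m(3)] m(2) by simp
    then obtain p q where pq: "p\<^sup>2 + q\<^sup>2 = 1" "m = act (sect a x) (rot p q)"
      using same_base_rot[OF sect_in[OF m(3)]] m(1) CM by blast
    then have "sect a x \<in> rotated circle C"
      using m(1) sect_in[OF m(3)] unfolding rotated_def circle_def by force
    then show "x \<in> {x \<in> topspace (subtopology X (U a)). sect a x \<in> rotated circle C}" using m by simp
  qed
  ultimately show "closedin (subtopology X (U a)) ({x \<in> topspace X. \<exists>m\<in>C. base m = x} \<inter> U a)" by simp
qed auto

lemma closed_containing:
  assumes C: "closedin Mhat_top C" shows "closedin X {x \<in> topspace X. \<forall>m\<in>Mhat. base m = x \<longrightarrow> m \<in> C}"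
proof (rule closed_by_charts)
  fix a
  let ?S = "\<lambda>k. {x \<in> topspace (subtopology X (U a)). sect a x \<in> {m \<in> topspace Mhat_top. act m (rot (fst k) (snd k)) \<in> C}}"
  have "closedin (subtopology X (U a)) (?S k)" for k
    by (intro closedin_continuous_map_preimage[OF continuous_sect] closedin_continuous_map_preimage[OF continuous_act] C)
  moreover have "(1, 0) \<in> circle" by (simp add: circle_def)
  then have "circle \<noteq> {}" by blast
  ultimately have "closedin (subtopology X (U a)) (\<Inter>k\<in>circle. ?S k)" by blast
  moreover have "(\<Inter>k\<in>circle. ?S k) = {x \<in> topspace X. \<forall>m\<in>Mhat. base m = x \<longrightarrow> m \<in> C} \<inter> U a"
  proof (intro equalityI subsetI)
    fix x assume x: "x \<in> (\<Inter>k\<in>circle. ?S k)"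
    then have xU: "x \<in> U a" "x \<in> topspace X" using \<open>circle \<noteq> {}\<close> by auto
    have "m \<in> C" if m: "m \<in> Mhat" "base m = x" for m
    proof -
      have "base (sect a x) = base m" using base_sect[OF xU(1)] m(2) by simp
      then obtain p q where pq: "p\<^sup>2 + q\<^sup>2 = 1" "m = act (sect a x) (rot p q)"
        using same_base_rot[OF sect_in[OF xU(1)] m(1)] by blast
      have "(p, q) \<in> circle" using pq(1) by (simp add: circle_def)
      then have "x \<in> ?S (p, q)" using x by blast
      then show ?thesis using pq(2) by simp
    qed
    then show "x \<in> {x \<in> topspace X. \<forall>m\<in>Mhat. base m = x \<longrightarrow> m \<in> C} \<inter> U a" using xU by blast
  next
    fix x assume x: "x \<in> {x \<in> topspace X. \<forall>m\<in>Mhat. base m = x \<longrightarrow> m \<in> C} \<inter> U a"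
    then have xU: "x \<in> U a" "x \<in> topspace X" by auto
    have s: "sect a x \<in> Mhat" by (rule sect_in[OF xU(1)])
    show "x \<in> (\<Inter>k\<in>circle. ?S k)"
    proof (rule INT_I)
      fix k assume k: "k \<in> circle"
      have "base (act (sect a x) (rot (fst k) (snd k))) = x"
        using base_act_rot[OF s] base_sect[OF xU(1)] k by (simp add: circle_def)
      then have "act (sect a x) (rot (fst k) (snd k)) \<in> C" using x act_in[OF s] by blast
      then show "x \<in> ?S k" using xU s by (simp add: topspace_Mhat_top)
    qed
  qed
  ultimately show "closedin (subtopology X (U a)) ({x \<in> topspace X. \<forall>m\<in>Mhat. base m = x \<longrightarrow> m \<in> C} \<inter> U a)" by simp
qed auto

lemma open_slice_Mhat_top: assumes V: "openin Mhat_top V" and t: "t \<in> TT a" shows "open (slice a t V)"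
proof -
  let ?ut = "unit_tangent (D a)"
  have "continuous_map (top_of_set ?ut) (coord_top a) (\<lambda>u. (u, t))"
    unfolding bundle_chart_space_def using t by (intro continuous_map_pairedI) auto
  from openin_continuous_map_preimage[OF continuous_map_compose[OF this continuous_psi] V]
  have "openin (top_of_set ?ut) {u \<in> ?ut. psi a (u, t) \<in> V}" by simp
  then obtain W where W: "open W" "{u \<in> ?ut. psi a (u, t) \<in> V} = ?ut \<inter> W" by (auto simp: openin_open)
  have cs: "continuous_on shell (\<lambda>A. tvec (elt A))"
    by (rule continuous_on_subset[OF continuous_tvec_elt]) (auto simp: shell_def)
  have o1: "open (shell \<inter> (\<lambda>A. tvec (elt A)) -` W)" by (rule continuous_open_preimage[OF cs open_shell W(1)])
  have o2: "open {A \<in> shell. moebius (elt A) \<i> \<in> D a}" by (rule open_shell_over[OF D_open])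
  have "A \<in> slice a t V \<longleftrightarrow> A \<in> (shell \<inter> (\<lambda>A. tvec (elt A)) -` W) \<inter> {A \<in> shell. moebius (elt A) \<i> \<in> D a}" for A
  proof -
    have "tvec (elt A) \<in> ?ut \<and> psi a (tvec (elt A), t) \<in> V \<longleftrightarrow> tvec (elt A) \<in> ?ut \<and> tvec (elt A) \<in> W"
      using W(2) by blast
    then show ?thesis by (auto simp: slice_def psi_tvec tvec_in_unit_tangent)
  qed
  then have "slice a t V = (shell \<inter> (\<lambda>A. tvec (elt A)) -` W) \<inter> {A \<in> shell. moebius (elt A) \<i> \<in> D a}" by (rule set_eqI)
  then show ?thesis using o1 o2 by (simp only: open_Int)
qed

definition affine_closed where
  "affine_closed C \<longleftrightarrow> closedin Mhat_top C \<and> (\<forall>m\<in>C. \<forall>b\<in>affine_group. act m b \<in> C)"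

text \<open>The flow multiplies the slopes of the rotations that lead into \<open>C\<close> by \<open>exp s\<close>; the remaining
affine factor does not leave \<open>C\<close>.\<close>

lemma rotated_flow:
  assumes C: "affine_closed C"
  shows "(\<lambda>m. act m (geod s)) ` rotated (sector k) C = rotated (sector (exp s * k)) C"
proof -
  have sub: "act m (geod s) \<in> rotated (sector (exp s * k)) C" if mr: "m \<in> rotated (sector k) C" for m s k
  proof -
    obtain x where x: "x \<in> sector k" "act m (rot (fst x) (snd x)) \<in> C" and m: "m \<in> Mhat"
      using mr unfolding rotated_def by blast
    obtain p q where "x = (p, q)" by (rule prod.exhaust)
    then have pq: "(p, q) \<in> sector k" "act m (rot p q) \<in> C" using x by simp_all
    obtain p' q' h where h: "(p', q') \<in> sector (exp s * k)" "h \<in> affine_group" "geod s * rot p' q' = rot p q * h"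
      by (rule flow_rot[OF pq(1)])
    have "act (act m (geod s)) (rot p' q') = act (act m (rot p q)) h" by (simp add: act_act h(3))
    then have "act (act m (geod s)) (rot p' q') \<in> C" using C pq(2) h(2) unfolding affine_closed_def by simp
    then show ?thesis using h(1) act_in[OF m] unfolding rotated_def by force
  qed
  show ?thesis
  proof (intro equalityI subsetI)
    fix m assume m: "m \<in> rotated (sector (exp s * k)) C"
    have e: "exp (- s) * (exp s * k) = k" by (simp add: exp_minus)
    have "act m (geod (- s)) \<in> rotated (sector k) C" using sub[OF m, of "- s"] unfolding e .
    moreover have "m = act (act m (geod (- s))) (geod s)" by (simp add: act_act geod_add geod_0 act_1)
    ultimately show "m \<in> (\<lambda>m. act m (geod s)) ` rotated (sector k) C" by blast
  qed (use sub in blast)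
qed

lemma rotated_mono: "j \<le> k \<Longrightarrow> rotated (sector j) C \<subseteq> rotated (sector k) C"
proof -
  assume "j \<le> k"
  then have "j * \<bar>p\<bar> \<le> k * \<bar>p\<bar>" for p :: real by (intro mult_right_mono) auto
  then have "sector j \<subseteq> sector k" unfolding sector_def by (auto intro: order_trans)
  then show ?thesis unfolding rotated_def by blast
qed

text \<open>A vector outside the closed set \<open>C\<close> stays outside under small rotations.\<close>

lemma not_rotated:
  assumes C: "closedin Mhat_top C" and A: "A \<in> slice a t (Mhat - C)" and t: "t \<in> TT a"
  obtains k0 where "k0 > 0" "\<forall>k\<le>k0. P a (elt A) t \<notin> rotated (sector k) C"
proof -
  have op: "open (slice a t (Mhat - C))"
    using C t by (intro open_slice_Mhat_top) (auto simp: closedin_def topspace_Mhat_top)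
  have As: "A \<in> shell" "valid a (elt A) t" using A t by (auto simp: slice_def valid_def)
  let ?f = "\<lambda>x::real\<times>real. rmul (fst x) (- snd x) (snd x) (fst x) A"
  have "continuous_on UNIV ?f" unfolding rmul_def by (intro continuous_intros)
  then have "open (?f -` slice a t (Mhat - C))" using op by (simp add: continuous_on_open_vimage)
  moreover have "(1, 0) \<in> ?f -` slice a t (Mhat - C)" using A by (simp add: rmul_def)
  ultimately obtain e where e: "e > 0" "ball (1, 0) e \<subseteq> ?f -` slice a t (Mhat - C)" by (meson openE)
  show ?thesis
  proof (rule that[of "e / 3"])
    show "\<forall>k\<le>e / 3. P a (elt A) t \<notin> rotated (sector k) C"
    proof (intro allI impI notI)
      fix k assume k: "k \<le> e / 3" and m: "P a (elt A) t \<in> rotated (sector k) C"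
      then obtain p0 q0 where "(p0, q0) \<in> sector k" "act (P a (elt A) t) (rot p0 q0) \<in> C" by (auto simp: rotated_def)
      then obtain p q where pq: "(p, q) \<in> sector k" "p > 0" "act (P a (elt A) t) (rot p q) \<in> C" by (metis sector_pos)
      have u: "p\<^sup>2 + q\<^sup>2 = 1" "\<bar>q\<bar> \<le> k * p" using pq by (auto simp: sector_def)
      have "p\<^sup>2 \<le> 1\<^sup>2" unfolding one_power2 using u(1) zero_le_power2[of q] by linarith
      then have p1: "p \<le> 1" by (rule power2_le_imp_le) simp
      have "\<bar>q\<bar>\<^sup>2 \<le> 1\<^sup>2" unfolding one_power2 power2_abs using u(1) zero_le_power2[of p] by linarith
      then have q1: "\<bar>q\<bar> \<le> 1" by (rule power2_le_imp_le) simp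
      have "k \<ge> 0"
      proof (rule ccontr)
        assume "\<not> k \<ge> 0"
        then have "k * p < 0" using pq(2) by (simp add: mult_neg_pos)
        then show False using u(2) by linarith
      qed
      then have qk: "\<bar>q\<bar> \<le> k" using u(2) p1 mult_left_le[of p k] by linarith
      have "p * p \<le> p * 1" using p1 pq(2) by (intro mult_left_mono) auto
      then have "1 - p \<le> q\<^sup>2" using u(1) by (simp add: power2_eq_square)
      also have "q\<^sup>2 = \<bar>q\<bar> * \<bar>q\<bar>" by (simp add: power2_eq_square)
      also have "\<dots> \<le> \<bar>q\<bar> * 1" using q1 by (intro mult_left_mono) auto
      finally have "\<bar>p - 1\<bar> \<le> k" using p1 qk by simp
      then have "norm (p - 1, q) \<le> k + k"
        using qk norm_Pair_le[of "p - 1" q] by simp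
      also have "\<dots> < e" using k e(1) by simp
      finally have "dist (1, 0) (p, q) < e"
        using norm_minus_cancel[of "(p - 1, q)"] by (simp add: dist_norm)
      then have f: "?f (p, q) \<in> slice a t (Mhat - C)" using e(2) by (auto simp: subset_iff)
      have det: "p * p - (- q) * q = 1" using u(1) by (simp add: power2_eq_square)
      have "elt (?f (p, q)) = elt A * rot p q" using elt_right(2)[OF det shell_pos[OF As(1)]] by (simp add: rot_def)
      then have "P a (elt A * rot p q) t \<notin> C" "valid a (elt A * rot p q) t" using f t by (auto simp: slice_def valid_def)
      then show False using act_P[OF As(2)] pq(3) by simp
    qed
  qed (use e in auto)
qed

text \<open>If the vectors of \<open>A1\<close> and \<open>A\<close> lie over the same plaque and the first column of \<open>A1\<close> has coordinates
\<open>p, q\<close> in the basis \<open>A\<close>, then the rotation with parameters proportional to \<open>(p, q)\<close> turns the vector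
of \<open>A\<close> to the boundary point of \<open>A1\<close>.\<close>

lemma in_rotated:
  assumes C: "affine_closed C" and A: "fdet A > 0" "valid a (elt A) t"
    and A1: "fdet A1 > 0" "valid a (elt A1) t" "P a (elt A1) t \<in> C"
    and w: "fst A1 = p *\<^sub>R fst A + q *\<^sub>R snd A" "p \<noteq> 0" and k: "\<bar>q / p\<bar> \<le> k"
  shows "P a (elt A) t \<in> rotated (sector k) C"
proof -
  define n where "n = sqrt (p\<^sup>2 + q\<^sup>2)"
  have "p\<^sup>2 + q\<^sup>2 > 0" using w(2) by (simp add: add_pos_nonneg)
  then have n: "n > 0" "n\<^sup>2 = p\<^sup>2 + q\<^sup>2" by (simp_all add: n_def)
  define p' where "p' = p / n"
  define q' where "q' = q / n"
  have "p'\<^sup>2 + q'\<^sup>2 = (p\<^sup>2 + q\<^sup>2) / n\<^sup>2" by (simp add: p'_def q'_def power_divide add_divide_distrib)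
  then have u: "p'\<^sup>2 + q'\<^sup>2 = 1" unfolding n(2)[symmetric] using n(1) by simp
  have det: "p' * p' - (- q') * q' = 1" using u by (simp add: power2_eq_square)
  let ?A = "rmul p' (- q') q' p' A"
  have f: "fst ?A = (1 / n) *\<^sub>R fst A1" by (simp add: rmul_def p'_def q'_def w(1) scaleR_add_right)
  have r: "fdet ?A = fdet A" "elt ?A = elt A * rot p' q'" using elt_right[OF det A(1)] by (simp_all add: rot_def)
  have "\<exists>h\<in>affine_group. elt ?A = elt A1 * h"
    by (rule affine_of_frames[OF A1(1) _ f]) (use r A n in auto)
  then obtain h where h: "h \<in> affine_group" "elt A * rot p' q' = elt A1 * h" using r(2) by auto
  have v: "valid a (elt A * rot p' q') t" using A(2) by (simp add: valid_def moebius_mult ii_UH rot_fixes[OF u])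
  have "act (P a (elt A) t) (rot p' q') = P a (elt A1 * h) t" using act_P[OF A(2) v] h(2) by simp
  also have "\<dots> = act (P a (elt A1) t) h" by (rule act_P[OF A1(2), symmetric]) (use v h(2) in simp)
  also have "\<dots> \<in> C" using C A1(3) h(1) unfolding affine_closed_def by blast
  finally have "act (P a (elt A) t) (rot p' q') \<in> C" .
  moreover have "(p', q') \<in> sector k"
  proof -
    have "\<bar>q\<bar> \<le> k * \<bar>p\<bar>" using k w(2) by (simp add: abs_divide divide_le_eq)
    then have "\<bar>q\<bar> / n \<le> k * \<bar>p\<bar> / n" using n(1) by (intro divide_right_mono) auto
    then show ?thesis using u n(1) by (simp add: sector_def p'_def q'_def abs_divide)
  qed
  ultimately show ?thesis using P_in[OF A(2)] unfolding rotated_def by force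
qed

text \<open>A frame \<open>A1\<close> with vector in \<open>C\<close> is fixed, and \<open>w\<close> is its first column. The open set consists of the
frames with vector outside \<open>C\<close> for which \<open>w\<close> is not a multiple of the second column, that is, for
which the boundary point of \<open>A1\<close> is not directly behind the vector.\<close>

lemma fat_slice:
  assumes C: "affine_closed C" and t: "t \<in> TT a" and s: "s > 0"
    and m1: "m1 \<in> C" "base m1 = x" and m0: "m0 \<in> Mhat" "m0 \<notin> C" "base m0 = x" and x: "x \<in> U a" "ct a x = t"
  obtains V where "open V" "V \<noteq> {}"
    "V \<subseteq> (\<Union>n::nat. slice a t (rotated (sector (exp (s * real n))) C - rotated (sector (exp (- s * real n))) C))"
proof -
  have cl: "closedin Mhat_top C" and CM: "C \<subseteq> Mhat" using C closedin_Mhat_top by (auto simp: affine_closed_def)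
  obtain g0 t0 where g0: "valid a g0 t0" "m0 = P a g0 t0" using in_chart[OF m0(1)] m0(3) x(1) by metis
  obtain g1 t1 where g1: "valid a g1 t1" "m1 = P a g1 t1" using in_chart[of m1 a] m1 x(1) CM by (metis subsetD)
  have "ct a (base m0) = t0" "ct a (base m1) = t1" by (simp_all add: g0 g1 base_P chart_valid)
  then have tt: "t0 = t" "t1 = t" using x(2) m0(3) m1(2) by simp_all
  obtain A0 where A0: "fdet A0 = 3/2" "elt A0 = g0" using elt_surj[of "3/2"] by auto
  obtain A1 where A1: "fdet A1 = 1" "elt A1 = g1" using elt_surj[of 1] by auto
  define w where "w = fst A1"
  define dW where "dW A = w $ 1 * snd A $ 2 - snd A $ 1 * w $ 2" for A :: frame
  define cW where "cW A = fst A $ 1 * w $ 2 - w $ 1 * fst A $ 2" for A :: frame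
  let ?O = "slice a t (Mhat - C)"
  have op: "open ?O"
    using cl t by (intro open_slice_Mhat_top) (auto simp: closedin_def topspace_Mhat_top)
  define V where "V = ?O \<inter> {A. dW A \<noteq> 0}"
  have cdW: "continuous_on UNIV dW" unfolding dW_def by (intro continuous_intros)
  have "open {A. dW A \<noteq> 0}" by (intro open_Collect_neq cdW continuous_intros)
  then have oV: "open V" unfolding V_def using op by (rule open_Int[rotated])
  have A0O: "A0 \<in> ?O" using A0 g0 m0 tt by (auto simp: slice_def shell_def valid_def)
  have cramer: "fdet A *\<^sub>R w = dW A *\<^sub>R fst A + cW A *\<^sub>R snd A" for A
    by (simp add: vec_eq_iff forall_2 dW_def cW_def fdet_def algebra_simps)
  have neV: "V \<noteq> {}"
  proof (cases "dW A0 = 0")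
    case False then show ?thesis using A0O by (auto simp: V_def)
  next
    case True
    have "w \<noteq> 0" using A1(1) by (auto simp: w_def fdet_def)
    have cW0: "cW A0 \<noteq> 0"
    proof
      assume "cW A0 = 0"
      then have "fdet A0 *\<^sub>R w = 0" using cramer[of A0] True by simp
      then show False using A0(1) \<open>w \<noteq> 0\<close> by simp
    qed
    \<comment> \<open>Adding a small multiple of the first column to the second one moves w off the second column.\<close>
    let ?f = "\<lambda>e::real. rmul 1 e 0 1 A0"
    have "continuous_on UNIV ?f" unfolding rmul_def by (intro continuous_intros)
    then have "open (?f -` ?O)" using op by (simp add: continuous_on_open_vimage)
    moreover have "0 \<in> ?f -` ?O" using A0O by (simp add: rmul_def)
    ultimately obtain e where e: "e > 0" "ball 0 e \<subseteq> ?f -` ?O" by (meson openE)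
    then have "e / 2 \<in> ?f -` ?O" by (auto simp: subset_iff dist_norm)
    moreover have "dW (?f (e / 2)) = dW A0 - (e / 2) * cW A0"
      by (simp add: dW_def cW_def rmul_def algebra_simps)
    then have "dW (?f (e / 2)) \<noteq> 0" using True cW0 e(1) by simp
    ultimately show ?thesis unfolding V_def by blast
  qed
  have "V \<subseteq> (\<Union>n::nat. slice a t (rotated (sector (exp (s * real n))) C - rotated (sector (exp (- s * real n))) C))"
  proof
    fix A assume AV: "A \<in> V"
    then have AO: "A \<in> ?O" and d: "dW A \<noteq> 0" by (auto simp: V_def)
    then have A: "A \<in> shell" "valid a (elt A) t" "moebius (elt A) \<i> \<in> D a" using t by (auto simp: slice_def valid_def)
    have pos: "fdet A > 0" using A(1) shell_pos by blast
    obtain k0 where k0: "k0 > 0" "\<forall>k\<le>k0. P a (elt A) t \<notin> rotated (sector k) C" by (rule not_rotated[OF cl AO t])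
    define p where "p = dW A / fdet A"
    define q where "q = cW A / fdet A"
    have wpq: "fst A1 = p *\<^sub>R fst A + q *\<^sub>R snd A"
    proof -
      have "w = (1 / fdet A) *\<^sub>R (fdet A *\<^sub>R w)" using pos by simp
      also have "\<dots> = p *\<^sub>R fst A + q *\<^sub>R snd A" unfolding cramer by (simp add: p_def q_def scaleR_add_right)
      finally show ?thesis by (simp add: w_def)
    qed
    have p0: "p \<noteq> 0" using d pos by (simp add: p_def)
    \<comment> \<open>Both thresholds are reached for the same n, since exp x exceeds x.\<close>
    obtain n :: nat where "max \<bar>q / p\<bar> (1 / k0) / s < real n" using reals_Archimedean2 by blast
    then have n: "max \<bar>q / p\<bar> (1 / k0) < s * real n" using s by (simp add: divide_less_eq mult.commute)
    have ex: "s * real n < exp (s * real n)" using exp_ge_add_one_self[of "s * real n"] by linarith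
    have "\<bar>q / p\<bar> \<le> exp (s * real n)" using n ex by simp
    then have in1: "P a (elt A) t \<in> rotated (sector (exp (s * real n))) C"
      using in_rotated[OF C pos A(2) _ _ _ wpq p0] A1 g1 m1 tt by simp
    have "1 / k0 < exp (s * real n)" using n ex by simp
    then have "exp (- s * real n) \<le> k0" using k0(1) by (simp add: exp_minus inverse_eq_divide field_simps)
    then have "P a (elt A) t \<notin> rotated (sector (exp (- s * real n))) C" using k0(2) by blast
    then have "A \<in> slice a t (rotated (sector (exp (s * real n))) C - rotated (sector (exp (- s * real n))) C)"
      using in1 A by (simp add: slice_def)
    then show "A \<in> (\<Union>n::nat. slice a t (rotated (sector (exp (s * real n))) C - rotated (sector (exp (- s * real n))) C))" by blast
  qed
  then show ?thesis using that oV neV by blast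
qed

end

context hyp_lam_measure
begin

lemma sector_unit: "k \<in> sector c \<Longrightarrow> (fst k)\<^sup>2 + (snd k)\<^sup>2 = 1" by (simp add: sector_def)

text \<open>All differences between sets of the family are null, and so for almost every point of the
transversal the slices of these differences are null; but the slices contain nonempty open sets.\<close>

lemma full_fibre_exists:
  assumes C: "affine_closed C" and meets: "\<forall>x\<in>topspace X. \<exists>m\<in>C. base m = x"
    and nz: "emeasure (N a) (Tr a) \<noteq> 0"
  shows "\<exists>x\<in>topspace X. \<forall>m\<in>Mhat. base m = x \<longrightarrow> m \<in> C"
proof (rule ccontr)
  assume "\<not> ?thesis"
  then have no: "\<And>x. x \<in> topspace X \<Longrightarrow> \<exists>m\<in>Mhat. base m = x \<and> m \<notin> C" by blast
  have cl: "closedin Mhat_top C" using C by (simp add: affine_closed_def)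
  show False
  proof (rule null_between)
    fix s assume s: "s > 0" and null: "\<forall>S. (\<forall>k::int. S k \<in> bundle_borel) \<and> (\<forall>k. (\<lambda>m. act m (geod s)) ` S k = S (k + 1)) \<and>
     (\<forall>k. S k \<subseteq> S (k + 1)) \<longrightarrow> (\<forall>a k. vol a (S (k + 1) - S k) = 0)"
    define S where "S k = rotated (sector (exp (s * real_of_int k))) C" for k :: int
    have SB: "S k \<in> bundle_borel" for k
      unfolding S_def by (rule bundle_borel_closed[OF closed_rotated[OF compact_sector _ cl]]) (rule sector_unit)
    have SR: "(\<lambda>m. act m (geod s)) ` S k = S (k + 1)" for k
    proof -
      have "exp s * exp (s * real_of_int k) = exp (s * real_of_int (k + 1))"
        by (simp add: exp_add[symmetric] algebra_simps)
      then show ?thesis unfolding S_def rotated_flow[OF C] by simp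
    qed
    have Sm: "S j \<subseteq> S k" if "j \<le> k" for j k
      unfolding S_def using that s by (intro rotated_mono) simp
    have nl: "vol a (S (k + 1) - S k) = 0" for k using null SB SR Sm by simp
    define Z where "Z n = S (int n) - S (- int n)" for n
    have ZB: "Z n \<in> bundle_borel" for n unfolding Z_def by (intro bundle_borel_ops SB)
    have "region a (\<Union>n. Z n) \<subseteq> (\<Union>k. region a (S (k + 1) - S k))"
    proof
      fix x assume "x \<in> region a (\<Union>n. Z n)"
      then obtain n where x: "fst x \<in> Tr a" "snd x \<in> shell" "moebius (elt (snd x)) \<i> \<in> D a"
        "P a (elt (snd x)) (ct a (fst x)) \<in> S (int n) - S (- int n)" by (auto simp: region_def slice_def Z_def)
      let ?m = "P a (elt (snd x)) (ct a (fst x))"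
      have "\<exists>k. ?m \<in> S (k + 1) - S k"
      proof (rule ccontr)
        assume no: "\<nexists>k. ?m \<in> S (k + 1) - S k"
        have "?m \<notin> S (- int n + int j)" for j
        proof (induction j)
          case 0 then show ?case using x(4) by simp
        next
          case (Suc j)
          then have "?m \<notin> S (- int n + int j + 1)" using no by blast
          then show ?case by (simp add: algebra_simps)
        qed
        from this[of "2 * n"] show False using x(4) by simp
      qed
      then show "x \<in> (\<Union>k. region a (S (k + 1) - S k))" using x by (auto simp: region_def slice_def mem_Times_iff)
    qed
    moreover have "(\<Union>k. region a (S (k + 1) - S k)) \<in> null_sets (N a \<Otimes>\<^sub>M lborel)"
    proof (rule null_sets_UN)
      fix k
      have "region a (S (k + 1) - S k) \<in> sets (N a \<Otimes>\<^sub>M lborel)" by (intro region_sets bundle_borel_ops SB)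
      then show "region a (S (k + 1) - S k) \<in> null_sets (N a \<Otimes>\<^sub>M lborel)"
        using nl unfolding vol_def null_sets_def by blast
    qed
    moreover have UB: "(\<Union>n. Z n) \<in> bundle_borel" by (rule bundle_borel_ops(4)) (rule ZB)
    ultimately have "region a (\<Union>n. Z n) \<in> null_sets (N a \<Otimes>\<^sub>M lborel)"
      by (meson null_sets_subset region_sets)
    then have "vol a (\<Union>n. Z n) = 0" by (simp add: vol_def null_setsD1)
    then have "AE x in N a. emeasure lborel (slice a (ct a x) (\<Union>n. Z n)) = 0"
      unfolding vol_eq[OF UB] using nn_integral_0_iff_AE[OF slice_measurable[OF UB]] by simp
    moreover have "emeasure lborel (slice a (ct a x) (\<Union>n. Z n)) \<noteq> 0" if x: "x \<in> space (N a)" for x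
    proof -
      have xT: "x \<in> Tr a" "x \<in> U a" "x \<in> topspace X" using x space_N Tr_sub U_sub by blast+
      obtain m1 where m1: "m1 \<in> C" "base m1 = x" using meets xT(3) by blast
      obtain m0 where m0: "m0 \<in> Mhat" "base m0 = x" "m0 \<notin> C" using no[OF xT(3)] by blast
      obtain V where V: "open V" "V \<noteq> {}"
        "V \<subseteq> (\<Union>n::nat. slice a (ct a x) (rotated (sector (exp (s * real n))) C - rotated (sector (exp (- s * real n))) C))"
        by (rule fat_slice[OF C ct_in[OF xT(2)] s m1 m0(1,3,2) xT(2) refl])
      have "V \<subseteq> slice a (ct a x) (\<Union>n. Z n)" using V(3) by (fastforce simp: slice_def Z_def S_def)
      then have "emeasure lborel V \<le> emeasure lborel (slice a (ct a x) (\<Union>n. Z n))"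
        by (rule emeasure_mono) (rule slice_sets[OF UB xT(1)])
      then show ?thesis using emeasure_open_pos[OF V(1,2)] by auto
    qed
    ultimately have "AE x in N a. False" by (auto elim!: AE_mp intro!: AE_I2)
    then have "emeasure (N a) (space (N a)) = 0" by (simp add: AE_iff_null null_sets_def)
    then show False using nz by (simp add: space_N)
  qed
qed

end

context hyp_lam
begin

text \<open>The points whose fibre meets \<open>C\<close> and the points whose fibre is contained in \<open>C\<close> form closed unions
of leaves, both of them nonempty.\<close>

lemma affine_closed_full:
  assumes min: "minimal_lamination L" and \<nu>: "holonomy_invariant_measure L \<nu>"
    and C: "affine_closed C" and ne: "C \<noteq> {}"
  shows "C = Mhat"
proof -
  have cl: "closedin Mhat_top C" and CM: "C \<subseteq> Mhat" and stable: "\<And>m b. m \<in> C \<Longrightarrow> b \<in> affine_group \<Longrightarrow> act m b \<in> C"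
    using C closedin_Mhat_top by (auto simp: affine_closed_def)
  let ?Q1 = "{x \<in> topspace X. \<exists>m\<in>C. base m = x}" and ?Q2 = "{x \<in> topspace X. \<forall>m\<in>Mhat. base m = x \<longrightarrow> m \<in> C}"
  have plq: "plaque L a t \<subseteq> topspace X" for a t using U_sub by (auto simp: plaque_def)
  obtain m where m: "m \<in> C" using ne by blast
  have "?Q1 = topspace X"
  proof (rule saturated_closed_full[OF min closed_meeting[OF cl]])
    show "base m \<in> ?Q1" using m CM base_in by blast
    fix a t x x' assume x: "x \<in> ?Q1" "x \<in> plaque L a t" "x' \<in> plaque L a t"
    then obtain k where k: "k \<in> C" "base k = x" by blast
    have kM: "k \<in> Mhat" using k CM by blast
    obtain b where "b \<in> affine_group" "base (act k b) = x'"
      using plaque_affine[OF kM] k(2) x(2,3) by metis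
    then show "x' \<in> ?Q1" using stable k(1) x(3) plq by blast
  qed
  then have meets: "\<forall>x\<in>topspace X. \<exists>m\<in>C. base m = x" by blast
  obtain a0 y0 where a0: "y0 \<in> D a0" "emeasure (\<nu> (transversal L a0 y0)) (transversal L a0 y0) \<noteq> 0"
    using \<nu> unfolding holonomy_invariant_measure_def by blast
  define y where "y a = (if a = a0 then y0 else (SOME z. z \<in> D a))" for a
  have y: "y a \<in> D a" for a using a0(1) D_ne[of a] by (auto simp: y_def some_in_eq)
  interpret hyp_lam_measure L \<nu> y by unfold_locales (use y \<nu> in auto)
  have "\<exists>x\<in>topspace X. \<forall>m\<in>Mhat. base m = x \<longrightarrow> m \<in> C"
    by (rule full_fibre_exists[OF C meets, of a0]) (use a0(2) in \<open>simp add: y_def\<close>)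
  then obtain x0 where x0: "x0 \<in> ?Q2" by blast
  have "?Q2 = topspace X"
  proof (rule saturated_closed_full[OF min closed_containing[OF cl] x0])
    fix a t x x' assume x: "x \<in> ?Q2" "x \<in> plaque L a t" "x' \<in> plaque L a t"
    have "k \<in> C" if k: "k \<in> Mhat" "base k = x'" for k
    proof -
      obtain b where b: "b \<in> affine_group" "base (act k b) = x" using plaque_affine[OF k(1)] k(2) x(2,3) by metis
      obtain b' where b': "b' \<in> affine_group" "b * b' = 1" by (rule affine_inverse[OF b(1)])
      have "act k b \<in> C" using x(1) b(2) act_in[OF k(1)] by blast
      then have "act (act k b) b' \<in> C" using stable b'(1) by blast
      then show ?thesis by (simp add: act_act b'(2) act_1)
    qed
    then show "x' \<in> ?Q2" using x(3) plq by blast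
  qed
  then show ?thesis using CM base_in by blast
qed

lemma orbit_closure:
  assumes v: "v \<in> Mhat" shows "affine_closed (Mhat_top closure_of (act v ` affine_group))"
  unfolding affine_closed_def
proof (intro conjI ballI)
  fix m b assume m: "m \<in> Mhat_top closure_of (act v ` affine_group)" and b: "b \<in> affine_group"
  have "act m b \<in> (\<lambda>m. act m b) ` (Mhat_top closure_of (act v ` affine_group))" using m by blast
  also have "\<dots> \<subseteq> Mhat_top closure_of ((\<lambda>m. act m b) ` (act v ` affine_group))"
    by (rule continuous_map_image_closure_subset[OF continuous_act])
  also have "\<dots> \<subseteq> Mhat_top closure_of (act v ` affine_group)"
    by (rule closure_of_mono) (auto simp: act_act intro!: imageI affine_mult b)
  finally show "act m b \<in> Mhat_top closure_of (act v ` affine_group)" .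
qed (rule closedin_closure_of)

lemma orbit_dense:
  assumes "minimal_lamination L" "holonomy_invariant_measure L \<nu>" and v: "v \<in> Mhat"
  shows "Mhat_top closure_of (right_action L v ` affine_group) = Mhat"
proof -
  have "v \<in> act v ` affine_group" using one_affine act_1 by (metis imageI)
  moreover have "act v ` affine_group \<subseteq> topspace Mhat_top" using act_in[OF v] by (auto simp: topspace_Mhat_top)
  ultimately have "Mhat_top closure_of (act v ` affine_group) \<noteq> {}" using closure_of_subset by blast
  then have "Mhat_top closure_of (act v ` affine_group) = Mhat"
    by (rule affine_closed_full[OF assms(1,2) orbit_closure[OF v]])
  moreover have "right_action L v ` affine_group = act v ` affine_group" using right_action_eq[OF v] by simp
  ultimately show ?thesis by simp
qed

end

theorem theorem5:
  fixes L :: "('m, 'i, 't) lamination"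
  assumes "compact_hyperbolic_lamination L"
    and "minimal_lamination L"
    and "\<exists>\<nu>. holonomy_invariant_measure L \<nu>"
  shows "\<forall>v\<in>unit_bundle L.
    bundle_topology L closure_of (right_action L v ` affine_group) = unit_bundle L"
proof
  interpret hyp_lam L by unfold_locales (rule assms(1))
  fix v assume "v \<in> unit_bundle L"
  then show "bundle_topology L closure_of (right_action L v ` affine_group) = unit_bundle L"
    using orbit_dense[OF assms(2)] assms(3) by blast
qed

end
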